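(* Let $m\ge1$ and $\delta_1,\dots,\delta_m\ge0$, and suppose that $a_1=\delta_1N,\dots,a_m=\delta_mN$. For $u\in\mathbb{C}\setminus\{0\}$ let $\xi_m(u)$ be the largest real root of the algebraic equation in $x$ $$\prod_{k=1}^m(\delta_k-\delta_m+|u|^2x)-|u|^2=0,$$ let $$\rho=\frac1{|u|\sqrt{\sum_{k=1}^m\frac1{\delta_k-\delta_m+|u|^2\xi_m(u)}}},$$ and introduce rescaled variables $z_k=u+\frac{v_k}{\rho\sqrt N}$, $k=1,\dots,n$. Then the following hold uniformly for $v_1,\dots,v_n$ in any compact subset of $\mathbb{C}$. (1) Bulk limit. For $\sqrt{\delta_1\cdots\delta_m}<|u|<\sqrt{(1+\delta_1)\cdots(1+\delta_m)}$, $$\lim_{N\to\infty}N^{n(m-1)}\rho^{-2n}R_{N,n}\big(N^{m/2}z_1,\dots,N^{m/2}z_n\big)=\det\Big(\frac1\pi e^{-\frac12(|v_k|^2+|v_j|^2-2v_k\overline{v_j})}\Big)_{1\le k,j\le n}.$$ (2) Inner edge. For $\delta_1,\dots,\delta_m>0$ and $u=\sqrt{\delta_1\cdots\delta_m}\,e^{i\phi}$ with $0\le\phi<2\pi$, $$\lim_{N\to\infty}N^{n(m-1)}\rho^{-2n}R_{N,n}\big(N^{m/2}z_1,\dots,N^{m/2}z_n\big)=\det\Big(\frac1{2\pi}e^{-\frac12(|v_k|^2+|v_j|^2-2v_k\overline{v_j})}\,\mathrm{erfc}\Big(-\frac{e^{i\phi}\overline{v_j}+e^{-i\phi}v_k}{\sqrt2}\Big)\Big)_{1\le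 k,j\le n}.$$ (3) Outer edge. For $u=\sqrt{(1+\delta_1)\cdots(1+\delta_m)}\,e^{i\phi}$ with $0\le\phi<2\pi$, $$\lim_{N\to\infty}N^{n(m-1)}\rho^{-2n}R_{N,n}\big(N^{m/2}z_1,\dots,N^{m/2}z_n\big)=\det\Big(\frac1{2\pi}e^{-\frac12(|v_k|^2+|v_j|^2-2v_k\overline{v_j})}\,\mathrm{erfc}\Big(\frac{e^{i\phi}\overline{v_j}+e^{-i\phi}v_k}{\sqrt2}\Big)\Big)_{1\le k,j\le n}.$$
   Context: $R_{N,n}$ is the $n$-point eigenvalue correlation function of the product $X_mX_{m-1}\cdots X_1$ of independent $N\times N$ matrices, $X_k$ having density proportional to $(\det X_k^*X_k)^{a_k}e^{-\mathrm{tr}(X_k^*X_k)}$. It is given explicitly by $R_{N,n}(z_1,\dots,z_n)=\det\big(K_N(z_j,z_k)\big)_{1\le j,k\le n}$, where $$K_N(z,z')=\sqrt{w_m(z)w_m(\overline{z'})}\sum_{l=0}^{N-1}\prod_{k=1}^m\frac{\Gamma(a_k+1)}{\Gamma(a_k+l+1)}(z\overline{z'})^l,$$ $$w_m(z)=|z|^{2a_m}\frac{2^{m-1}}{\pi}\prod_{k=1}^m\frac1{\Gamma(a_k+1)}\int_{\mathbb{R}_+^{m-1}}\exp\Big\{-\sum_{k=1}^{m-1}r_k^2-\frac{|z|^2}{r_1^2\cdots r_{m-1}^2}\Big\}\prod_{k=1}^{m-1}r_k^{2(a_k-a_m)-1}\,d^{m-1}r$$ (for $m=1$ the integral is read as $e^{-|z|^2}$).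 Here $\mathrm{erfc}=1-\mathrm{erf}$ is the (entire) complementary error function. *)

theory Defs
  imports "HOL-Complex_Analysis.Cauchy_Integral_Theorem"
begin

definition erf :: "complex \<Rightarrow> complex" where
  "erf z = of_real (2 / sqrt pi) * contour_integral (linepath 0 z) (\<lambda>t. exp (- (t ^ 2)))"

definition erfc :: "complex \<Rightarrow> complex" where
  "erfc z = 1 - erf z"

lemma erf_0 [simp]: "erf 0 = 0"
  by (simp add: erf_def)

lemma has_field_derivative_erf:
  "(erf has_field_derivative of_real (2 / sqrt pi) * exp (- (z ^ 2))) (at z)"
proof -
  have hol: "(\<lambda>t::complex. exp (- (t ^ 2))) holomorphic_on UNIV"
    by (intro holomorphic_intros)
  obtain F :: "complex \<Rightarrow> complex" where F: "\<And>x. (F has_field_derivative exp (- (x ^ 2))) (at x)"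
    using holomorphic_convex_primitive'[OF convex_UNIV open_UNIV hol] by auto
  have "contour_integral (linepath 0 w) (\<lambda>t. exp (- (t ^ 2))) = F w - F 0" for w
    using contour_integral_unique[OF contour_integral_primitive[of UNIV F "\<lambda>t. exp (- (t ^ 2))" "linepath 0 w"]] F
    by simp
  then have "erf = (\<lambda>w. of_real (2 / sqrt pi) * (F w - F 0))"
    by (simp add: erf_def fun_eq_iff)
  moreover have "((\<lambda>w. of_real (2 / sqrt pi) * (F w - F 0)) has_field_derivative
      of_real (2 / sqrt pi) * exp (- (z ^ 2))) (at z)"
    by (rule DERIV_cmult, rule DERIV_diff[OF F DERIV_const, simplified])
  ultimately show ?thesis by simp
qed

text \<open>
  The parameters \<open>a 1, \<dots>, a m\<close> and the radii \<open>r 1, \<dots>, r (m - 1)\<close> are indexed from 1. For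
  \<open>m = 1\<close> the product space has a single point, of mass 1, so that the integral is
  \<open>exp (- \<bar>z\<bar>\<^sup>2)\<close>. The value at \<open>z = 0\<close> is not meaningful in general: the integral may
  diverge there (and then has the value 0 by convention), and \<open>0 powr 0 = 0\<close>.
\<close>
definition weight :: "nat \<Rightarrow> (nat \<Rightarrow> real) \<Rightarrow> complex \<Rightarrow> real" where
  "weight m a z =
     cmod z powr (2 * a m) * (2 ^ (m - 1) / pi) * (\<Prod>k=1..m. 1 / Gamma (a k + 1)) *
     (LINT r : (\<Pi>\<^sub>E k\<in>{1..<m}. {0<..}) | (\<Pi>\<^sub>M k\<in>{1..<m}. lborel).
        exp (- (\<Sum>k=1..<m. (r k)\<^sup>2) - (cmod z)\<^sup>2 / (\<Prod>k=1..<m. (r k)\<^sup>2)) *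
        (\<Prod>k=1..<m. r k powr (2 * (a k - a m) - 1)))"

definition corr_kernel :: "nat \<Rightarrow> (nat \<Rightarrow> real) \<Rightarrow> nat \<Rightarrow> complex \<Rightarrow> complex \<Rightarrow> complex" where
  "corr_kernel m a N z z' =
     of_real (sqrt (weight m a z * weight m a (cnj z'))) *
     (\<Sum>l<N. of_real (\<Prod>k=1..m. Gamma (a k + 1) / Gamma (a k + real l + 1)) * (z * cnj z') ^ l)"

text \<open>
  The \<open>n\<close>-point eigenvalue correlation function of the product \<open>X\<^sub>m \<cdots> X\<^sub>1\<close> of independent
  \<open>N \<times> N\<close> matrices with densities proportional to
  \<open>det (X\<^sub>k\<^sup>* X\<^sub>k) powr a k * exp (- tr (X\<^sub>k\<^sup>* X\<^sub>k))\<close>, given by its determinantal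
  formula; \<open>n = CARD('n)\<close>.
\<close>
definition corr_fun :: "nat \<Rightarrow> (nat \<Rightarrow> real) \<Rightarrow> nat \<Rightarrow> complex ^ 'n \<Rightarrow> complex" where
  "corr_fun m a N z = det (\<chi> j k. corr_kernel m a N (z $ j) (z $ k))"

text \<open>
  For \<open>m \<ge> 1\<close> and \<open>u \<noteq> 0\<close> the equation is polynomial of degree \<open>m\<close> in \<open>x\<close> and has a root
  beyond the largest zero of the product, so the greatest root exists.
\<close>
definition xi :: "nat \<Rightarrow> (nat \<Rightarrow> real) \<Rightarrow> complex \<Rightarrow> real" where
  "xi m \<delta> u =
     (GREATEST x. (\<Prod>k=1..m. \<delta> k - \<delta> m + (cmod u)\<^sup>2 * x) - (cmod u)\<^sup>2 = 0)"

definition rho :: "nat \<Rightarrow> (nat \<Rightarrow> real) \<Rightarrow> complex \<Rightarrow> real" where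
  "rho m \<delta> u =
     1 / (cmod u * sqrt (\<Sum>k=1..m. 1 / (\<delta> k - \<delta> m + (cmod u)\<^sup>2 * xi m \<delta> u)))"

definition rescaled_point ::
  "nat \<Rightarrow> (nat \<Rightarrow> real) \<Rightarrow> complex \<Rightarrow> nat \<Rightarrow> complex \<Rightarrow> complex" where
  "rescaled_point m \<delta> u N v = u + v / of_real (rho m \<delta> u * sqrt (real N))"

definition rescaled_corr ::
  "nat \<Rightarrow> (nat \<Rightarrow> real) \<Rightarrow> complex \<Rightarrow> nat \<Rightarrow> complex ^ 'n \<Rightarrow> complex" where
  "rescaled_corr m \<delta> u N v =
     of_real (real N ^ (CARD('n) * (m - 1)) / rho m \<delta> u ^ (2 * CARD('n))) *
     corr_fun m (\<lambda>k. \<delta> k * real N) N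
       (\<chi> k. of_real (real N powr (real m / 2)) * rescaled_point m \<delta> u N (v $ k))"

end

theory Submission
  imports Defs "HOL-Probability.Probability" "HOL-Real_Asymp.Real_Asymp"
begin

text \<open>
  The \<open>l\<close>-th term of \<open>K\<^sub>N(z, z)\<close>, multiplied by \<open>\<pi> \<bar>z\<bar>\<^sup>2\<close>, is the density at \<open>ln \<bar>z\<bar>\<^sup>2\<close> of a sum of \<open>m\<close>
  independent variables \<open>ln G\<^sub>k\<close>, where \<open>G\<^sub>k\<close> is Gamma distributed with shape \<open>a\<^sub>k + l + 1\<close>: the substitution
  \<open>r\<^sub>k\<^sup>2 = exp \<eta>\<^sub>k\<close> turns the integral in the weight into an iterated convolution. For \<open>z \<noteq> z'\<close> the
  \<open>l\<close>-th term times \<open>\<pi> \<bar>z z'\<bar>\<close> is the geometric mean of the two densities times \<open>exp (i l (arg z - arg z'))\<close>.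

  A local limit theorem (dominated convergence in the convolution) makes the rescaled density
  Gaussian with variance \<open>\<Sum> 1 / (\<delta>\<^sub>k + y)\<close> when \<open>l = y N + t \<surd>N\<close> and \<open>\<Prod> (\<delta>\<^sub>k + y) = \<bar>u\<bar>\<^sup>2\<close>, that is
  \<open>y = \<bar>u\<bar>\<^sup>2 \<xi>\<^sub>m(u) - \<delta>\<^sub>m\<close>. As a function of \<open>l\<close> the density is log-concave, which gives an exponential
  bound on its tails. So the sum over \<open>l\<close> becomes a Gaussian integral in \<open>t\<close>, over the whole line if
  \<open>0 < y < 1\<close> (bulk), and over a half-line, which produces \<open>erfc\<close>, if \<open>y = 0\<close> or \<open>y = 1\<close> (edges).
  The remaining phases have the form \<open>c\<^sub>j / c\<^sub>k\<close> and cancel in the determinant.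
\<close>

section \<open>The logarithm of a Gamma variable\<close>

text \<open>The entries of the rescaled kernel need not have a limit: with
  \<open>w = z / (N^(m/2) u)\<close> they carry phases \<open>exp (i y N Im (Ln w))\<close> that
  turn at the rate sqrt N. These phases are therefore split off exactly, before any limit is taken.
  The points move with N and the convergence has to be uniform on compact sets. For this reason
  limits are proved along convergent sequences of arguments (continuous convergence), and
  compactness yields uniformity only at the very end. Stirling's formula does not enter: the size of
  the Gamma normalisation is read off from the fact that \<open>lgam\<close> has total mass one. Nor
  is the density of the sum needed in closed form to control its dependence on \<open>l\<close>: all
  terms share one weight integral, so the ratio of consecutive terms is explicit and decreasing in
  \<open>l\<close>. The condition \<open>\<delta> k + y > 0\<close> makes every shape parameter grow
  linearly in N, so that every factor becomes Gaussian; at the inner edge, where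
  \<open>y = 0\<close>, it is the positivity of the \<open>\<delta> k\<close>.\<close>

lemma nn_integral_exp_substitution:
  fixes f :: "real \<Rightarrow> ennreal"
  assumes [measurable]: "f \<in> borel_measurable borel" and c: "c > 0"
  shows "(\<integral>\<^sup>+x. f x * indicator {0<..} x \<partial>lborel)
       = (\<integral>\<^sup>+y. f (exp (c * y)) * ennreal (c * exp (c * y)) \<partial>lborel)"
proof -
  define g where "g = (\<lambda>y. f (exp (c * y)) * ennreal (c * exp (c * y)))"
  have [measurable]: "g \<in> borel_measurable borel" unfolding g_def by measurable
  define A where "A = (\<lambda>n::nat. {exp (c * (- (1 + real n)))..exp (c * (1 + real n))})"
  define B where "B = (\<lambda>n::nat. {- (1 + real n)..1 + real n})"
  have UA: "(\<Union>n. A n) = {0<..}"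
  proof (intro equalityI subsetI)
    fix x :: real assume x: "x \<in> {0<..}"
    obtain n :: nat where n: "\<bar>ln x\<bar> / c \<le> real n" using real_arch_simple by blast
    have "\<bar>ln x\<bar> \<le> c * (1 + real n)" using n c by (simp add: field_simps)
    hence "c * (- (1 + real n)) \<le> ln x" "ln x \<le> c * (1 + real n)" by linarith+
    hence "exp (c * (- (1 + real n))) \<le> exp (ln x)" "exp (ln x) \<le> exp (c * (1 + real n))"
      by (simp_all only: exp_le_cancel_iff)
    moreover have "exp (ln x) = x" using x by simp
    ultimately have "x \<in> A n" unfolding A_def by (simp only: atLeastAtMost_iff simp_thms)
    thus "x \<in> (\<Union>n. A n)" by blast
  qed (auto simp: A_def intro: less_le_trans[OF exp_gt_zero])
  have UB: "(\<Union>n. B n) = UNIV"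
  proof (intro equalityI subsetI)
    fix x :: real
    obtain n :: nat where n: "\<bar>x\<bar> \<le> real n" using real_arch_simple by blast
    hence "x \<in> B n" by (auto simp: B_def)
    thus "x \<in> (\<Union>n. B n)" by blast
  qed auto
  have incA: "incseq A" unfolding A_def incseq_def using c
    by (auto intro: order_trans[rotated] order_trans)
  have incB: "incseq B" unfolding B_def incseq_def by auto
  have eq: "(\<integral>\<^sup>+x. f x * indicator (A n) x \<partial>lborel) = (\<integral>\<^sup>+y. g y * indicator (B n) y \<partial>lborel)" for n
    unfolding A_def B_def g_def
    by (rule nn_integral_substitution_aux)
       (use c in \<open>auto intro!: derivative_eq_intros continuous_intros\<close>)
  have "(\<integral>\<^sup>+x. f x * indicator {0<..} x \<partial>lborel) = emeasure (density lborel f) (\<Union>n. A n)"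
    by (simp add: emeasure_density UA)
  also have "\<dots> = (SUP n. emeasure (density lborel f) (A n))"
    by (rule SUP_emeasure_incseq[symmetric]) (use incA in \<open>auto simp: A_def\<close>)
  also have "\<dots> = (SUP n. emeasure (density lborel g) (B n))"
  proof (rule SUP_cong[OF refl])
    fix n
    have "A n \<in> sets lborel" "B n \<in> sets lborel" by (simp_all add: A_def B_def)
    thus "emeasure (density lborel f) (A n) = emeasure (density lborel g) (B n)"
      by (simp add: emeasure_density eq)
  qed
  also have "\<dots> = emeasure (density lborel g) (\<Union>n. B n)"
    by (rule SUP_emeasure_incseq) (use incB in \<open>auto simp: B_def\<close>)
  also have "\<dots> = (\<integral>\<^sup>+y. g y \<partial>lborel)"
    by (simp add: emeasure_density UB)
  finally show ?thesis unfolding g_def .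
qed

lemma integrable_exp_neg_abs:
  fixes b :: real assumes "b > 0"
  shows "integrable lborel (\<lambda>x. exp (- b * \<bar>x\<bar>))"
proof -
  have "set_integrable lborel {0<..} (\<lambda>x. exp (- (x * b)))"
    by (rule integrable_I0i_exp_mscale[OF assms])
  hence "integrable lborel (\<lambda>x. indicator {0<..} x *\<^sub>R exp (- b * \<bar>x\<bar>))"
    unfolding set_integrable_def
    by (rule Bochner_Integration.integrable_cong[THEN iffD1, rotated -1]) (auto simp: indicator_def mult.commute)
  hence "integrable lborel (\<lambda>x. indicator {0..} x *\<^sub>R exp (- b * \<bar>x\<bar>))"
    by (rule integrable_discrete_difference[where X="{0}", THEN iffD1, rotated 4])
       (auto split: split_indicator)
  hence "has_bochner_integral lborel (\<lambda>x. indicator {0..} x *\<^sub>R exp (- b * \<bar>x\<bar>))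
      (\<integral>x. indicator {0..} x *\<^sub>R exp (- b * \<bar>x\<bar>) \<partial>lborel)"
    by (simp add: has_bochner_integral_iff)
  from has_bochner_integral_even_function[OF this] show ?thesis
    by (simp add: has_bochner_integral_iff)
qed

text \<open>Density of \<open>ln G\<close> for a Gamma variable \<open>G\<close> of shape \<kappa>
  and scale 1. Its mode is \<open>ln \<kappa>\<close>.\<close>

definition lgam :: "real \<Rightarrow> real \<Rightarrow> real" where
  "lgam \<kappa> y = exp (\<kappa> * y - exp y) / Gamma \<kappa>"

lemma lgam_nonneg [simp]: "\<kappa> > 0 \<Longrightarrow> 0 \<le> lgam \<kappa> y"
  by (simp add: lgam_def Gamma_real_pos less_imp_le)

lemma measurable_lgam [measurable]: "lgam \<kappa> \<in> borel_measurable borel"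
  unfolding lgam_def[abs_def] by measurable

lemma nn_integral_lgam:
  assumes "\<kappa> > 0" shows "(\<integral>\<^sup>+y. ennreal (lgam \<kappa> y) \<partial>lborel) = 1"
proof -
  have G: "Gamma \<kappa> > 0" using assms by (rule Gamma_real_pos)
  have "ennreal (Gamma \<kappa>) = (\<integral>\<^sup>+t. ennreal (indicator {0..} t * t powr (\<kappa> - 1) / exp t) \<partial>lborel)"
    using Gamma_conv_nn_integral_real[OF assms] by simp
  also have "\<dots> = (\<integral>\<^sup>+t. ennreal (t powr (\<kappa> - 1) / exp t) * indicator {0<..} t \<partial>lborel)"
    by (intro nn_integral_cong_AE AE_I[of _ _ "{0}"]) (auto simp: indicator_def)
  also have "\<dots> = (\<integral>\<^sup>+y. ennreal (exp (1 * y) powr (\<kappa> - 1) / exp (exp (1 * y))) * ennreal (1 * exp (1 * y)) \<partial>lborel)"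
    by (rule nn_integral_exp_substitution) auto
  also have "\<dots> = (\<integral>\<^sup>+y. ennreal (Gamma \<kappa>) * ennreal (lgam \<kappa> y) \<partial>lborel)"
    using G
    by (intro nn_integral_cong)
       (auto simp: lgam_def ennreal_mult[symmetric] powr_def exp_diff exp_add[symmetric] field_simps)
  also have "\<dots> = ennreal (Gamma \<kappa>) * (\<integral>\<^sup>+y. ennreal (lgam \<kappa> y) \<partial>lborel)"
    by (rule nn_integral_cmult) measurable
  finally have "ennreal (Gamma \<kappa>) * 1 = ennreal (Gamma \<kappa>) * (\<integral>\<^sup>+y. ennreal (lgam \<kappa> y) \<partial>lborel)" by simp
  thus ?thesis using G by (subst (asm) ennreal_mult_cancel_left) auto
qed

lemma integral_lgam: "\<kappa> > 0 \<Longrightarrow> (\<integral>y. lgam \<kappa> y \<partial>lborel) = 1"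
  by (subst integral_eq_nn_integral) (auto simp: nn_integral_lgam)

section \<open>Peak, shape and Gaussian limit of the density\<close>

definition lgam_peak :: "real \<Rightarrow> real" where
  "lgam_peak \<kappa> = exp (\<kappa> * ln \<kappa> - \<kappa>) / Gamma \<kappa>"

text \<open>The density divided by its maximum, in the unit \<open>1 / sqrt \<kappa>\<close> around
  the mode; in this unit minus its logarithm has second derivative 1 at the mode. The constant
  \<open>Gamma \<kappa>\<close> sits entirely in the peak.\<close>

definition lgam_shape :: "real \<Rightarrow> real \<Rightarrow> real" where
  "lgam_shape \<kappa> h = exp (- \<kappa> * (exp (h / sqrt \<kappa>) - 1 - h / sqrt \<kappa>))"

lemma lgam_conv_shape:
  assumes "\<kappa> > 0" shows "lgam \<kappa> (ln \<kappa> + h / sqrt \<kappa>) = lgam_peak \<kappa> * lgam_shape \<kappa> h"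
  using assms by (simp add: lgam_def lgam_peak_def lgam_shape_def exp_add exp_diff[symmetric] exp_add[symmetric] algebra_simps)

lemma lgam_le_peak:
  assumes "\<kappa> > 0" shows "lgam \<kappa> y \<le> lgam_peak \<kappa>"
proof -
  have "1 + (y - ln \<kappa>) \<le> exp (y - ln \<kappa>)" by (rule exp_ge_add_one_self)
  hence "\<kappa> * (1 + (y - ln \<kappa>)) \<le> \<kappa> * (exp y / \<kappa>)"
    using assms by (intro mult_left_mono) (auto simp: exp_diff)
  hence "\<kappa> * y - exp y \<le> \<kappa> * ln \<kappa> - \<kappa>" using assms by (simp add: algebra_simps)
  thus ?thesis unfolding lgam_def lgam_peak_def using Gamma_real_pos[OF assms]
    by (intro divide_right_mono) auto
qed

lemma measurable_lgam_shape [measurable]: "lgam_shape \<kappa> \<in> borel_measurable borel"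
  unfolding lgam_shape_def[abs_def] by measurable

text \<open>By convexity, exp lies above its tangents at \<open>a\<close> and \<open>-a\<close> with
  \<open>a = 1 / sqrt \<kappa>\<close>. Since \<open>\<kappa> * a\<^sup>2 = 1\<close>, shifting the
  point of tangency costs a constant that does not depend on \<kappa>. A Gaussian bound is
  impossible: for fixed \<kappa> the left tail decays only exponentially.\<close>

lemma lgam_shape_le:
  assumes "\<kappa> \<ge> 1" shows "lgam_shape \<kappa> h \<le> exp (1 - \<bar>h\<bar> / 2)"
proof -
  have tangent: "exp a * (1 + x - a) \<le> exp x" for a x :: real
    using exp_ge_add_one_self[of "x - a"] by (simp add: exp_diff field_simps)
  define a where "a = 1 / sqrt \<kappa>"
  have a: "0 < a" "a \<le> 1" "\<kappa> * a\<^sup>2 = 1" using assms by (auto simp: a_def power_divide)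
  define x where "x = h * a"
  have hx: "\<kappa> * (a * x) = h" using a by (simp add: x_def power2_eq_square algebra_simps)
  have "\<bar>h\<bar> / 2 - 1 \<le> \<kappa> * (exp x - 1 - x)"
  proof (cases "h \<ge> 0")
    case True
    have x0: "x \<ge> 0" using True a by (simp add: x_def)
    have "(1 + a) * (1 - a) \<le> exp a * (1 - a)" using a by (intro mult_right_mono) auto
    moreover have "(1 + a) * x \<le> exp a * x" using x0 by (intro mult_right_mono) auto
    ultimately have "a * x - a\<^sup>2 \<le> exp x - 1 - x" using tangent[of a x] by (simp add: power2_eq_square algebra_simps)
    hence "\<kappa> * (a * x - a\<^sup>2) \<le> \<kappa> * (exp x - 1 - x)" using assms by simp
    thus ?thesis using hx a True by (simp add: algebra_simps)
  next
    case False
    have x0: "x \<le> 0" using False a by (simp add: x_def mult_nonpos_nonneg)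
    \<comment> \<open>The origin of the 1/2 in the bound:
      \<open>(1 + a) * (1 - a / 2) \<ge> 1\<close> for \<open>0 \<le> a \<le> 1\<close>.\<close>
    have e: "exp (-a) \<le> 1 - a / 2"
    proof -
      have "1 + a \<le> exp a" by (rule exp_ge_add_one_self)
      hence "exp (-a) \<le> 1 / (1 + a)" using a by (simp add: exp_minus field_simps)
      also have "\<dots> \<le> 1 - a / 2" using a by (simp add: field_simps)
      finally show ?thesis .
    qed
    have "(1 - a) * (1 + a) \<le> exp (-a) * (1 + a)"
      using a exp_ge_add_one_self[of "-a"] by (intro mult_right_mono) auto
    moreover have "(1 - a / 2) * x \<le> exp (-a) * x" using x0 e by (intro mult_right_mono_neg) auto
    ultimately have "- (a * x) / 2 - a\<^sup>2 \<le> exp x - 1 - x" using tangent[of "-a" x]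
      by (simp add: power2_eq_square algebra_simps)
    hence "\<kappa> * (- (a * x) / 2 - a\<^sup>2) \<le> \<kappa> * (exp x - 1 - x)" using assms by simp
    thus ?thesis using hx a False by (simp add: algebra_simps)
  qed
  thus ?thesis by (simp add: lgam_shape_def x_def a_def algebra_simps)
qed

text \<open>Left of the mode, \<open>exp (-x) \<le> 1 - x + x\<^sup>2 / 2\<close> keeps the shape
  above \<open>exp (- h\<^sup>2 / 2)\<close>. The mass on \<open>{-1..0}\<close> is thus bounded
  below uniformly in \<kappa>, and this caps the peak in \<open>lgam_peak_le\<close>.\<close>

lemma lgam_shape_ge:
  assumes "\<kappa> > 0" "h \<le> 0" "-1 \<le> h" shows "exp (-1/2) \<le> lgam_shape \<kappa> h"
proof -
  define x where "x = - h / sqrt \<kappa>"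
  have x0: "x \<ge> 0" using assms by (simp add: x_def divide_nonpos_pos)
  have "1 - x + x\<^sup>2 / 2 \<ge> exp (-x)"
  proof -
    have "exp (-x) - (1 - x + x\<^sup>2 / 2) \<le> exp (-0) - (1 - 0 + 0\<^sup>2 / 2)"
      by (rule DERIV_nonpos_imp_nonincreasing[OF x0, where f="\<lambda>x. exp (-x) - (1 - x + x\<^sup>2 / 2)"])
         (auto intro!: exI derivative_eq_intros, use exp_ge_add_one_self in \<open>smt (verit) \<close>)
    thus ?thesis by simp
  qed
  hence "\<kappa> * (exp (-x) - 1 + x) \<le> \<kappa> * (x\<^sup>2 / 2)" using assms by simp
  also have "\<dots> = h\<^sup>2 / 2" using assms by (simp add: x_def power_divide)
  also have "\<dots> \<le> 1 / 2" using assms by (simp add: abs_square_le_1 abs_le_iff)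
  finally have "exp (-1/2) \<le> exp (- (\<kappa> * (exp (-x) - 1 + x)))" by simp
  also have "\<dots> = lgam_shape \<kappa> h" by (simp add: lgam_shape_def x_def)
  finally show ?thesis .
qed

lemma integrable_lgam_shape:
  assumes "\<kappa> \<ge> 1" shows "integrable lborel (lgam_shape \<kappa>)"
proof (rule Bochner_Integration.integrable_bound)
  show "integrable lborel (\<lambda>h::real. exp 1 * exp (- (1/2) * \<bar>h\<bar>))"
    by (intro integrable_mult_right integrable_exp_neg_abs) simp
  show "AE x in lborel. norm (lgam_shape \<kappa> x) \<le> norm (exp 1 * exp (- (1/2) * \<bar>x\<bar>))"
    using lgam_shape_le[OF assms] by (auto simp: exp_add[symmetric] abs_of_pos lgam_shape_def)
qed measurable

text \<open>Total mass one, written in the coordinate \<open>h\<close>. It replaces Stirling's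
  formula: the peak is governed by the integral of a function with an elementary limit.\<close>

lemma lgam_peak_integral_shape:
  assumes "\<kappa> \<ge> 1" shows "lgam_peak \<kappa> * (\<integral>h. lgam_shape \<kappa> h \<partial>lborel) = sqrt \<kappa>"
proof -
  have "1 = (\<integral>y. lgam \<kappa> y \<partial>lborel)" using assms by (simp add: integral_lgam)
  also have "\<dots> = \<bar>1 / sqrt \<kappa>\<bar> *\<^sub>R (\<integral>h. lgam \<kappa> (ln \<kappa> + (1 / sqrt \<kappa>) * h) \<partial>lborel)"
    by (rule lborel_integral_real_affine) (use assms in auto)
  also have "(\<lambda>h. lgam \<kappa> (ln \<kappa> + (1 / sqrt \<kappa>) * h)) = (\<lambda>h. lgam_peak \<kappa> * lgam_shape \<kappa> h)"
    using assms by (simp add: lgam_conv_shape)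
  finally show ?thesis using assms by (simp add: field_simps)
qed

lemma lgam_peak_le:
  assumes "\<kappa> \<ge> 1" shows "lgam_peak \<kappa> \<le> exp (1/2) * sqrt \<kappa>"
proof -
  have pos: "lgam_peak \<kappa> > 0" using assms by (simp add: lgam_peak_def Gamma_real_pos)
  have "exp (-1/2) = (\<integral>h. (exp (-1/2) :: real) * indicator {-1..0::real} h \<partial>lborel)" by simp
  also have "\<dots> \<le> (\<integral>h. lgam_shape \<kappa> h \<partial>lborel)"
  proof (rule integral_mono)
    show "integrable lborel (\<lambda>h. (exp (-1/2) :: real) * indicator {-1..0::real} h)"
      by (intro integrable_mult_right integrable_real_indicator) auto
    show "exp (-1/2) * indicator {-1..0} h \<le> lgam_shape \<kappa> h" for h
      using assms lgam_shape_ge[of \<kappa> h] by (simp add: indicator_def) (simp add: lgam_shape_def)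
  qed (rule integrable_lgam_shape[OF assms])
  finally have "lgam_peak \<kappa> * exp (-1/2) \<le> sqrt \<kappa>"
    using lgam_peak_integral_shape[OF assms] pos by (metis mult_left_mono less_imp_le)
  hence "exp (1/2) * (lgam_peak \<kappa> * exp (-1/2)) \<le> exp (1/2) * sqrt \<kappa>" by simp
  thus ?thesis by (simp add: exp_minus field_simps)
qed

lemma tendsto_lgam_shape:
  assumes K: "filterlim K at_top sequentially" and h: "h \<longlonglongrightarrow> (h0::real)"
  shows "(\<lambda>n. lgam_shape (K n) (h n)) \<longlonglongrightarrow> exp (- h0\<^sup>2 / 2)"
proof -
  \<comment> \<open>The removable singularity is filled in, so that \<open>h n = 0\<close> needs no
    separate treatment.\<close>
  define r where "r = (\<lambda>x::real. if x = 0 then 1/2 else (exp x - 1 - x) / x\<^sup>2)"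
  have "((\<lambda>x::real. (exp x - 1 - x) / x\<^sup>2) \<longlongrightarrow> 1/2) (at 0)" by real_asymp
  hence "(r \<longlongrightarrow> r 0) (at 0)"
    unfolding r_def by (subst tendsto_cong[where g="\<lambda>x. (exp x - 1 - x) / x\<^sup>2"]) (auto simp: eventually_at_filter)
  hence cont: "isCont r 0" by (simp add: isCont_def)
  have rx: "exp x - 1 - x = r x * x\<^sup>2" for x by (simp add: r_def)
  have x0: "(\<lambda>n. h n / sqrt (K n)) \<longlonglongrightarrow> 0"
    by (rule real_tendsto_divide_at_top[OF h]) (rule filterlim_compose[OF sqrt_at_top K])
  have "(\<lambda>n. exp (- (r (h n / sqrt (K n)) * (h n)\<^sup>2))) \<longlonglongrightarrow> exp (- (r 0 * h0\<^sup>2))"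
    by (intro tendsto_intros isCont_tendsto_compose[OF cont] x0 h)
  moreover have "\<forall>\<^sub>F n in sequentially. K n > 0" using K by (simp add: filterlim_at_top_dense)
  hence "\<forall>\<^sub>F n in sequentially. exp (- (r (h n / sqrt (K n)) * (h n)\<^sup>2)) = lgam_shape (K n) (h n)"
    by eventually_elim (simp add: lgam_shape_def rx power_divide)
  ultimately show ?thesis by (subst (asm) tendsto_cong) (auto simp: r_def)
qed

lemma tendsto_lgam_peak:
  assumes K: "filterlim K at_top sequentially"
  shows "(\<lambda>n. lgam_peak (K n) / sqrt (K n)) \<longlonglongrightarrow> 1 / sqrt (2 * pi)"
proof -
  have ev: "\<forall>\<^sub>F n in sequentially. K n \<ge> 1" using K by (simp add: filterlim_at_top)
  \<comment> \<open>The dominating function is valid only for parameters at least 1; the truncation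
    makes it valid for every \<open>n\<close> and changes nothing eventually.\<close>
  define K' where "K' = (\<lambda>n. max 1 (K n))"
  have K': "filterlim K' at_top sequentially"
    using K unfolding K'_def by (rule filterlim_at_top_mono) simp
  have "(\<lambda>n. \<integral>h. lgam_shape (K' n) h \<partial>lborel) \<longlonglongrightarrow> (\<integral>h. exp (- (h::real)\<^sup>2 / 2) \<partial>lborel)"
  proof (rule integral_dominated_convergence[where w="\<lambda>h. exp 1 * exp (- (1/2) * \<bar>h\<bar>)"])
    show "integrable lborel (\<lambda>h::real. exp 1 * exp (- (1/2) * \<bar>h\<bar>))"
      by (intro integrable_mult_right integrable_exp_neg_abs) simp
    show "AE x in lborel. (\<lambda>n. lgam_shape (K' n) x) \<longlonglongrightarrow> exp (- x\<^sup>2 / 2)"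
      by (intro AE_I2 tendsto_lgam_shape K' tendsto_const)
    show "AE x in lborel. norm (lgam_shape (K' n) x) \<le> exp 1 * exp (- (1/2) * \<bar>x\<bar>)" for n
      using lgam_shape_le[of "K' n"] by (auto simp: exp_add[symmetric] K'_def lgam_shape_def)
  qed measurable
  also have "(\<integral>h. exp (- (h::real)\<^sup>2 / 2) \<partial>lborel) = sqrt (2 * pi) * (\<integral>h. std_normal_density h \<partial>lborel)"
    unfolding std_normal_density_def by simp
  also have "\<dots> = sqrt (2 * pi)" by simp
  finally have "(\<lambda>n. 1 / (\<integral>h. lgam_shape (K' n) h \<partial>lborel)) \<longlonglongrightarrow> 1 / sqrt (2 * pi)"
    by (intro tendsto_intros) auto
  moreover have "\<forall>\<^sub>F n in sequentially. 1 / (\<integral>h. lgam_shape (K' n) h \<partial>lborel) = lgam_peak (K n) / sqrt (K n)"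
    using ev
  proof eventually_elim
    case (elim n)
    have "(\<integral>h. lgam_shape (K n) h \<partial>lborel) \<noteq> 0"
      using lgam_peak_integral_shape[OF elim] elim by auto
    thus ?case using lgam_peak_integral_shape[OF elim] elim by (simp add: K'_def max_absorb2 field_simps)
  qed
  ultimately show ?thesis by (subst (asm) tendsto_cong)
qed

text \<open>The unit is \<open>1 / sqrt n\<close> for every factor, instead of the intrinsic
  \<open>1 / sqrt (K n)\<close>, so that the factors can be convolved with one another. The quotient
  of the two units tends to \<open>sqrt \<gamma>\<close>, which gives the variance
  \<open>1 / \<gamma>\<close>.\<close>

lemma tendsto_lgam_rescaled:
  assumes K: "(\<lambda>n. K n / real n) \<longlonglongrightarrow> \<gamma>" and \<gamma>: "\<gamma> > 0" and h: "h \<longlonglongrightarrow> h0"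
  shows "(\<lambda>n. 1 / sqrt (real n) * lgam (K n) (ln (K n) + h n / sqrt (real n)))
           \<longlonglongrightarrow> normal_density 0 (1 / sqrt \<gamma>) h0"
proof -
  have "filterlim (\<lambda>n. K n / real n * real n) at_top sequentially"
    by (rule filterlim_tendsto_pos_mult_at_top[OF K \<gamma>]) (rule filterlim_real_sequentially)
  hence Kt: "filterlim K at_top sequentially"
    by (rule filterlim_mono_eventually[OF _ order_refl order_refl])
       (rule eventually_mono[OF eventually_gt_at_top[of 0]], auto)
  have lim: "(\<lambda>n. sqrt (K n / real n) * (lgam_peak (K n) / sqrt (K n)) *
       lgam_shape (K n) (h n * sqrt (K n / real n))) \<longlonglongrightarrow>
       sqrt \<gamma> * (1 / sqrt (2 * pi)) * exp (- (h0 * sqrt \<gamma>)\<^sup>2 / 2)"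
    by (intro tendsto_mult tendsto_lgam_shape[OF Kt] tendsto_lgam_peak[OF Kt] tendsto_real_sqrt K h)
  have "\<forall>\<^sub>F n in sequentially. K n > 0" using Kt by (simp add: filterlim_at_top_dense)
  hence "\<forall>\<^sub>F n in sequentially. sqrt (K n / real n) * (lgam_peak (K n) / sqrt (K n)) *
       lgam_shape (K n) (h n * sqrt (K n / real n))
       = 1 / sqrt (real n) * lgam (K n) (ln (K n) + h n / sqrt (real n))"
    using eventually_gt_at_top[of 0]
  proof eventually_elim
    case (elim n)
    have "lgam (K n) (ln (K n) + h n / sqrt (real n)) = lgam (K n) (ln (K n) + (h n * sqrt (K n / real n)) / sqrt (K n))"
      using elim by (simp add: real_sqrt_divide)
    also have "\<dots> = lgam_peak (K n) * lgam_shape (K n) (h n * sqrt (K n / real n))"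
      by (rule lgam_conv_shape) (use elim in auto)
    finally show ?case using elim by (simp add: real_sqrt_divide)
  qed
  with lim have "(\<lambda>n. 1 / sqrt (real n) * lgam (K n) (ln (K n) + h n / sqrt (real n)))
      \<longlonglongrightarrow> sqrt \<gamma> * (1 / sqrt (2 * pi)) * exp (- (h0 * sqrt \<gamma>)\<^sup>2 / 2)" by (subst (asm) tendsto_cong)
  also have "sqrt \<gamma> * (1 / sqrt (2 * pi)) * exp (- (h0 * sqrt \<gamma>)\<^sup>2 / 2) = normal_density 0 (1 / sqrt \<gamma>) h0"
    using \<gamma> by (simp add: normal_density_def real_sqrt_divide real_sqrt_mult power_mult_distrib power_divide field_simps)
  finally show ?thesis .
qed

lemma lgam_rescaled_dominated:
  assumes K: "(\<lambda>n. K n / real n) \<longlonglongrightarrow> \<gamma>" and \<gamma>: "\<gamma> > 0" and K1: "\<And>n. K n \<ge> 1"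
  obtains D b where "D > 0" "b > 0"
    "\<forall>\<^sub>F n in sequentially. \<forall>h. 1 / sqrt (real n) * lgam (K n) (ln (K n) + h / sqrt (real n)) \<le> D * exp (- b * \<bar>h\<bar>)"
proof
  \<comment> \<open>Eventually \<open>K n / n\<close> lies between \<open>\<gamma> / 2\<close> and
    \<open>2 * \<gamma>\<close>: the upper value bounds the peak and gives \<open>D\<close>, the
    lower one bounds the decay and gives \<open>b\<close>.\<close>
  define D where "D = exp (1/2) * sqrt (2 * \<gamma>) * exp 1"
  define b where "b = sqrt (\<gamma> / 2) / 2"
  show "D > 0" "b > 0" using \<gamma> by (auto simp: D_def b_def)
  have "\<forall>\<^sub>F n in sequentially. K n / real n > \<gamma> / 2" "\<forall>\<^sub>F n in sequentially. K n / real n < 2 * \<gamma>"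
    using order_tendstoD(1)[OF K, of "\<gamma> / 2"] order_tendstoD(2)[OF K, of "2 * \<gamma>"] \<gamma> by simp_all
  thus "\<forall>\<^sub>F n in sequentially. \<forall>h. 1 / sqrt (real n) * lgam (K n) (ln (K n) + h / sqrt (real n)) \<le> D * exp (- b * \<bar>h\<bar>)"
    using eventually_gt_at_top[of 0]
  proof eventually_elim
    case (elim n)
    show ?case
    proof
      fix h :: real
      have k: "K n \<ge> 1" by (rule K1)
      have "lgam (K n) (ln (K n) + h / sqrt (real n)) = lgam (K n) (ln (K n) + (h * sqrt (K n / real n)) / sqrt (K n))"
        using elim k by (simp add: real_sqrt_divide)
      also have "\<dots> = lgam_peak (K n) * lgam_shape (K n) (h * sqrt (K n / real n))"
        by (rule lgam_conv_shape) (use k in auto)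
      also have "\<dots> \<le> (exp (1/2) * sqrt (K n)) * exp (1 - \<bar>h * sqrt (K n / real n)\<bar> / 2)"
        using k by (intro mult_mono lgam_peak_le lgam_shape_le) (auto simp: lgam_shape_def)
      finally have "1 / sqrt (real n) * lgam (K n) (ln (K n) + h / sqrt (real n)) \<le>
          exp (1/2) * sqrt (K n / real n) * exp (1 - \<bar>h\<bar> * sqrt (K n / real n) / 2)"
        using elim k by (simp add: real_sqrt_divide field_simps abs_mult)
      also have "\<dots> \<le> exp (1/2) * sqrt (2 * \<gamma>) * exp (1 - \<bar>h\<bar> * sqrt (\<gamma> / 2) / 2)"
        using elim \<gamma> by (intro mult_mono) (auto intro!: mult_left_mono)
      also have "\<dots> = D * exp (- b * \<bar>h\<bar>)"
        by (simp add: D_def b_def exp_add[symmetric] exp_diff exp_minus field_simps)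
      finally show "1 / sqrt (real n) * lgam (K n) (ln (K n) + h / sqrt (real n)) \<le> D * exp (- b * \<bar>h\<bar>)" .
    qed
  qed
qed

section \<open>Iterated convolutions\<close>

lemma dominated_convergence_eventually:
  fixes s :: "nat \<Rightarrow> 'a \<Rightarrow> 'b::{banach, second_countable_topology}"
  assumes "f \<in> borel_measurable M" "\<And>n. s n \<in> borel_measurable M" "integrable M w"
    and "AE x in M. (\<lambda>n. s n x) \<longlonglongrightarrow> f x"
    and "\<forall>\<^sub>F n in sequentially. \<forall>x. norm (s n x) \<le> w x"
  shows "(\<lambda>n. integral\<^sup>L M (s n)) \<longlonglongrightarrow> integral\<^sup>L M f"
proof -
  obtain n0 where n0: "\<And>n x. n \<ge> n0 \<Longrightarrow> norm (s n x) \<le> w x"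
    using assms(5) unfolding eventually_sequentially by blast
  have "(\<lambda>n. integral\<^sup>L M (s (n + n0))) \<longlonglongrightarrow> integral\<^sup>L M f"
  proof (rule integral_dominated_convergence[where w=w])
    show "AE x in M. (\<lambda>n. s (n + n0) x) \<longlonglongrightarrow> f x"
      using assms(4) by eventually_elim (rule LIMSEQ_ignore_initial_segment)
  qed (use assms n0 in auto)
  thus ?thesis by (rule LIMSEQ_offset)
qed

definition prob_density :: "(real \<Rightarrow> real) \<Rightarrow> bool" where
  "prob_density f \<longleftrightarrow> f \<in> borel_measurable borel \<and> (\<forall>x. 0 \<le> f x) \<and> (\<integral>\<^sup>+x. ennreal (f x) \<partial>lborel) = 1"

lemma prob_densityD:
  assumes "prob_density f"
  shows "f \<in> borel_measurable borel" "0 \<le> f x" "integrable lborel f" "(\<integral>x. f x \<partial>lborel) = 1"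
proof -
  show m: "f \<in> borel_measurable borel" and nn: "0 \<le> f x" for x
    using assms by (auto simp: prob_density_def)
  show i: "integrable lborel f"
    by (rule integrableI_nonneg) (use assms m nn in \<open>auto simp: prob_density_def\<close>)
  show "(\<integral>x. f x \<partial>lborel) = 1"
    by (subst integral_eq_nn_integral) (use assms m nn in \<open>auto simp: prob_density_def\<close>)
qed

lemma prob_density_lgam: "\<kappa> > 0 \<Longrightarrow> prob_density (lgam \<kappa>)"
  by (simp add: prob_density_def nn_integral_lgam)

lemma prob_density_affine:
  assumes "prob_density f" "c > 0" shows "prob_density (\<lambda>h. c * f (b + c * h))"
proof -
  have [measurable]: "f \<in> borel_measurable borel" and nn: "\<And>x. 0 \<le> f x" and I: "(\<integral>\<^sup>+x. ennreal (f x) \<partial>lborel) = 1"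
    using assms by (auto simp: prob_density_def)
  have "(\<integral>\<^sup>+x. ennreal (f x) \<partial>lborel) = \<bar>c\<bar> * (\<integral>\<^sup>+h. ennreal (f (b + c * h)) \<partial>lborel)"
    by (rule nn_integral_real_affine) (use assms in auto)
  also have "\<dots> = (\<integral>\<^sup>+h. ennreal (c * f (b + c * h)) \<partial>lborel)"
    using assms nn by (subst nn_integral_cmult[symmetric]) (auto simp: ennreal_mult)
  finally show ?thesis using I nn assms by (simp add: prob_density_def)
qed

text \<open>The seed \<open>g\<close> is kept apart from the other factors. In the weight it is the
  factor of index \<open>m\<close>, which has no integration variable of its own; in the limit
  theorem it has to be bounded and to converge along moving arguments, while the \<open>f k\<close>
  supply the integrable majorants.\<close>

primrec iconv :: "(real \<Rightarrow> real) \<Rightarrow> (nat \<Rightarrow> real \<Rightarrow> real) \<Rightarrow> nat \<Rightarrow> real \<Rightarrow> real" where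
  "iconv g f 0 = g"
| "iconv g f (Suc j) = (\<lambda>x. \<integral>h. f (Suc j) h * iconv g f j (x - h) \<partial>lborel)"

lemma iconv_bounds:
  assumes "\<And>k. k \<in> {1..j} \<Longrightarrow> prob_density (f k)"
    and "g \<in> borel_measurable borel" "\<And>x. 0 \<le> g x" "\<And>x. g x \<le> B"
  shows "iconv g f j \<in> borel_measurable borel \<and> (\<forall>x. 0 \<le> iconv g f j x \<and> iconv g f j x \<le> B)"
  using assms(1)
proof (induction j)
  case 0 thus ?case using assms by simp
next
  case (Suc j)
  hence [measurable]: "iconv g f j \<in> borel_measurable borel"
    and b: "\<And>x. 0 \<le> iconv g f j x" "\<And>x. iconv g f j x \<le> B" by auto
  have d: "prob_density (f (Suc j))" using Suc by auto
  note [measurable] = prob_densityD(1)[OF d]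
  have i: "integrable lborel (\<lambda>h. f (Suc j) h * B)"
    using prob_densityD(3)[OF d] by simp
  have B: "0 \<le> B" using b[of 0] by linarith
  have "(\<integral>h. f (Suc j) h * iconv g f j (x - h) \<partial>lborel) \<le> (\<integral>h. f (Suc j) h * B \<partial>lborel)" for x
    using prob_densityD(2)[OF d] b
    by (intro integral_mono' i mult_left_mono) (auto intro: mult_nonneg_nonneg B)
  hence "(\<integral>h. f (Suc j) h * iconv g f j (x - h) \<partial>lborel) \<le> B" for x
    using prob_densityD(4)[OF d] by simp
  moreover have "0 \<le> (\<integral>h. f (Suc j) h * iconv g f j (x - h) \<partial>lborel)" for x
    using prob_densityD(2)[OF d] b by (intro Bochner_Integration.integral_nonneg) auto
  moreover have "(\<lambda>x. \<integral>h. f (Suc j) h * iconv g f j (x - h) \<partial>lborel) \<in> borel_measurable borel"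
    by measurable
  ultimately show ?case by simp
qed

lemma ennreal_iconv_Suc:
  assumes "\<And>k. k \<in> {1..Suc j} \<Longrightarrow> prob_density (f k)"
    and "g \<in> borel_measurable borel" "\<And>x. 0 \<le> g x" "\<And>x. g x \<le> B"
  shows "ennreal (iconv g f (Suc j) x)
     = (\<integral>\<^sup>+h. ennreal (f (Suc j) h) * ennreal (iconv g f j (x - h)) \<partial>lborel)"
proof -
  have d: "prob_density (f (Suc j))" using assms by auto
  have I: "iconv g f j \<in> borel_measurable borel \<and> (\<forall>x. 0 \<le> iconv g f j x \<and> iconv g f j x \<le> B)"
    by (rule iconv_bounds) (use assms in auto)
  hence [measurable]: "iconv g f j \<in> borel_measurable borel"
    and b: "\<And>x. 0 \<le> iconv g f j x" "\<And>x. iconv g f j x \<le> B" by auto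
  note [measurable] = prob_densityD(1)[OF d]
  have "integrable lborel (\<lambda>h. f (Suc j) h * iconv g f j (x - h))"
  proof (rule Bochner_Integration.integrable_bound)
    show "integrable lborel (\<lambda>h. f (Suc j) h * B)" using prob_densityD(3)[OF d] by simp
    show "AE h in lborel. norm (f (Suc j) h * iconv g f j (x - h)) \<le> norm (f (Suc j) h * B)"
      using b prob_densityD(2)[OF d] by (intro AE_I2) (auto simp: abs_mult intro!: mult_left_mono intro: order_trans[OF _ abs_ge_self])
  qed measurable
  hence "ennreal (iconv g f (Suc j) x) = (\<integral>\<^sup>+h. ennreal (f (Suc j) h * iconv g f j (x - h)) \<partial>lborel)"
    using b prob_densityD(2)[OF d] by (simp add: nn_integral_eq_integral)
  thus ?thesis using b prob_densityD(2)[OF d] by (simp add: ennreal_mult)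
qed

text \<open>Each of the \<open>j + 1\<close> factors carries a Jacobian \<open>c\<close>, each of
  the \<open>j\<close> integrals uses one up, and the centres add. The rescaled factors thus
  recombine into the original density.\<close>

lemma iconv_affine:
  assumes "c > 0"
  shows "iconv (\<lambda>h. c * g (b 0 + c * h)) (\<lambda>k h. c * f k (b k + c * h)) j x
       = c * iconv g f j ((\<Sum>k\<le>j. b k) + c * x)"
proof (induction j arbitrary: x)
  case (Suc j)
  have "c * iconv g f (Suc j) ((\<Sum>k\<le>Suc j. b k) + c * x)
      = c * (\<bar>c\<bar> *\<^sub>R (\<integral>h. f (Suc j) (b (Suc j) + c * h) *
          iconv g f j ((\<Sum>k\<le>Suc j. b k) + c * x - (b (Suc j) + c * h)) \<partial>lborel))"
    unfolding iconv.simps by (subst lborel_integral_real_affine[where c=c and t="b (Suc j)"]) (use assms in auto)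
  also have "\<dots> = (\<integral>h. c * f (Suc j) (b (Suc j) + c * h) * (c * iconv g f j ((\<Sum>k\<le>j. b k) + c * (x - h))) \<partial>lborel)"
    using assms by (simp add: algebra_simps flip: integral_mult_right_zero)
  finally show ?case by (simp add: Suc)
qed simp

lemma integral_conv_normal_density:
  assumes "\<sigma> > 0" "\<tau> > 0"
  shows "(\<integral>h. normal_density 0 \<tau> h * normal_density 0 \<sigma> (x - h) \<partial>lborel)
       = normal_density 0 (sqrt (\<sigma>\<^sup>2 + \<tau>\<^sup>2)) x"
proof -
  have "(\<integral>\<^sup>+h. ennreal (normal_density 0 \<tau> h * normal_density 0 \<sigma> (x - h)) \<partial>lborel)
      = ennreal (normal_density 0 (sqrt (\<sigma>\<^sup>2 + \<tau>\<^sup>2)) x)"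
    using fun_cong[OF conv_normal_density_zero_mean[OF assms], of x] by (simp add: mult.commute)
  thus ?thesis by (subst integral_eq_nn_integral) auto
qed

text \<open>Convergence along a moving \<open>x n\<close> is what makes the induction work: under
  the integral the previous stage is evaluated at \<open>x n - h\<close>. The majorant is the
  exponential bound on the new factor times the bound \<open>B\<close> of the seed, which averaging
  against probability densities preserves.\<close>

lemma tendsto_iconv_normal_density:
  fixes G :: "nat \<Rightarrow> real \<Rightarrow> real" and F :: "nat \<Rightarrow> nat \<Rightarrow> real \<Rightarrow> real"
  assumes \<sigma>: "\<And>k. \<sigma> k > 0"
    and G: "\<And>x x0. x \<longlonglongrightarrow> x0 \<Longrightarrow> (\<lambda>n. G n (x n)) \<longlonglongrightarrow> normal_density 0 (\<sigma> 0) x0"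
    and Gm: "\<And>n. G n \<in> borel_measurable borel"
    and GB: "\<forall>\<^sub>F n in sequentially. \<forall>x. 0 \<le> G n x \<and> G n x \<le> B"
    and F: "\<And>k h. k \<in> {1..j} \<Longrightarrow> (\<lambda>n. F n k h) \<longlonglongrightarrow> normal_density 0 (\<sigma> k) h"
    and Fd: "\<And>k. k \<in> {1..j} \<Longrightarrow> \<forall>\<^sub>F n in sequentially. prob_density (F n k)"
    and FD: "\<And>k. k \<in> {1..j} \<Longrightarrow> \<exists>D b. b > 0 \<and> (\<forall>\<^sub>F n in sequentially. \<forall>h. F n k h \<le> D * exp (- b * \<bar>h\<bar>))"
    and x: "x \<longlonglongrightarrow> x0"
  shows "(\<lambda>n. iconv (G n) (F n) j (x n)) \<longlonglongrightarrow> normal_density 0 (sqrt (\<Sum>k\<le>j. (\<sigma> k)\<^sup>2)) x0"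
  using F Fd FD x
proof (induction j arbitrary: x x0)
  case 0
  have "sqrt ((\<sigma> 0)\<^sup>2) = \<sigma> 0" using \<sigma>[of 0] by simp
  thus ?case using G[OF 0(4)] by simp
next
  case (Suc j)
  obtain D b where b: "b > 0" and D: "\<forall>\<^sub>F n in sequentially. \<forall>h. F n (Suc j) h \<le> D * exp (- b * \<bar>h\<bar>)"
    using Suc.prems(3)[of "Suc j"] by auto
  have dens: "\<forall>\<^sub>F n in sequentially. \<forall>k\<in>{1..Suc j}. prob_density (F n k)"
    using Suc.prems(2) by (intro eventually_ball_finite) auto
  \<comment> \<open>The hypotheses hold only eventually, whereas dominated convergence asks for
    integrands measurable for every \<open>n\<close>; outside \<open>good\<close> they are replaced
    by 0.\<close>
  define good where "good = (\<lambda>n. (\<forall>k\<in>{1..Suc j}. prob_density (F n k)) \<and> (\<forall>x. 0 \<le> G n x \<and> G n x \<le> B))"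
  have good: "\<forall>\<^sub>F n in sequentially. good n"
    unfolding good_def using dens GB by eventually_elim auto
  have bd: "iconv (G n) (F n) j \<in> borel_measurable borel \<and>
      (\<forall>x. 0 \<le> iconv (G n) (F n) j x \<and> iconv (G n) (F n) j x \<le> B)" if "good n" for n
    by (rule iconv_bounds) (use that Gm in \<open>auto simp: good_def\<close>)
  define s where "s = (\<lambda>n h. if good n then F n (Suc j) h * iconv (G n) (F n) j (x n - h) else 0)"
  define \<tau> where "\<tau> = sqrt (\<Sum>k\<le>j. (\<sigma> k)\<^sup>2)"
  have "0 < (\<Sum>k\<le>j. (\<sigma> k)\<^sup>2)" using \<sigma> by (intro sum_pos zero_less_power) auto
  hence \<tau>: "\<tau> > 0" "\<tau>\<^sup>2 = (\<Sum>k\<le>j. (\<sigma> k)\<^sup>2)" by (simp_all add: \<tau>_def less_imp_le)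
  have "(\<lambda>n. integral\<^sup>L lborel (s n)) \<longlonglongrightarrow>
      (\<integral>h. normal_density 0 (\<sigma> (Suc j)) h * normal_density 0 \<tau> (x0 - h) \<partial>lborel)"
  proof (rule dominated_convergence_eventually[where w="\<lambda>h. D * B * exp (- b * \<bar>h\<bar>)"])
    show "s n \<in> borel_measurable lborel" for n
    proof (cases "good n")
      case True
      note [measurable] = conjunct1[OF bd[OF True]]
      have [measurable]: "F n (Suc j) \<in> borel_measurable borel"
        using True by (auto simp: good_def intro: prob_densityD)
      show ?thesis unfolding s_def using True by simp
    qed (simp add: s_def)
    show "integrable lborel (\<lambda>h. D * B * exp (- b * \<bar>h\<bar>))"
      using b by (intro integrable_mult_right integrable_exp_neg_abs)
    show "AE h in lborel. (\<lambda>n. s n h) \<longlonglongrightarrow> normal_density 0 (\<sigma> (Suc j)) h * normal_density 0 \<tau> (x0 - h)"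
    proof (rule AE_I2)
      fix h :: real
      have "(\<lambda>n. iconv (G n) (F n) j (x n - h)) \<longlonglongrightarrow> normal_density 0 \<tau> (x0 - h)"
        unfolding \<tau>_def using Suc.prems by (intro Suc.IH tendsto_intros) auto
      hence "(\<lambda>n. F n (Suc j) h * iconv (G n) (F n) j (x n - h)) \<longlonglongrightarrow>
          normal_density 0 (\<sigma> (Suc j)) h * normal_density 0 \<tau> (x0 - h)"
        using Suc.prems(1)[of "Suc j" h] by (intro tendsto_mult) auto
      thus "(\<lambda>n. s n h) \<longlonglongrightarrow> normal_density 0 (\<sigma> (Suc j)) h * normal_density 0 \<tau> (x0 - h)"
        by (rule Lim_transform_eventually) (use good in eventually_elim, simp add: s_def)
    qed
    show "\<forall>\<^sub>F n in sequentially. \<forall>h. norm (s n h) \<le> D * B * exp (- b * \<bar>h\<bar>)"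
      using good D
    proof eventually_elim
      case (elim n)
      show ?case
      proof
        fix h
        have nn: "0 \<le> F n (Suc j) h" using elim by (auto simp: good_def intro: prob_densityD)
        have "F n (Suc j) h * iconv (G n) (F n) j (x n - h) \<le> D * exp (- b * \<bar>h\<bar>) * B"
          using nn elim bd[of n] by (intro mult_mono) (auto intro: order_trans)
        thus "norm (s n h) \<le> D * B * exp (- b * \<bar>h\<bar>)"
          using nn elim bd[of n] by (simp add: s_def abs_mult mult_ac)
      qed
    qed
  qed measurable
  also have "(\<integral>h. normal_density 0 (\<sigma> (Suc j)) h * normal_density 0 \<tau> (x0 - h) \<partial>lborel)
      = normal_density 0 (sqrt (\<Sum>k\<le>Suc j. (\<sigma> k)\<^sup>2)) x0"
    using integral_conv_normal_density[OF \<tau>(1) \<sigma>[of "Suc j"], of x0] by (simp add: \<tau>(2))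
  finally show ?case
    by (rule Lim_transform_eventually) (use good in eventually_elim, simp add: s_def)
qed

section \<open>The weight as an iterated convolution\<close>

text \<open>\<open>w k\<close> is the density of the square root of a Gamma variable of shape
  \<open>\<kappa> k\<close>. The newest radius \<open>y\<close> is integrated outermost, so that the
  inner integral is the induction hypothesis at \<open>s / y\<^sup>2\<close>; then
  \<open>y = exp (\<eta> / 2)\<close> turns division into the shift \<open>ln s - \<eta>\<close> and
  \<open>w\<close> into \<open>lgam\<close>.\<close>

lemma nn_integral_PiM_eq_iconv:
  fixes \<kappa> :: "nat \<Rightarrow> real" and \<kappa>' :: real
  defines "w \<equiv> \<lambda>k r. ennreal (2 * exp (- r\<^sup>2) * r powr (2 * \<kappa> k - 1) / Gamma (\<kappa> k)) * indicator {0<..} r"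
  assumes \<kappa>: "\<And>k. \<kappa> k > 0" "\<kappa>' > 0" and s: "s > 0"
  shows "(\<integral>\<^sup>+r. (\<Prod>k=1..<Suc j. w k (r k)) * ennreal (lgam \<kappa>' (ln (s / (\<Prod>k=1..<Suc j. (r k)\<^sup>2))))
            \<partial>(\<Pi>\<^sub>M k\<in>{1..<Suc j}. lborel))
       = ennreal (iconv (lgam \<kappa>') (\<lambda>k. lgam (\<kappa> k)) j (ln s))"
  using s
proof (induction j arbitrary: s)
  case 0
  show ?case by (simp add: PiM_empty nn_integral_count_space_finite)
next
  case (Suc j)
  interpret product_sigma_finite "\<lambda>k::nat. lborel :: real measure"
    by unfold_locales
  have [measurable]: "w k \<in> borel_measurable borel" for k unfolding w_def by measurable
  let ?I = "{1..<Suc j}"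
  have ins: "{1..<Suc (Suc j)} = insert (Suc j) ?I" by auto
  define f where "f = (\<lambda>r :: nat \<Rightarrow> real. (\<Prod>k\<in>insert (Suc j) ?I. w k (r k)) *
      ennreal (lgam \<kappa>' (ln (s / (\<Prod>k\<in>insert (Suc j) ?I. (r k)\<^sup>2)))))"
  have f [measurable]: "f \<in> borel_measurable (Pi\<^sub>M (insert (Suc j) ?I) (\<lambda>_. lborel))"
    unfolding f_def by measurable
  have upd: "f (x(Suc j := y)) = w (Suc j) y * ((\<Prod>k=1..<Suc j. w k (x k)) *
      ennreal (lgam \<kappa>' (ln (s / y\<^sup>2 / (\<Prod>k=1..<Suc j. (x k)\<^sup>2)))))" for x y
  proof -
    have "(\<Prod>k\<in>?I. w k ((x(Suc j := y)) k)) = (\<Prod>k\<in>?I. w k (x k))"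
         "(\<Prod>k\<in>?I. ((x(Suc j := y)) k)\<^sup>2) = (\<Prod>k\<in>?I. (x k)\<^sup>2)"
      by (auto intro!: prod.cong)
    thus ?thesis unfolding f_def by (simp add: mult_ac)
  qed
  have "(\<integral>\<^sup>+r. f r \<partial>(\<Pi>\<^sub>M k\<in>insert (Suc j) ?I. lborel))
      = (\<integral>\<^sup>+y. (\<integral>\<^sup>+x. f (x(Suc j := y)) \<partial>(\<Pi>\<^sub>M k\<in>?I. lborel)) \<partial>lborel)"
    by (rule product_nn_integral_insert_rev[OF _ _ f]) auto
  also have "\<dots> = (\<integral>\<^sup>+y. w (Suc j) y * (\<integral>\<^sup>+x. (\<Prod>k=1..<Suc j. w k (x k)) *
      ennreal (lgam \<kappa>' (ln (s / y\<^sup>2 / (\<Prod>k=1..<Suc j. (x k)\<^sup>2)))) \<partial>(\<Pi>\<^sub>M k\<in>?I. lborel)) \<partial>lborel)"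
    unfolding upd by (intro nn_integral_cong nn_integral_cmult) measurable
  also have "\<dots> = (\<integral>\<^sup>+y. (ennreal (2 * exp (- y\<^sup>2) * y powr (2 * \<kappa> (Suc j) - 1) / Gamma (\<kappa> (Suc j))) *
      ennreal (iconv (lgam \<kappa>') (\<lambda>k. lgam (\<kappa> k)) j (ln s - 2 * ln y))) * indicator {0<..} y \<partial>lborel)"
  proof (intro nn_integral_cong)
    fix y :: real
    have "(\<integral>\<^sup>+x. (\<Prod>k=1..<Suc j. w k (x k)) * ennreal (lgam \<kappa>' (ln (s / y\<^sup>2 / (\<Prod>k=1..<Suc j. (x k)\<^sup>2))))
        \<partial>(\<Pi>\<^sub>M k\<in>?I. lborel)) = ennreal (iconv (lgam \<kappa>') (\<lambda>k. lgam (\<kappa> k)) j (ln s - 2 * ln y))" if "y > 0"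
      using Suc.IH[of "s / y\<^sup>2"] Suc.prems that by (simp add: ln_div ln_realpow)
    thus "w (Suc j) y * (\<integral>\<^sup>+x. (\<Prod>k=1..<Suc j. w k (x k)) * ennreal (lgam \<kappa>' (ln (s / y\<^sup>2 / (\<Prod>k=1..<Suc j. (x k)\<^sup>2))))
        \<partial>(\<Pi>\<^sub>M k\<in>?I. lborel)) = (ennreal (2 * exp (- y\<^sup>2) * y powr (2 * \<kappa> (Suc j) - 1) / Gamma (\<kappa> (Suc j))) *
      ennreal (iconv (lgam \<kappa>') (\<lambda>k. lgam (\<kappa> k)) j (ln s - 2 * ln y))) * indicator {0<..} y"
      by (auto simp: w_def indicator_def)
  qed
  also have "\<dots> = (\<integral>\<^sup>+y. (ennreal (2 * exp (- (exp (1/2 * y))\<^sup>2) * exp (1/2 * y) powr (2 * \<kappa> (Suc j) - 1) / Gamma (\<kappa> (Suc j))) *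
      ennreal (iconv (lgam \<kappa>') (\<lambda>k. lgam (\<kappa> k)) j (ln s - 2 * ln (exp (1/2 * y))))) * ennreal (1/2 * exp (1/2 * y)) \<partial>lborel)"
  proof (rule nn_integral_exp_substitution)
    have "iconv (lgam \<kappa>') (\<lambda>k. lgam (\<kappa> k)) j \<in> borel_measurable borel"
      using iconv_bounds[of j "\<lambda>k. lgam (\<kappa> k)" "lgam \<kappa>'" "lgam_peak \<kappa>'"] \<kappa>
      by (auto simp: prob_density_lgam lgam_le_peak)
    note [measurable] = this
    show "(\<lambda>y. ennreal (2 * exp (- y\<^sup>2) * y powr (2 * \<kappa> (Suc j) - 1) / Gamma (\<kappa> (Suc j))) *
      ennreal (iconv (lgam \<kappa>') (\<lambda>k. lgam (\<kappa> k)) j (ln s - 2 * ln y))) \<in> borel_measurable borel"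
      by measurable
  qed simp
  also have "\<dots> = (\<integral>\<^sup>+y. ennreal (lgam (\<kappa> (Suc j)) y) * ennreal (iconv (lgam \<kappa>') (\<lambda>k. lgam (\<kappa> k)) j (ln s - y)) \<partial>lborel)"
  proof (intro nn_integral_cong)
    fix y :: real
    have "2 * exp (- (exp (1/2 * y))\<^sup>2) * exp (1/2 * y) powr (2 * \<kappa> (Suc j) - 1) / Gamma (\<kappa> (Suc j)) * (1/2 * exp (1/2 * y))
        = lgam (\<kappa> (Suc j)) y"
      by (simp add: lgam_def powr_def exp_add[symmetric] exp_double[symmetric] algebra_simps)
    moreover have "0 \<le> 2 * exp (- (exp (1/2 * y))\<^sup>2) * exp (1/2 * y) powr (2 * \<kappa> (Suc j) - 1) / Gamma (\<kappa> (Suc j))"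
      using Gamma_real_pos[OF \<kappa>(1)[of "Suc j"]] by simp
    ultimately have e: "ennreal (2 * exp (- (exp (1/2 * y))\<^sup>2) * exp (1/2 * y) powr (2 * \<kappa> (Suc j) - 1) / Gamma (\<kappa> (Suc j))) *
        ennreal (1/2 * exp (1/2 * y)) = ennreal (lgam (\<kappa> (Suc j)) y)"
      by (subst ennreal_mult[symmetric]) auto
    show "(ennreal (2 * exp (- (exp (1/2 * y))\<^sup>2) * exp (1/2 * y) powr (2 * \<kappa> (Suc j) - 1) / Gamma (\<kappa> (Suc j))) *
      ennreal (iconv (lgam \<kappa>') (\<lambda>k. lgam (\<kappa> k)) j (ln s - 2 * ln (exp (1/2 * y))))) * ennreal (1/2 * exp (1/2 * y))
      = ennreal (lgam (\<kappa> (Suc j)) y) * ennreal (iconv (lgam \<kappa>') (\<lambda>k. lgam (\<kappa> k)) j (ln s - y))"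
    proof -
      have l: "2 * ln (exp (1/2 * y)) = y" by simp
      show ?thesis unfolding l by (subst e[symmetric]) (simp only: mult_ac)
    qed
  qed
  also have "\<dots> = ennreal (iconv (lgam \<kappa>') (\<lambda>k. lgam (\<kappa> k)) (Suc j) (ln s))"
    by (rule ennreal_iconv_Suc[symmetric, where B="lgam_peak \<kappa>'"])
       (use \<kappa> in \<open>auto simp: prob_density_lgam lgam_le_peak\<close>)
  finally show ?case unfolding f_def ins .
qed

definition loggam_density :: "nat \<Rightarrow> (nat \<Rightarrow> real) \<Rightarrow> nat \<Rightarrow> real \<Rightarrow> real" where
  "loggam_density m a l = iconv (lgam (a m + real l + 1)) (\<lambda>k. lgam (a k + real l + 1)) (m - 1)"

text \<open>The radial exponents involve only the differences \<open>a k - a m\<close>, which do not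
  change when all shapes are raised by the same \<open>l\<close>. So one weight integral serves
  every \<open>l\<close>, and the Gamma quotients with the power of \<open>cmod z\<close> adjust the
  normalisation. The two extra powers of \<open>cmod z\<close> are the Jacobian of passing to
  \<open>ln ((cmod z)\<^sup>2)\<close>.\<close>

lemma weight_conv_loggam_density:
  assumes m: "m \<ge> 1" and a: "\<And>k. k \<in> {1..m} \<Longrightarrow> a k \<ge> 0" and z: "z \<noteq> 0"
  shows "pi * weight m a z * (\<Prod>k=1..m. Gamma (a k + 1) / Gamma (a k + real l + 1)) * cmod z ^ (2 * l + 2)
       = loggam_density m a l (ln ((cmod z)\<^sup>2))"
proof -
  \<comment> \<open>The value 1 outside the index range is a filler: the convolution lemma asks for
    positive shapes at all indices.\<close>
  define \<kappa> where "\<kappa> = (\<lambda>k. if k \<in> {1..m} then a k + real l + 1 else 1)"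
  have \<kappa>: "\<kappa> k > 0" for k using a[of k] by (auto simp: \<kappa>_def add_nonneg_pos)
  define s where "s = (cmod z)\<^sup>2"
  have s: "s > 0" using z by (simp add: s_def)
  define g where "g = (\<lambda>r :: nat \<Rightarrow> real. exp (- (\<Sum>k=1..<m. (r k)\<^sup>2) - s / (\<Prod>k=1..<m. (r k)\<^sup>2)) *
        (\<Prod>k=1..<m. r k powr (2 * (a k - a m) - 1)))"
  define M where "M = (\<Pi>\<^sub>M k\<in>{1..<m}. lborel :: real measure)"
  define X where "X = (\<Pi>\<^sub>E k\<in>{1..<m}. {0<..} :: real set)"
  have [measurable]: "X \<in> sets M" unfolding X_def M_def by (intro sets_PiM_I_finite) auto
  have [measurable]: "g \<in> borel_measurable M" unfolding g_def M_def by measurable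
  define C where "C = s powr \<kappa> m * 2 ^ (m - 1) * (\<Prod>k=1..m. 1 / Gamma (\<kappa> k))"
  have C: "C > 0" unfolding C_def using s \<kappa> by (intro mult_pos_pos prod_pos) (auto intro: Gamma_real_pos)
  have splitm: "(\<Prod>k=1..m. h k) = (\<Prod>k=1..<m. h k) * h m" for h :: "nat \<Rightarrow> real"
    using m by (simp add: prod.last_plus atLeastLessThanSuc_atLeastAtMost[symmetric] del: prod.op_ivl_Suc)
       (metis (no_types) prod.atLeastLessThan_Suc atLeastLessThanSuc_atLeastAtMost)
  have eq: "ennreal (C * (indicator X r * g r)) =
      (\<Prod>k=1..<m. ennreal (2 * exp (- (r k)\<^sup>2) * r k powr (2 * \<kappa> k - 1) / Gamma (\<kappa> k)) * indicator {0<..} (r k)) *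
      ennreal (lgam (\<kappa> m) (ln (s / (\<Prod>k=1..<m. (r k)\<^sup>2))))" if r: "r \<in> space M" for r
  proof (cases "r \<in> X")
    case False
    then obtain k where "k \<in> {1..<m}" "r k \<notin> {0<..}" using r by (auto simp: X_def M_def space_PiM PiE_iff)
    hence "(\<Prod>k=1..<m. ennreal (2 * exp (- (r k)\<^sup>2) * r k powr (2 * \<kappa> k - 1) / Gamma (\<kappa> k)) * indicator {0<..} (r k)) = 0"
      by (intro prod_zero) (auto intro!: bexI[of _ k])
    thus ?thesis using False by simp
  next
    case True
    hence rk: "r k > 0" if "k \<in> {1..<m}" for k using that by (auto simp: X_def PiE_iff)
    define P where "P = (\<Prod>k=1..<m. (r k)\<^sup>2)"
    have P: "P > 0" unfolding P_def by (intro prod_pos ballI zero_less_power rk)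
    have "(\<Prod>k=1..<m. ennreal (2 * exp (- (r k)\<^sup>2) * r k powr (2 * \<kappa> k - 1) / Gamma (\<kappa> k)) * indicator {0<..} (r k))
        = (\<Prod>k=1..<m. ennreal (2 * exp (- (r k)\<^sup>2) * r k powr (2 * \<kappa> k - 1) / Gamma (\<kappa> k)))"
      using rk by (intro prod.cong) auto
    also have "\<dots> = ennreal (\<Prod>k=1..<m. 2 * exp (- (r k)\<^sup>2) * r k powr (2 * \<kappa> k - 1) / Gamma (\<kappa> k))"
      using \<kappa> by (intro prod_ennreal) (auto intro!: divide_nonneg_pos Gamma_real_pos)
    finally have 1: "(\<Prod>k=1..<m. ennreal (2 * exp (- (r k)\<^sup>2) * r k powr (2 * \<kappa> k - 1) / Gamma (\<kappa> k)) * indicator {0<..} (r k))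
        = ennreal (\<Prod>k=1..<m. 2 * exp (- (r k)\<^sup>2) * r k powr (2 * \<kappa> k - 1) / Gamma (\<kappa> k))" .
    have Ppowr: "P powr \<kappa> m = (\<Prod>k=1..<m. r k powr (2 * \<kappa> m))"
    proof -
      have "P powr \<kappa> m = (\<Prod>k=1..<m. (r k)\<^sup>2 powr \<kappa> m)" unfolding P_def by (rule prod_powr_distrib)
      also have "\<dots> = (\<Prod>k=1..<m. r k powr (2 * \<kappa> m))"
      proof (intro prod.cong refl)
        fix k assume "k \<in> {1..<m}"
        hence "(r k)\<^sup>2 = r k powr 2" using rk[of k] by (simp add: powr_numeral)
        thus "(r k)\<^sup>2 powr \<kappa> m = r k powr (2 * \<kappa> m)" by (simp add: powr_powr)
      qed
      finally show ?thesis .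
    qed
    \<comment> \<open>The factor \<open>s powr \<kappa> m\<close> of \<open>C\<close> splits into
      \<open>(s / P) powr \<kappa> m\<close>, which belongs to the seed, and
      \<open>P powr \<kappa> m\<close>, which lifts the exponents \<open>2 * (a k - a m) - 1\<close>
      to \<open>2 * \<kappa> k - 1\<close>.\<close>
    have ga: "(\<Prod>k=1..<m. r k powr (2 * (a k - a m) - 1)) * P powr \<kappa> m = (\<Prod>k=1..<m. r k powr (2 * \<kappa> k - 1))"
      unfolding Ppowr prod.distrib[symmetric]
      using m by (intro prod.cong) (auto simp: \<kappa>_def powr_add[symmetric] algebra_simps)
    have "C * (indicator X r * g r) = C * (exp (- (\<Sum>k=1..<m. (r k)\<^sup>2)) * exp (- (s / P)) *
        (\<Prod>k=1..<m. r k powr (2 * (a k - a m) - 1)))"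
      using True by (simp add: g_def P_def exp_diff exp_minus divide_inverse mult_ac)
    also have "\<dots> = (2 ^ (m - 1) * exp (- (\<Sum>k=1..<m. (r k)\<^sup>2)) * ((\<Prod>k=1..<m. r k powr (2 * (a k - a m) - 1)) * P powr \<kappa> m) *
        (\<Prod>k=1..<m. 1 / Gamma (\<kappa> k))) * ((s / P) powr \<kappa> m * exp (- (s / P)) / Gamma (\<kappa> m))"
      using s P unfolding C_def splitm by (simp add: powr_divide field_simps)
    also have "2 ^ (m - 1) * exp (- (\<Sum>k=1..<m. (r k)\<^sup>2)) * ((\<Prod>k=1..<m. r k powr (2 * (a k - a m) - 1)) * P powr \<kappa> m) *
        (\<Prod>k=1..<m. 1 / Gamma (\<kappa> k)) = (\<Prod>k=1..<m. 2 * exp (- (r k)\<^sup>2) * r k powr (2 * \<kappa> k - 1) / Gamma (\<kappa> k))"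
      unfolding ga by (simp add: prod.distrib exp_sum sum_negf[symmetric] prod_dividef divide_inverse)
    also have "(s / P) powr \<kappa> m * exp (- (s / P)) / Gamma (\<kappa> m) = lgam (\<kappa> m) (ln (s / P))"
      using s P by (simp add: lgam_def powr_def exp_diff exp_minus divide_inverse)
    finally have "ennreal (C * (indicator X r * g r)) =
        ennreal ((\<Prod>k=1..<m. 2 * exp (- (r k)\<^sup>2) * r k powr (2 * \<kappa> k - 1) / Gamma (\<kappa> k)) * lgam (\<kappa> m) (ln (s / P)))"
      by simp
    also have "\<dots> = ennreal (\<Prod>k=1..<m. 2 * exp (- (r k)\<^sup>2) * r k powr (2 * \<kappa> k - 1) / Gamma (\<kappa> k)) * ennreal (lgam (\<kappa> m) (ln (s / P)))"
      using \<kappa> by (intro ennreal_mult prod_nonneg) (auto intro!: divide_nonneg_pos Gamma_real_pos)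
    finally show ?thesis unfolding 1 P_def .
  qed
  have nn: "0 \<le> iconv (lgam (\<kappa> m)) (\<lambda>k. lgam (\<kappa> k)) (m - 1) (ln s)"
    using iconv_bounds[of "m - 1" "\<lambda>k. lgam (\<kappa> k)" "lgam (\<kappa> m)" "lgam_peak (\<kappa> m)"] \<kappa>
    by (auto simp: prob_density_lgam lgam_le_peak)
  have "(\<integral>\<^sup>+r. ennreal (C * (indicator X r * g r)) \<partial>M) = ennreal (iconv (lgam (\<kappa> m)) (\<lambda>k. lgam (\<kappa> k)) (m - 1) (ln s))"
  proof -
    have S: "Suc (m - 1) = m" using m by simp
    show ?thesis
      using nn_integral_PiM_eq_iconv[OF \<kappa> \<kappa>[of m] s, of "m - 1"] unfolding S M_def[symmetric]
      by (subst nn_integral_cong[OF eq])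
  qed
  moreover have "0 \<le> C * (indicator X r * g r)" for r
    using C by (auto simp: g_def indicator_def prod_nonneg)
  ultimately have "(\<integral>r. C * (indicator X r * g r) \<partial>M) = iconv (lgam (\<kappa> m)) (\<lambda>k. lgam (\<kappa> k)) (m - 1) (ln s)"
    using nn by (subst integral_eq_nn_integral) auto
  hence "C * (\<integral>r. indicator X r * g r \<partial>M) = iconv (lgam (\<kappa> m)) (\<lambda>k. lgam (\<kappa> k)) (m - 1) (ln s)"
    by simp
  also have "\<dots> = loggam_density m a l (ln s)"
  proof -
    have cong: "iconv G F j = iconv G F' j" if "\<And>k. k \<in> {1..j} \<Longrightarrow> F k = F' k" for G F F' j
      using that by (induction j) auto
    show ?thesis unfolding loggam_density_def using m
      by (subst cong[where F'="\<lambda>k. lgam (\<kappa> k)"]) (auto simp: \<kappa>_def)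
  qed
  finally have main: "C * (\<integral>r. indicator X r * g r \<partial>M) = loggam_density m a l (ln s)" .
  have W: "weight m a z = cmod z powr (2 * a m) * (2 ^ (m - 1) / pi) * (\<Prod>k=1..m. 1 / Gamma (a k + 1)) *
      (\<integral>r. indicator X r * g r \<partial>M)"
    by (simp add: weight_def g_def X_def M_def s_def set_lebesgue_integral_def)
  have pw: "cmod z powr (2 * a m) * cmod z ^ (2 * l + 2) = s powr \<kappa> m"
  proof -
    have "cmod z ^ (2 * l + 2) = cmod z powr real (2 * l + 2)" using z by (subst powr_realpow) auto
    have "s = cmod z powr 2" using z by (simp add: s_def powr_numeral)
    hence "s powr \<kappa> m = cmod z powr (2 * \<kappa> m)" by (simp only: powr_powr)
    moreover note \<open>cmod z ^ (2 * l + 2) = cmod z powr real (2 * l + 2)\<close>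
    ultimately show ?thesis using m by (simp add: powr_add[symmetric] \<kappa>_def algebra_simps)
  qed
  have G1: "(\<Prod>k=1..m. 1 / Gamma (a k + 1)) * (\<Prod>k=1..m. Gamma (a k + 1) / Gamma (a k + real l + 1)) = (\<Prod>k=1..m. 1 / Gamma (\<kappa> k))"
    unfolding prod.distrib[symmetric]
  proof (intro prod.cong refl)
    fix k assume k: "k \<in> {1..m}"
    have "Gamma (a k + 1) > 0" using a[OF k] by (intro Gamma_real_pos) auto
    thus "1 / Gamma (a k + 1) * (Gamma (a k + 1) / Gamma (a k + real l + 1)) = 1 / Gamma (\<kappa> k)"
      using k by (simp add: \<kappa>_def)
  qed
  have "pi * weight m a z * (\<Prod>k=1..m. Gamma (a k + 1) / Gamma (a k + real l + 1)) * cmod z ^ (2 * l + 2)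
      = (cmod z powr (2 * a m) * cmod z ^ (2 * l + 2)) * 2 ^ (m - 1) *
        ((\<Prod>k=1..m. 1 / Gamma (a k + 1)) * (\<Prod>k=1..m. Gamma (a k + 1) / Gamma (a k + real l + 1))) *
        (\<integral>r. indicator X r * g r \<partial>M)"
    unfolding W by (simp only: mult_ac times_divide_eq_right times_divide_eq_left) simp
  also have "\<dots> = C * (\<integral>r. indicator X r * g r \<partial>M)" unfolding pw G1 C_def ..
  finally show ?thesis using main by (simp add: s_def)
qed

section \<open>Exponential bounds\<close>

text \<open>Differentiability at 0 along a moving direction. It serves twice: for the real
  \<open>ln (1 + x)\<close> in the centring of the densities, and for the complex
  \<open>Ln (1 + x)\<close> at the rescaled points.\<close>

lemma tendsto_sqrt_scaled:
  fixes f :: "'a \<Rightarrow> 'a :: {real_normed_field}"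
  assumes f: "(f has_field_derivative d) (at 0)" "f 0 = 0" and e: "e \<longlonglongrightarrow> e0"
  shows "(\<lambda>n. of_real (sqrt (real n)) * f (e n / of_real (sqrt (real n)))) \<longlonglongrightarrow> d * e0"
proof -
  define q where "q = (\<lambda>h. if h = 0 then d else f h / h)"
  have "(\<lambda>h. f h / h) \<midarrow>0\<rightarrow> d" using f by (simp add: DERIV_def)
  hence "(q \<longlongrightarrow> q 0) (at 0)"
    unfolding q_def by (subst tendsto_cong[where g="\<lambda>h. f h / h"]) (auto simp: eventually_at_filter)
  hence cont: "isCont q 0" by (simp add: isCont_def)
  have fq: "f h = q h * h" for h using f(2) by (simp add: q_def)
  have "(\<lambda>n. e n * of_real (1 / sqrt (real n))) \<longlonglongrightarrow> e0 * of_real 0"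
    by (intro tendsto_mult[OF e] tendsto_of_real) real_asymp
  hence s: "(\<lambda>n. e n / of_real (sqrt (real n))) \<longlonglongrightarrow> 0" by (simp add: divide_inverse)
  have "(\<lambda>n. q (e n / of_real (sqrt (real n))) * e n) \<longlonglongrightarrow> q 0 * e0"
    by (intro tendsto_mult e isCont_tendsto_compose[OF cont s])
  moreover have "\<forall>\<^sub>F n in sequentially. q (e n / of_real (sqrt (real n))) * e n
      = of_real (sqrt (real n)) * f (e n / of_real (sqrt (real n)))"
    using eventually_gt_at_top[of 0] by eventually_elim (simp add: fq)
  ultimately have "(\<lambda>n. of_real (sqrt (real n)) * f (e n / of_real (sqrt (real n)))) \<longlonglongrightarrow> q 0 * e0"
    by (rule Lim_transform_eventually)
  thus ?thesis by (simp add: q_def)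
qed

lemma loggam_density_bounds:
  assumes "m \<ge> 1" "\<And>k. k \<in> {1..m} \<Longrightarrow> a k \<ge> 0"
  shows "0 \<le> loggam_density m a l x" "loggam_density m a l x \<le> exp (1/2) * sqrt (a m + real l + 1)"
proof -
  have "loggam_density m a l \<in> borel_measurable borel \<and>
      (\<forall>x. 0 \<le> loggam_density m a l x \<and> loggam_density m a l x \<le> exp (1/2) * sqrt (a m + real l + 1))"
    unfolding loggam_density_def
  proof (rule iconv_bounds)
    have "a m \<ge> 0" using assms by auto
    thus "lgam (a m + real l + 1) x \<le> exp (1/2) * sqrt (a m + real l + 1)"
         "0 \<le> lgam (a m + real l + 1) x" for x
      using lgam_le_peak[of "a m + real l + 1" x] lgam_peak_le[of "a m + real l + 1"] by auto
    show "prob_density (lgam (a k + real l + 1))" if "k \<in> {1..m - 1}" for k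
    proof -
      have "k \<in> {1..m}" using that by auto
      thus ?thesis using assms(2)[of k] by (intro prob_density_lgam) auto
    qed
  qed auto
  thus "0 \<le> loggam_density m a l x" "loggam_density m a l x \<le> exp (1/2) * sqrt (a m + real l + 1)" by auto
qed

text \<open>Consecutive densities contain the same weight integral, which drops out of their
  quotient. The quotient \<open>exp x / (\<Prod>k=1..m. a k + real (Suc l))\<close> decreases in
  \<open>l\<close>: this is the log-concavity behind the tail bounds.\<close>

lemma loggam_density_Suc:
  assumes m: "m \<ge> 1" and a: "\<And>k. k \<in> {1..m} \<Longrightarrow> a k \<ge> 0"
  shows "loggam_density m a (Suc l) x * (\<Prod>k=1..m. a k + real (Suc l)) = exp x * loggam_density m a l x"
proof -
  define z where "z = complex_of_real (exp (x / 2))"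
  have z: "z \<noteq> 0" "(cmod z)\<^sup>2 = exp x" by (simp_all add: z_def exp_double[symmetric])
  define c where "c = (\<lambda>l. \<Prod>k=1..m. Gamma (a k + 1) / Gamma (a k + real l + 1))"
  have cl: "c l = c (Suc l) * (\<Prod>k=1..m. a k + real (Suc l))"
    unfolding c_def prod.distrib[symmetric]
  proof (intro prod.cong refl)
    fix k assume "k \<in> {1..m}"
    hence k: "a k + real l + 1 > 0" using a by (simp add: add_nonneg_pos)
    hence "Gamma (a k + real l + 1 + 1) = (a k + real l + 1) * Gamma (a k + real l + 1)"
      by (intro Gamma_plus1) (auto elim!: nonpos_Ints_cases)
    moreover have "Gamma (a k + real l + 1) > 0" using k by (rule Gamma_real_pos)
    ultimately show "Gamma (a k + 1) / Gamma (a k + real l + 1)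
        = Gamma (a k + 1) / Gamma (a k + real (Suc l) + 1) * (a k + real (Suc l))"
      using k by (simp add: add_ac)
  qed
  have zl: "cmod z ^ (2 * Suc l + 2) = cmod z ^ (2 * l + 2) * exp x"
    by (simp add: z(2)[symmetric] power_add[symmetric] algebra_simps power2_eq_square)
  have w: "loggam_density m a l x = pi * weight m a z * c l * cmod z ^ (2 * l + 2)" for l
    using weight_conv_loggam_density[where a=a and l=l, OF m a z(1)] by (simp only: c_def z(2) ln_exp)
  show ?thesis unfolding w zl cl by (simp only: mult_ac)
qed

text \<open>Up to distance \<open>R\<close> from \<open>Y\<close> only the crude bound
  \<open>M\<close> is available, beyond it every step gains \<open>exp (- \<epsilon>)\<close>. The 1
  in \<open>R + 1\<close> pays for the single step that crosses the threshold.\<close>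

lemma exp_decay_above:
  fixes p :: "nat \<Rightarrow> real"
  assumes M: "M \<ge> 0" and \<epsilon>: "\<epsilon> > 0" and Y: "Y \<ge> 0" "R \<ge> 0" and le: "\<And>l. l < n \<Longrightarrow> p l \<le> M"
    and step: "\<And>l. Suc l < n \<Longrightarrow> real l \<ge> Y + R \<Longrightarrow> p (Suc l) \<le> exp (- \<epsilon>) * p l"
  shows "l < n \<Longrightarrow> p l \<le> M * exp (\<epsilon> * (R + 1) - \<epsilon> * (real l - Y))"
proof (induction l)
  case 0
  have "0 \<le> \<epsilon> * (R + 1) - \<epsilon> * (real 0 - Y)"
    using \<epsilon> Y by (simp add: right_diff_distrib[symmetric])
  hence "M * 1 \<le> M * exp (\<epsilon> * (R + 1) - \<epsilon> * (real 0 - Y))"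
    using M by (intro mult_left_mono) (simp_all only: one_le_exp_iff)
  thus ?case using le[OF 0] by simp
next
  case (Suc l)
  show ?case
  proof (cases "real l \<ge> Y + R")
    case True
    have "p (Suc l) \<le> exp (- \<epsilon>) * (M * exp (\<epsilon> * (R + 1) - \<epsilon> * (real l - Y)))"
      using step[OF Suc.prems True] Suc by (auto intro: order_trans)
    also have "\<dots> = M * (exp (- \<epsilon>) * exp (\<epsilon> * (R + 1) - \<epsilon> * (real l - Y)))" by simp
    also have "exp (- \<epsilon>) * exp (\<epsilon> * (R + 1) - \<epsilon> * (real l - Y)) = exp (\<epsilon> * (R + 1) - \<epsilon> * (real (Suc l) - Y))"
      unfolding exp_add[symmetric] by (simp add: algebra_simps)
    finally show ?thesis .
  next
    case False
    hence "0 \<le> \<epsilon> * (R + 1) - \<epsilon> * (real (Suc l) - Y)"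
      unfolding right_diff_distrib[symmetric] using \<epsilon> by simp
    hence "M * 1 \<le> M * exp (\<epsilon> * (R + 1) - \<epsilon> * (real (Suc l) - Y))"
      using M by (intro mult_left_mono) (simp_all only: one_le_exp_iff)
    thus ?thesis using le[OF Suc.prems] by simp
  qed
qed

text \<open>The mirror image, by induction on the distance to \<open>n\<close>. The last index has
  no successor to compare with, and there \<open>Y \<le> n\<close> guarantees that the crude bound
  suffices.\<close>

lemma exp_decay_below:
  fixes p :: "nat \<Rightarrow> real"
  assumes M: "M \<ge> 0" and \<epsilon>: "\<epsilon> > 0" and Y: "Y \<le> real n" "R \<ge> 0" and le: "\<And>l. l < n \<Longrightarrow> p l \<le> M"
    and step: "\<And>l. Suc l < n \<Longrightarrow> real (Suc l) \<le> Y - R \<Longrightarrow> p l \<le> exp (- \<epsilon>) * p (Suc l)"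
  shows "l < n \<Longrightarrow> p l \<le> M * exp (\<epsilon> * (R + 1) + \<epsilon> * (real l - Y))"
proof (induction "n - l" arbitrary: l)
  case (Suc d)
  show ?case
  proof (cases "real (Suc l) \<le> Y - R \<and> Suc l < n")
    case True
    have "p (Suc l) \<le> M * exp (\<epsilon> * (R + 1) + \<epsilon> * (real (Suc l) - Y))"
      using Suc True by (intro Suc.hyps(1)) auto
    hence "p l \<le> exp (- \<epsilon>) * (M * exp (\<epsilon> * (R + 1) + \<epsilon> * (real (Suc l) - Y)))"
      using step[of l] True by (auto intro: order_trans)
    also have "\<dots> = M * (exp (- \<epsilon>) * exp (\<epsilon> * (R + 1) + \<epsilon> * (real (Suc l) - Y)))" by simp
    also have "exp (- \<epsilon>) * exp (\<epsilon> * (R + 1) + \<epsilon> * (real (Suc l) - Y)) = exp (\<epsilon> * (R + 1) + \<epsilon> * (real l - Y))"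
      unfolding exp_add[symmetric] by (simp add: algebra_simps)
    finally show ?thesis .
  next
    case False
    have "real l + 1 \<ge> Y - R"
    proof (cases "Suc l < n")
      case True thus ?thesis using False by simp
    next
      case False
      hence "real l + 1 = real n" using Suc.prems by simp
      thus ?thesis using Y by simp
    qed
    hence "0 \<le> \<epsilon> * (R + 1) + \<epsilon> * (real l - Y)"
      unfolding distrib_left[symmetric] using \<epsilon> by simp
    hence "M * 1 \<le> M * exp (\<epsilon> * (R + 1) + \<epsilon> * (real l - Y))"
      using M by (intro mult_left_mono) (simp_all only: one_le_exp_iff)
    thus ?thesis using le[OF Suc.prems] by simp
  qed
qed simp

lemma prod_le_one_factor:
  fixes q :: "nat \<Rightarrow> real"
  assumes "finite I" "i \<in> I" "\<And>k. k \<in> I \<Longrightarrow> 0 \<le> q k \<and> q k \<le> 1"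
  shows "(\<Prod>k\<in>I. q k) \<le> q i"
proof -
  have "(\<Prod>k\<in>I. q k) = q i * (\<Prod>k\<in>I - {i}. q k)" using assms by (simp add: prod.remove)
  also have "\<dots> \<le> q i * 1" using assms by (intro mult_left_mono prod_le_1) auto
  finally show ?thesis by simp
qed

text \<open>To leading order the sum of the modes \<open>ln (a k + l + 1)\<close> at
  \<open>l = y n\<close>. When \<open>y\<close> solves the saddle equation it equals the logarithm
  of the squared modulus of the unperturbed point \<open>n^(m/2) u\<close>.\<close>

definition log_center :: "nat \<Rightarrow> (nat \<Rightarrow> real) \<Rightarrow> real \<Rightarrow> nat \<Rightarrow> real" where
  "log_center m \<delta> y n = real m * ln (real n) + (\<Sum>k=1..m. ln (\<delta> k + y))"

lemma exp_log_center:
  assumes "n > 0" "\<And>k. k \<in> {1..m} \<Longrightarrow> \<delta> k + y > 0"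
  shows "exp (log_center m \<delta> y n) = (\<Prod>k=1..m. real n * (\<delta> k + y))"
proof -
  have "exp (log_center m \<delta> y n) = (\<Prod>k=1..m. exp (ln (real n) + ln (\<delta> k + y)))"
    by (simp add: log_center_def exp_add prod.distrib exp_sum exp_of_nat_mult)
  also have "\<dots> = (\<Prod>k=1..m. real n * (\<delta> k + y))"
    using assms by (intro prod.cong) (auto simp: exp_add)
  finally show ?thesis .
qed

text \<open>Near \<open>y n\<close> the bound on the peak of the seed suffices. At distance
  \<open>C * sqrt n\<close> the factor \<open>k = 1\<close> of the ratio of consecutive terms
  already differs from 1 by enough to outweigh the perturbation \<open>exp (X n / sqrt n)\<close>
  and to leave a gain of \<open>exp (- 1 / sqrt n)\<close> per step, in either direction.\<close>

lemma loggam_density_dominated: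
  fixes X :: "nat \<Rightarrow> real"
  assumes m: "m \<ge> 1" and \<delta>: "\<And>k. k \<in> {1..m} \<Longrightarrow> \<delta> k \<ge> 0"
    and y: "0 \<le> y" "y \<le> 1" and \<gamma>: "\<And>k. k \<in> {1..m} \<Longrightarrow> \<delta> k + y > 0"
    and X: "X \<longlonglongrightarrow> X0"
  shows "\<exists>D\<ge>0. \<forall>\<^sub>F n in sequentially. \<forall>l<n.
     loggam_density m (\<lambda>k. \<delta> k * real n) l (log_center m \<delta> y n + X n / sqrt (real n)) / sqrt (real n)
       \<le> D * exp (- \<bar>real l - y * real n\<bar> / sqrt (real n))"
proof -
  obtain B where B: "B > 0" "\<And>n. \<bar>X n\<bar> \<le> B"
    using convergent_imp_Bseq[OF convergentI[OF X]] unfolding Bseq_def by auto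
  \<comment> \<open>Chosen so that \<open>1 + C' * h \<ge> exp ((B + 1) * h)\<close>, by
    \<open>exp t \<le> 1 + t + t\<^sup>2 \<le> 1 + 2 * t\<close> for
    \<open>0 \<le> t \<le> 1\<close>; of \<open>B + 1\<close>, the part \<open>B\<close> absorbs
    \<open>X n\<close> and the 1 remains as gain. The factor \<open>\<delta> 1 + y\<close> in
    \<open>C\<close> converts this into a distance of the index.\<close>
  define C' where "C' = 2 * (B + 1)"
  define C where "C = (\<delta> 1 + y) * C'"
  have g1: "\<delta> 1 + y > 0" using \<gamma>[of 1] m by auto
  have C: "C > 0" "C' > 0" using B g1 by (auto simp: C_def C'_def)
  define D0 where "D0 = exp (1/2) * sqrt (\<delta> m + 2)"
  have dm: "\<delta> m \<ge> 0" using \<delta> m by auto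
  have D0: "D0 \<ge> 0" using dm by (simp add: D0_def)
  \<comment> \<open>This size of \<open>n\<close> means \<open>(B + 1) * h \<le> 1\<close> for
    \<open>h = 1 / sqrt n\<close>, the range in which the bound on exp is used.\<close>
  have ev: "\<forall>\<^sub>F n in sequentially. real n \<ge> (B + 1)\<^sup>2" by real_asymp
  have "\<forall>\<^sub>F n in sequentially. \<forall>l<n.
     loggam_density m (\<lambda>k. \<delta> k * real n) l (log_center m \<delta> y n + X n / sqrt (real n)) / sqrt (real n)
       \<le> (D0 * exp (C + 1)) * exp (- \<bar>real l - y * real n\<bar> / sqrt (real n))"
    using ev eventually_gt_at_top[of 0]
  proof eventually_elim
    case (elim n)
    define h where "h = 1 / sqrt (real n)"
    have n: "n > 0" by fact
    have h: "h > 0" "h \<le> 1" "sqrt (real n) = 1 / h" "real n * h\<^sup>2 = 1"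
      using n by (auto simp: h_def power_divide)
    have nh: "1 / h = real n * h" using h(1,4) by (simp add: field_simps power2_eq_square)
    have Bh: "(B + 1) * h \<le> 1"
    proof -
      have "B + 1 \<le> sqrt (real n)" using elim B by (intro real_le_rsqrt) auto
      thus ?thesis using h(1,3) by (simp add: field_simps)
    qed
    define a where "a = (\<lambda>k. \<delta> k * real n)"
    have a: "\<And>k. k \<in> {1..m} \<Longrightarrow> a k \<ge> 0" using \<delta> by (simp add: a_def)
    define x where "x = log_center m \<delta> y n + X n * h"
    define p where "p = (\<lambda>l. loggam_density m a l x * h)"
    note bnd = loggam_density_bounds[where a=a, OF m a]
    have p0: "p l \<ge> 0" for l using bnd h by (simp add: p_def)
    have pD0: "p l \<le> D0" if l: "l < n" for l
    proof -
      have "a m + real l + 1 \<le> (\<delta> m + 2) * real n" using l n by (simp add: a_def algebra_simps)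
      hence "sqrt (a m + real l + 1) \<le> sqrt (\<delta> m + 2) * sqrt (real n)"
        by (simp flip: real_sqrt_mult)
      hence "exp (1/2) * sqrt (a m + real l + 1) \<le> exp (1/2) * (sqrt (\<delta> m + 2) * (1 / h))"
        unfolding h(3) by (intro mult_left_mono) auto
      with bnd(2)[of l x] have "loggam_density m a l x \<le> D0 * (1 / h)" by (simp add: D0_def)
      thus ?thesis using h(1) by (simp add: p_def field_simps)
    qed
    \<comment> \<open>Measured against \<open>exp (log_center m \<delta> y n)\<close>, all powers of
      \<open>n\<close> cancel and each factor of the ratio is close to 1 near
      \<open>l = y n\<close>.\<close>
    have rec: "p (Suc l) * (\<Prod>k=1..m. (\<delta> k + real (Suc l) / real n) / (\<delta> k + y)) = exp (X n * h) * p l" for l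
    proof -
      have "(\<Prod>k=1..m. a k + real (Suc l)) = (\<Prod>k=1..m. ((\<delta> k + real (Suc l) / real n) / (\<delta> k + y)) * (real n * (\<delta> k + y)))"
      proof (intro prod.cong refl)
        fix k assume "k \<in> {1..m}"
        hence "\<delta> k + y \<noteq> 0" using \<gamma>[of k] by simp
        hence "(\<delta> k + real (Suc l) / real n) / (\<delta> k + y) * (real n * (\<delta> k + y)) = (\<delta> k + real (Suc l) / real n) * real n"
          by simp
        also have "\<dots> = a k + real (Suc l)" using n by (simp add: a_def field_simps)
        finally show "a k + real (Suc l) = (\<delta> k + real (Suc l) / real n) / (\<delta> k + y) * (real n * (\<delta> k + y))" ..
      qed
      also have "\<dots> = (\<Prod>k=1..m. (\<delta> k + real (Suc l) / real n) / (\<delta> k + y)) * exp (log_center m \<delta> y n)"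
      proof -
        have E: "exp (log_center m \<delta> y n) = (\<Prod>k=1..m. real n * (\<delta> k + y))"
          using n \<gamma> by (rule exp_log_center)
        show ?thesis unfolding E by (rule prod.distrib)
      qed
      finally have pq: "(\<Prod>k=1..m. a k + real (Suc l)) = (\<Prod>k=1..m. (\<delta> k + real (Suc l) / real n) / (\<delta> k + y)) * exp (log_center m \<delta> y n)" .
      have "exp x = exp (log_center m \<delta> y n) * exp (X n * h)" unfolding x_def by (rule exp_add)
      with loggam_density_Suc[where a=a, OF m a, of l x] have "loggam_density m a (Suc l) x * ((\<Prod>k=1..m. (\<delta> k + real (Suc l) / real n) / (\<delta> k + y)) * exp (log_center m \<delta> y n))
         = exp (log_center m \<delta> y n) * exp (X n * h) * loggam_density m a l x"
        by (simp only: pq)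
      hence "exp (log_center m \<delta> y n) * (loggam_density m a (Suc l) x * (\<Prod>k=1..m. (\<delta> k + real (Suc l) / real n) / (\<delta> k + y)))
         = exp (log_center m \<delta> y n) * (exp (X n * h) * loggam_density m a l x)" by (simp only: mult_ac)
      hence "loggam_density m a (Suc l) x * (\<Prod>k=1..m. (\<delta> k + real (Suc l) / real n) / (\<delta> k + y))
         = exp (X n * h) * loggam_density m a l x" by (simp only: mult_cancel_left exp_not_eq_zero simp_thms)
      from arg_cong[OF this, of "\<lambda>v. v * h"] show ?thesis by (simp only: p_def mult_ac)
    qed
    have Xh: "X n * h \<le> B * h" "- (X n * h) \<le> B * h"
    proof -
      have "X n \<le> B" "- X n \<le> B" using B(2)[of n] by linarith+
      from this[THEN mult_right_mono, of h] show "X n * h \<le> B * h" "- (X n * h) \<le> B * h"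
        using h(1) by simp_all
    qed
    have up: "p (Suc l) \<le> exp (- h) * p l" if l: "real l \<ge> y * real n + C / h" for l
    proof -
      define q where "q = (\<lambda>k. (\<delta> k + y) / (\<delta> k + real (Suc l) / real n))"
      have yl: "y + C * h \<le> real (Suc l) / real n"
      proof -
        have "y * real n + C * (real n * h) \<le> real (Suc l)" using l unfolding nh[symmetric] by simp
        thus ?thesis using n by (simp add: field_simps)
      qed
      have Ch: "C * h > 0" using C h by simp
      have q: "0 \<le> q k \<and> q k \<le> 1" if "k \<in> {1..m}" for k
        using \<gamma>[OF that] yl Ch unfolding q_def by (auto simp: divide_le_eq_1)
      have "(\<Prod>k=1..m. q k) \<le> q 1" by (rule prod_le_one_factor) (use q m in auto)
      also have "q 1 \<le> (\<delta> 1 + y) / (\<delta> 1 + (y + C * h))"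
        unfolding q_def using g1 yl Ch by (intro divide_left_mono mult_pos_pos) auto
      also have "\<delta> 1 + (y + C * h) = (\<delta> 1 + y) * (1 + C' * h)" by (simp add: C_def algebra_simps)
      also have "(\<delta> 1 + y) / ((\<delta> 1 + y) * (1 + C' * h)) = 1 / (1 + C' * h)" using g1 by simp
      also have "\<dots> \<le> exp (- ((B + 1) * h))"
      proof -
        have "exp ((B + 1) * h) \<le> 1 + (B + 1) * h + ((B + 1) * h)\<^sup>2" using Bh B h by (intro exp_bound) auto
        also have "((B + 1) * h)\<^sup>2 \<le> (B + 1) * h" using Bh B h by (simp add: power2_eq_square mult_left_le)
        finally have "exp ((B + 1) * h) \<le> 1 + C' * h" by (simp add: C'_def algebra_simps)
        hence "1 / (1 + C' * h) \<le> 1 / exp ((B + 1) * h)" using C h by (intro divide_left_mono mult_pos_pos add_pos_pos) auto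
        thus ?thesis by (simp only: exp_minus inverse_eq_divide)
      qed
      finally have Q: "(\<Prod>k=1..m. q k) \<le> exp (- ((B + 1) * h))" .
      have PQ: "(\<Prod>k=1..m. (\<delta> k + real (Suc l) / real n) / (\<delta> k + y)) * (\<Prod>k=1..m. q k) = (\<Prod>k=1..m. 1)"
        unfolding prod.distrib[symmetric]
      proof (intro prod.cong refl)
        fix k assume k: "k \<in> {1..m}"
        have "\<delta> k + real (Suc l) / real n > 0" using \<gamma>[OF k] yl Ch by linarith
        thus "(\<delta> k + real (Suc l) / real n) / (\<delta> k + y) * q k = 1" using \<gamma>[OF k] by (simp add: q_def)
      qed
      have "p (Suc l) = p (Suc l) * ((\<Prod>k=1..m. (\<delta> k + real (Suc l) / real n) / (\<delta> k + y)) * (\<Prod>k=1..m. q k))"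
        by (simp only: PQ prod.neutral_const mult_1_right)
      also have "\<dots> = exp (X n * h) * p l * (\<Prod>k=1..m. q k)" by (simp only: rec mult.assoc[symmetric])
      also have "\<dots> \<le> exp (B * h) * p l * exp (- ((B + 1) * h))"
        using Q Xh p0 q by (intro mult_mono mult_nonneg_nonneg prod_nonneg) auto
      also have "\<dots> = (exp (B * h) * exp (- ((B + 1) * h))) * p l" by simp
      also have "exp (B * h) * exp (- ((B + 1) * h)) = exp (- h)"
        unfolding exp_add[symmetric] by (simp add: algebra_simps)
      finally show ?thesis .
    qed
    have down: "p l \<le> exp (- h) * p (Suc l)" if l: "real (Suc l) \<le> y * real n - C / h" for l
    proof -
      define q where "q = (\<lambda>k. (\<delta> k + real (Suc l) / real n) / (\<delta> k + y))"
      have yl: "real (Suc l) / real n \<le> y - C * h"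
      proof -
        have "real (Suc l) \<le> y * real n - C * (real n * h)" using l unfolding nh[symmetric] by simp
        thus ?thesis using n by (simp add: field_simps)
      qed
      have Ch: "C * h > 0" using C h by simp
      have l0: "0 \<le> real (Suc l) / real n" by simp
      have q: "0 \<le> q k \<and> q k \<le> 1" if "k \<in> {1..m}" for k
      proof -
        have g: "\<delta> k + y > 0" using \<gamma>[OF that] .
        have "0 \<le> \<delta> k + real (Suc l) / real n" "\<delta> k + real (Suc l) / real n \<le> \<delta> k + y"
          using \<delta>[OF that] yl Ch l0 by linarith+
        thus ?thesis unfolding q_def using g by (simp only: divide_nonneg_pos divide_le_eq_1_pos simp_thms)
      qed
      have "(\<Prod>k=1..m. q k) \<le> q 1" by (rule prod_le_one_factor) (use q m in auto)
      also have "q 1 \<le> (\<delta> 1 + (y - C * h)) / (\<delta> 1 + y)"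
        unfolding q_def using g1 yl by (intro divide_right_mono) auto
      also have "\<delta> 1 + (y - C * h) = (\<delta> 1 + y) * (1 - C' * h)" by (simp add: C_def algebra_simps)
      also have "(\<delta> 1 + y) * (1 - C' * h) / (\<delta> 1 + y) = 1 - C' * h" using g1 by simp
      also have "\<dots> \<le> exp (- (C' * h))" using exp_ge_add_one_self[of "- (C' * h)"] by simp
      also have "\<dots> \<le> exp (- ((B + 1) * h))" using B h by (simp add: C'_def)
      finally have Q: "(\<Prod>k=1..m. q k) \<le> exp (- ((B + 1) * h))" .
      have "p l = exp (- (X n * h)) * (exp (X n * h) * p l)" by (simp add: exp_minus)
      also have "\<dots> = exp (- (X n * h)) * (p (Suc l) * (\<Prod>k=1..m. q k))" using rec[of l] by (simp add: q_def)
      also have "\<dots> \<le> exp (B * h) * (p (Suc l) * exp (- ((B + 1) * h)))"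
        using Q Xh p0 q by (intro mult_mono mult_nonneg_nonneg prod_nonneg mult_left_mono) auto
      also have "\<dots> = (exp (B * h) * exp (- ((B + 1) * h))) * p (Suc l)" by simp
      also have "exp (B * h) * exp (- ((B + 1) * h)) = exp (- h)"
        unfolding exp_add[symmetric] by (simp add: algebra_simps)
      finally show ?thesis .
    qed
    have Ch1: "h * (C / h + 1) \<le> C + 1" using h by (simp add: distrib_left)
    show ?case
    proof (intro allI impI)
      fix l assume l: "l < n"
      have yn: "0 \<le> y * real n" "y * real n \<le> real n" using y by (auto simp: mult_left_le_one_le)
      have Chp: "0 \<le> C / h" using C h by simp
      have "p l \<le> D0 * exp (h * (C / h + 1) - h * (real l - y * real n))"
        by (rule exp_decay_above[where p=p, OF D0 h(1) yn(1) Chp _ _ l]) (erule pD0, rule up)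
      moreover have "p l \<le> D0 * exp (h * (C / h + 1) + h * (real l - y * real n))"
        by (rule exp_decay_below[where p=p, OF D0 h(1) yn(2) Chp _ _ l]) (erule pD0, rule down)
      ultimately have "p l \<le> D0 * exp (h * (C / h + 1) - \<bar>real l - y * real n\<bar> * h)"
      proof (cases "real l \<ge> y * real n")
        case True
        hence "\<bar>real l - y * real n\<bar> * h = h * (real l - y * real n)" by simp
        with \<open>p l \<le> D0 * exp (h * (C / h + 1) - h * (real l - y * real n))\<close> show ?thesis by (simp only:)
      next
        case False
        hence "h * (C / h + 1) - \<bar>real l - y * real n\<bar> * h = h * (C / h + 1) + h * (real l - y * real n)"
          by (simp add: abs_if algebra_simps)
        with \<open>p l \<le> D0 * exp (h * (C / h + 1) + h * (real l - y * real n))\<close> show ?thesis by (simp only:)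
      qed
      also have "\<dots> \<le> D0 * exp ((C + 1) - \<bar>real l - y * real n\<bar> * h)"
        using Ch1 D0 by (intro mult_left_mono) auto
      also have "\<dots> = (D0 * exp (C + 1)) * exp (- \<bar>real l - y * real n\<bar> * h)"
        by (simp add: exp_diff exp_minus divide_inverse)
      finally show "loggam_density m (\<lambda>k. \<delta> k * real n) l (log_center m \<delta> y n + X n / sqrt (real n)) / sqrt (real n)
       \<le> (D0 * exp (C + 1)) * exp (- \<bar>real l - y * real n\<bar> / sqrt (real n))"
        by (simp add: p_def x_def a_def h_def)
    qed
  qed
  moreover have "D0 * exp (C + 1) \<ge> 0" using D0 by simp
  ultimately show ?thesis by blast
qed

section \<open>The local limit theorem\<close>

text \<open>Reconciles two numberings: in \<open>iconv\<close> the seed has index 0, among the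
  parameters it has index \<open>m\<close>.\<close>

lemma sum_last_as_zero:
  fixes f :: "nat \<Rightarrow> 'a :: comm_monoid_add"
  assumes "m \<ge> 1"
  shows "(\<Sum>k\<le>m - 1. f (if k = 0 then m else k)) = (\<Sum>k=1..m. f k)"
proof -
  have "{..m - 1} = insert 0 {1..m - 1}" "{1..m} = insert m {1..m - 1}" using assms by auto
  moreover have "(\<Sum>k=1..m - 1. f (if k = 0 then m else k)) = (\<Sum>k=1..m - 1. f k)"
    by (intro sum.cong) auto
  ultimately show ?thesis using assms by simp
qed

text \<open>Each factor is centred at its own mode \<open>ln (K k n)\<close>. The distance of
  \<open>log_center\<close> from the sum of these modes, times \<open>sqrt n\<close>, tends to
  \<open>- t * S\<close>, because \<open>S\<close> is the derivative of
  \<open>\<Sum>k=1..m. ln (\<delta> k + y)\<close> in \<open>y\<close>. Variances add, so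
  \<open>S\<close> is also the limiting variance.\<close>

lemma tendsto_loggam_density:
  fixes X :: "nat \<Rightarrow> real" and l :: "nat \<Rightarrow> nat"
  assumes m: "m \<ge> 1" and \<delta>: "\<And>k. k \<in> {1..m} \<Longrightarrow> \<delta> k \<ge> 0"
    and \<gamma>: "\<And>k. k \<in> {1..m} \<Longrightarrow> \<delta> k + y > 0"
    and X: "X \<longlonglongrightarrow> X0"
    and l: "(\<lambda>n. (real (l n) - y * real n) / sqrt (real n)) \<longlonglongrightarrow> t"
  shows "(\<lambda>n. loggam_density m (\<lambda>k. \<delta> k * real n) (l n) (log_center m \<delta> y n + X n / sqrt (real n)) / sqrt (real n))
     \<longlonglongrightarrow> normal_density 0 (sqrt (\<Sum>k=1..m. 1 / (\<delta> k + y))) (X0 - t * (\<Sum>k=1..m. 1 / (\<delta> k + y)))"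
proof -
  define idx where "idx = (\<lambda>k. if k = 0 then m else k)"
  have idx: "idx k \<in> {1..m}" if "k \<le> m - 1" for k using that m by (auto simp: idx_def)
  define K where "K = (\<lambda>k n. \<delta> k * real n + real (l n) + 1)"
  have K1: "K k n \<ge> 1" if "k \<in> {1..m}" for k n using \<delta>[OF that] by (simp add: K_def)
  have s0: "(\<lambda>n. 1 / sqrt (real n)) \<longlonglongrightarrow> 0" "(\<lambda>n. 1 / real n) \<longlonglongrightarrow> 0" by real_asymp+
  have Klim: "(\<lambda>n. K k n / real n) \<longlonglongrightarrow> \<delta> k + y" for k
  proof -
    have "(\<lambda>n. \<delta> k + y + (real (l n) - y * real n) / sqrt (real n) * (1 / sqrt (real n)) + 1 / real n) \<longlonglongrightarrow> \<delta> k + y + t * 0 + 0"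
      by (intro tendsto_intros l s0)
    moreover have "\<forall>\<^sub>F n in sequentially. \<delta> k + y + (real (l n) - y * real n) / sqrt (real n) * (1 / sqrt (real n)) + 1 / real n = K k n / real n"
      using eventually_gt_at_top[of 0]
    proof eventually_elim
      case (elim n)
      hence "(real (l n) - y * real n) / sqrt (real n) * (1 / sqrt (real n)) = (real (l n) - y * real n) / real n"
        by simp
      thus ?case using elim by (simp add: K_def field_simps)
    qed
    ultimately have "(\<lambda>n. K k n / real n) \<longlonglongrightarrow> \<delta> k + y + t * 0 + 0" by (rule Lim_transform_eventually)
    thus ?thesis by simp
  qed
  define b where "b = (\<lambda>n k. ln (K (idx k) n))"
  define c where "c = (\<lambda>n::nat. 1 / sqrt (real n))"
  define G where "G = (\<lambda>n h. c n * lgam (K m n) (b n 0 + c n * h))"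
  define F where "F = (\<lambda>n k h. c n * lgam (K k n) (b n k + c n * h))"
  define x where "x = (\<lambda>n. log_center m \<delta> y n + X n / sqrt (real n))"
  define x' where "x' = (\<lambda>n. sqrt (real n) * (x n - (\<Sum>k\<le>m - 1. b n k)))"
  define S where "S = (\<Sum>k=1..m. 1 / (\<delta> k + y))"
  \<comment> \<open>The 1 beyond the relevant indices only keeps every \<open>\<sigma> k\<close>
    positive.\<close>
  define \<sigma> where "\<sigma> = (\<lambda>k. if k \<le> m - 1 then 1 / sqrt (\<delta> (idx k) + y) else 1)"
  have \<sigma>: "\<sigma> k > 0" for k using \<gamma>[OF idx[of k]] by (simp add: \<sigma>_def)
  have \<sigma>S: "(\<Sum>k\<le>m - 1. (\<sigma> k)\<^sup>2) = S"
  proof -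
    have "(\<Sum>k\<le>m - 1. (\<sigma> k)\<^sup>2) = (\<Sum>k\<le>m - 1. 1 / (\<delta> (idx k) + y))"
      using \<gamma>[OF idx] by (intro sum.cong refl) (auto simp: \<sigma>_def power_divide less_imp_le)
    thus ?thesis unfolding S_def idx_def using sum_last_as_zero[OF m, of "\<lambda>k. 1 / (\<delta> k + y)"] by simp
  qed
  have x'lim: "x' \<longlonglongrightarrow> X0 - t * S"
  proof -
    \<comment> \<open>Defined so that
      \<open>1 + e k n / sqrt n = K k n / (n * (\<delta> k + y))\<close>; the summand
      \<open>1 / sqrt n\<close> comes from the \<open>+ 1\<close> in the shape parameter and
      vanishes in the limit.\<close>
    define e where "e = (\<lambda>k n. ((real (l n) - y * real n) / sqrt (real n) + 1 / sqrt (real n)) / (\<delta> k + y))"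
    have "(\<lambda>n. X n - (\<Sum>k=1..m. sqrt (real n) * ln (1 + e k n / sqrt (real n)))) \<longlonglongrightarrow> X0 - (\<Sum>k=1..m. 1 * (t / (\<delta> k + y)))"
    proof (intro tendsto_diff X tendsto_sum)
      fix k assume k: "k \<in> {1..m}"
      have "e k \<longlonglongrightarrow> (t + 0) / (\<delta> k + y)"
        unfolding e_def using \<gamma>[OF k] by (intro tendsto_intros l s0) auto
      moreover have "((\<lambda>x::real. ln (1 + x)) has_field_derivative 1) (at 0)"
        by (auto intro!: derivative_eq_intros)
      ultimately show "(\<lambda>n. sqrt (real n) * ln (1 + e k n / sqrt (real n))) \<longlonglongrightarrow> 1 * (t / (\<delta> k + y))"
        using tendsto_sqrt_scaled[of "\<lambda>x::real. ln (1 + x)" 1 "e k" "t / (\<delta> k + y)"] by simp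
    qed
    moreover have "\<forall>\<^sub>F n in sequentially. X n - (\<Sum>k=1..m. sqrt (real n) * ln (1 + e k n / sqrt (real n))) = x' n"
      using eventually_gt_at_top[of 0]
    proof eventually_elim
      case (elim n)
      have ek: "ln (1 + e k n / sqrt (real n)) = ln (K k n) - ln (real n) - ln (\<delta> k + y)" if k: "k \<in> {1..m}" for k
      proof -
        have "1 + e k n / sqrt (real n) = K k n / (real n * (\<delta> k + y))"
        proof -
          have E: "e k n / sqrt (real n) = (real (l n) - y * real n + 1) / (real n * (\<delta> k + y))"
            using elim by (simp add: e_def add_divide_distrib[symmetric])
          have "K k n = real n * (\<delta> k + y) + (real (l n) - y * real n + 1)" by (simp add: K_def algebra_simps)
          moreover have "real n * (\<delta> k + y) \<noteq> 0" using elim \<gamma>[OF k] by simp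
          ultimately show ?thesis unfolding E by (simp add: add_divide_distrib)
        qed
        thus ?thesis using elim \<gamma>[OF k] K1[OF k, of n] by (simp add: ln_div ln_mult)
      qed
      have "(\<Sum>k\<le>m - 1. b n k) = (\<Sum>k=1..m. ln (K k n))"
        unfolding b_def idx_def using sum_last_as_zero[OF m, of "\<lambda>k. ln (K k n)"] by simp
      hence E: "x n - (\<Sum>k\<le>m - 1. b n k) = X n / sqrt (real n) - (\<Sum>k=1..m. ln (1 + e k n / sqrt (real n)))"
        by (simp add: x_def log_center_def ek sum_subtractf)
      show ?case unfolding x'_def E using elim by (simp add: right_diff_distrib sum_distrib_left)
    qed
    ultimately have "x' \<longlonglongrightarrow> X0 - (\<Sum>k=1..m. 1 * (t / (\<delta> k + y)))" by (rule Lim_transform_eventually)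
    thus ?thesis by (simp add: S_def sum_distrib_left)
  qed
  have m_in: "m \<in> {1..m}" using m by simp
  have "(\<lambda>n. iconv (G n) (F n) (m - 1) (x' n)) \<longlonglongrightarrow> normal_density 0 (sqrt (\<Sum>k\<le>m - 1. (\<sigma> k)\<^sup>2)) (X0 - t * S)"
  proof -
    obtain D b' where D: "D > 0" "b' > 0"
      "\<forall>\<^sub>F n in sequentially. \<forall>h. 1 / sqrt (real n) * lgam (K m n) (ln (K m n) + h / sqrt (real n)) \<le> D * exp (- b' * \<bar>h\<bar>)"
      using lgam_rescaled_dominated[OF Klim \<gamma>[OF m_in] K1[OF m_in]] .
    show ?thesis
    proof (rule tendsto_iconv_normal_density[where B=D])
      show "\<And>k. \<sigma> k > 0" by (rule \<sigma>)
      show "(\<lambda>n. G n (z n)) \<longlonglongrightarrow> normal_density 0 (\<sigma> 0) z0" if "z \<longlonglongrightarrow> z0" for z z0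
        using tendsto_lgam_rescaled[OF Klim \<gamma>[OF m_in] that]
        by (simp add: G_def c_def b_def idx_def \<sigma>_def)
      show "G n \<in> borel_measurable borel" for n unfolding G_def by measurable
      show "\<forall>\<^sub>F n in sequentially. \<forall>x. 0 \<le> G n x \<and> G n x \<le> D"
        using D(3)
      proof eventually_elim
        case (elim n)
        have "D * exp (- b' * \<bar>x\<bar>) \<le> D * 1" for x using D by (intro mult_left_mono) auto
        with elim have "1 / sqrt (real n) * lgam (K m n) (ln (K m n) + x / sqrt (real n)) \<le> D" for x
          by (metis mult.right_neutral order_trans)
        moreover have "0 \<le> lgam (K m n) x" for x using K1[OF m_in, of n] by (intro lgam_nonneg) linarith
        ultimately show ?case by (simp add: G_def c_def b_def idx_def)
      qed
      fix k assume k: "k \<in> {1..m - 1}"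
      hence k': "k \<in> {1..m}" "idx k = k" by (auto simp: idx_def)
      show "(\<lambda>n. F n k h) \<longlonglongrightarrow> normal_density 0 (\<sigma> k) h" for h
        using tendsto_lgam_rescaled[OF Klim \<gamma>[OF k'(1)] tendsto_const, of h] k
        by (simp add: F_def c_def b_def k' \<sigma>_def)
      show "\<forall>\<^sub>F n in sequentially. prob_density (F n k)"
        using eventually_gt_at_top[of 0]
      proof eventually_elim
        case (elim n)
        show ?case unfolding F_def
          by (rule prob_density_affine[OF prob_density_lgam]) (use elim K1[OF k'(1), of n] in \<open>auto simp: c_def\<close>)
      qed
      obtain D b' where "D > 0" "b' > 0"
        "\<forall>\<^sub>F n in sequentially. \<forall>h. 1 / sqrt (real n) * lgam (K k n) (ln (K k n) + h / sqrt (real n)) \<le> D * exp (- b' * \<bar>h\<bar>)"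
        using lgam_rescaled_dominated[OF Klim \<gamma>[OF k'(1)] K1[OF k'(1)]] .
      thus "\<exists>D b. b > 0 \<and> (\<forall>\<^sub>F n in sequentially. \<forall>h. F n k h \<le> D * exp (- b * \<bar>h\<bar>))"
        by (intro exI[of _ D] exI[of _ b']) (simp add: F_def c_def b_def k')
    qed (rule x'lim)
  qed
  moreover have "\<forall>\<^sub>F n in sequentially. iconv (G n) (F n) (m - 1) (x' n) = loggam_density m (\<lambda>k. \<delta> k * real n) (l n) (x n) / sqrt (real n)"
    using eventually_gt_at_top[of 0]
  proof eventually_elim
    case (elim n)
    have "iconv (G n) (F n) (m - 1) (x' n) = c n * iconv (lgam (K m n)) (\<lambda>k. lgam (K k n)) (m - 1) ((\<Sum>k\<le>m - 1. b n k) + c n * x' n)"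
      unfolding G_def F_def by (rule iconv_affine) (use elim in \<open>simp add: c_def\<close>)
    also have "(\<Sum>k\<le>m - 1. b n k) + c n * x' n = x n"
      using elim by (simp add: c_def x'_def)
    finally show ?case by (simp add: loggam_density_def K_def c_def)
  qed
  ultimately show ?thesis unfolding \<sigma>S S_def x_def by (rule Lim_transform_eventually)
qed

section \<open>Sums as integrals\<close>

text \<open>The sum is the integral of a step function in \<open>t\<close>, the index being \<open>\<lfloor>c n + t \<surd>n\<rfloor>\<close>.\<close>
lemma tendsto_rescaled_sum_integral:
  fixes F :: "nat \<Rightarrow> nat \<Rightarrow> complex" and c :: "nat \<Rightarrow> real"
  assumes D: "D \<ge> 0"
    and bd: "\<forall>\<^sub>F n in sequentially. \<forall>l<n. norm (F n l) \<le> D * exp (- \<bar>real l - c n\<bar> / sqrt (real n))"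
    and lim: "AE t in lborel. (\<lambda>n. if 0 \<le> \<lfloor>c n + t * sqrt (real n)\<rfloor> \<and> \<lfloor>c n + t * sqrt (real n)\<rfloor> < int n
       then F n (nat \<lfloor>c n + t * sqrt (real n)\<rfloor>) else 0) \<longlonglongrightarrow> f t"
    and f: "f \<in> borel_measurable borel"
  shows "(\<lambda>n. of_real (1 / sqrt (real n)) * (\<Sum>l<n. F n l)) \<longlonglongrightarrow> (\<integral>t. f t \<partial>lborel)"
proof -
  define s where "s = (\<lambda>n t. if 0 \<le> \<lfloor>c n + t * sqrt (real n)\<rfloor> \<and> \<lfloor>c n + t * sqrt (real n)\<rfloor> < int n
       then F n (nat \<lfloor>c n + t * sqrt (real n)\<rfloor>) else 0)"
  have s_sum: "s n t = (\<Sum>l<n. indicator {(real l - c n) / sqrt (real n)..<(real l + 1 - c n) / sqrt (real n)} t *\<^sub>R F n l)"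
    if n: "n > 0" for n t
  proof -
    define L where "L = \<lfloor>c n + t * sqrt (real n)\<rfloor>"
    have sL: "s n t = (if 0 \<le> L \<and> L < int n then F n (nat L) else 0)" unfolding s_def L_def ..
    have ind: "t \<in> {(real l - c n) / sqrt (real n)..<(real l + 1 - c n) / sqrt (real n)} \<longleftrightarrow> int l = L" for l
    proof -
      have "t \<in> {(real l - c n) / sqrt (real n)..<(real l + 1 - c n) / sqrt (real n)} \<longleftrightarrow>
          real l \<le> c n + t * sqrt (real n) \<and> c n + t * sqrt (real n) < real l + 1"
        using n by (auto simp: field_simps)
      thus ?thesis unfolding L_def by (metis eq_commute floor_eq_iff of_int_of_nat_eq)
    qed
    have "(\<Sum>l<n. indicator {(real l - c n) / sqrt (real n)..<(real l + 1 - c n) / sqrt (real n)} t *\<^sub>R F n l)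
        = (\<Sum>l<n. if int l = L then F n l else 0)"
      unfolding indicator_def ind by (intro sum.cong refl) auto
    also have "\<dots> = s n t"
    proof (cases "0 \<le> L \<and> L < int n")
      case True
      hence "(int l = L) = (l = nat L)" for l by auto
      moreover have "nat L < n" using True by auto
      ultimately show ?thesis using True by (simp add: sL)
    next
      case False
      hence "int l \<noteq> L" if "l < n" for l using that by auto
      thus ?thesis using False by (auto simp: sL)
    qed
    finally show ?thesis ..
  qed
  have int_s: "integral\<^sup>L lborel (s n) = of_real (1 / sqrt (real n)) * (\<Sum>l<n. F n l)" if n: "n > 0" for n
  proof -
    have fin: "emeasure lborel {(real l - c n) / sqrt (real n)..<(real l + 1 - c n) / sqrt (real n)} < \<infinity>"
      and ms: "measure lborel {(real l - c n) / sqrt (real n)..<(real l + 1 - c n) / sqrt (real n)} = 1 / sqrt (real n)" for l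
    proof -
      have le: "(real l - c n) / sqrt (real n) \<le> (real l + 1 - c n) / sqrt (real n)" by (simp add: divide_right_mono)
      show "emeasure lborel {(real l - c n) / sqrt (real n)..<(real l + 1 - c n) / sqrt (real n)} < \<infinity>"
        using le by simp
      show "measure lborel {(real l - c n) / sqrt (real n)..<(real l + 1 - c n) / sqrt (real n)} = 1 / sqrt (real n)"
        using le by (simp add: diff_divide_distrib[symmetric])
    qed
    have "integral\<^sup>L lborel (s n) = (\<integral>t. (\<Sum>l<n. indicator {(real l - c n) / sqrt (real n)..<(real l + 1 - c n) / sqrt (real n)} t *\<^sub>R F n l) \<partial>lborel)"
      by (simp add: s_sum[OF n] cong: Bochner_Integration.integral_cong)
    also have "\<dots> = (\<Sum>l<n. (1 / sqrt (real n)) *\<^sub>R F n l)"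
      using fin by (subst Bochner_Integration.integral_sum) (auto simp: ms intro!: integrable_scaleR_left integrable_real_indicator)
    finally show ?thesis by (simp add: scaleR_conv_of_real sum_distrib_left)
  qed
  have "(\<lambda>n. integral\<^sup>L lborel (s n)) \<longlonglongrightarrow> integral\<^sup>L lborel f"
  \<comment> \<open>The factor \<open>exp 1\<close> pays for the rounding of the index: an error of
    at most 1 is at most \<open>sqrt n\<close>, that is, at most 1 in \<open>t\<close>.\<close>
  proof (rule dominated_convergence_eventually[where w="\<lambda>t. D * exp 1 * exp (- 1 * \<bar>t\<bar>)"])
    show "integrable lborel (\<lambda>t. D * exp 1 * exp (- 1 * \<bar>t\<bar>))"
      by (intro integrable_mult_right integrable_exp_neg_abs) simp
    show "s n \<in> borel_measurable lborel" for n unfolding s_def by measurable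
    show "AE t in lborel. (\<lambda>n. s n t) \<longlonglongrightarrow> f t" using lim unfolding s_def .
    show "\<forall>\<^sub>F n in sequentially. \<forall>t. norm (s n t) \<le> D * exp 1 * exp (- 1 * \<bar>t\<bar>)"
      using bd eventually_gt_at_top[of 0]
    proof eventually_elim
      case (elim n)
      show ?case
      proof
        fix t
        define L where "L = \<lfloor>c n + t * sqrt (real n)\<rfloor>"
    have sL: "s n t = (if 0 \<le> L \<and> L < int n then F n (nat L) else 0)" unfolding s_def L_def ..
        show "norm (s n t) \<le> D * exp 1 * exp (- 1 * \<bar>t\<bar>)"
        proof (cases "0 \<le> L \<and> L < int n")
          case False thus ?thesis using D by (auto simp: sL)
        next
          case True
          have sn: "sqrt (real n) \<ge> 1" using elim by simp
          have rl: "real (nat L) = of_int L" using True by simp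
          have "\<bar>of_int L - (c n + t * sqrt (real n))\<bar> \<le> 1" unfolding L_def by linarith
          hence "\<bar>t * sqrt (real n)\<bar> - 1 \<le> \<bar>of_int L - c n\<bar>" by linarith
          hence "\<bar>t\<bar> * sqrt (real n) - 1 \<le> \<bar>of_int L - c n\<bar>" by (simp add: abs_mult)
          hence "\<bar>t\<bar> * sqrt (real n) - sqrt (real n) \<le> \<bar>of_int L - c n\<bar>" using sn by linarith
          hence "\<bar>t\<bar> - 1 \<le> \<bar>real (nat L) - c n\<bar> / sqrt (real n)" unfolding rl using sn by (simp add: field_simps)
          hence "exp (- \<bar>real (nat L) - c n\<bar> / sqrt (real n)) \<le> exp (1 + - 1 * \<bar>t\<bar>)" by simp
          hence "D * exp (- \<bar>real (nat L) - c n\<bar> / sqrt (real n)) \<le> D * (exp 1 * exp (- 1 * \<bar>t\<bar>))"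
            unfolding exp_add using D by (rule mult_left_mono)
          moreover have "norm (s n t) \<le> D * exp (- \<bar>real (nat L) - c n\<bar> / sqrt (real n))"
          proof -
            have "nat L < n" using True by linarith
            hence "norm (F n (nat L)) \<le> D * exp (- \<bar>real (nat L) - c n\<bar> / sqrt (real n))" using elim(1) by blast
            thus ?thesis using True by (simp only: sL if_True simp_thms)
          qed
          ultimately show ?thesis by simp
        qed
      qed
    qed
  qed (use f in auto)
  thus ?thesis
    by (rule Lim_transform_eventually) (use int_s in \<open>auto intro: eventually_mono[OF eventually_gt_at_top[of 0]]\<close>)
qed

section \<open>Gaussian integrals over half-lines\<close>

lemma integrable_exp_linear_minus_quadratic:
  fixes w :: complex
  shows "integrable lborel (\<lambda>t. exp (of_real t * w - of_real (t\<^sup>2 / 2)))"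
proof (rule Bochner_Integration.integrable_bound)
  \<comment> \<open>The 1 added to \<open>\<bar>Re w\<bar>\<close> leaves
    \<open>exp (- \<bar>t\<bar>)\<close> over once the square
    \<open>(\<bar>t\<bar> - ?r)\<^sup>2 \<ge> 0\<close> has been used.\<close>
  let ?r = "\<bar>Re w\<bar> + 1"
  show "integrable lborel (\<lambda>t::real. exp (?r\<^sup>2 / 2) * exp (- 1 * \<bar>t\<bar>))"
    by (intro integrable_mult_right integrable_exp_neg_abs) simp
  show "AE t in lborel. norm (exp (of_real t * w - of_real (t\<^sup>2 / 2))) \<le> norm (exp (?r\<^sup>2 / 2) * exp (- 1 * \<bar>t\<bar>))"
  proof (rule AE_I2)
    fix t :: real
    have "0 \<le> (\<bar>t\<bar> - ?r)\<^sup>2" by simp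
    hence "\<bar>t\<bar> * ?r \<le> ?r\<^sup>2 / 2 + t\<^sup>2 / 2" unfolding power2_diff by simp
    moreover have "t * Re w \<le> \<bar>t\<bar> * \<bar>Re w\<bar>" using abs_ge_self[of "t * Re w"] by (simp add: abs_mult)
    ultimately have "t * Re w - t\<^sup>2 / 2 \<le> ?r\<^sup>2 / 2 - \<bar>t\<bar>" by (simp add: distrib_left)
    thus "norm (exp (of_real t * w - of_real (t\<^sup>2 / 2))) \<le> norm (exp (?r\<^sup>2 / 2) * exp (- 1 * \<bar>t\<bar>))"
      by (simp add: norm_exp_eq_Re exp_add[symmetric])
  qed
qed measurable

section \<open>The error function and Gaussian integrals with complex parameter\<close>

lemma continuous_on_erf [continuous_intros]:
  "continuous_on S f \<Longrightarrow> continuous_on S (\<lambda>x. erf (f x))"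
  by (rule continuous_on_compose2[of UNIV erf])
     (auto intro!: continuous_at_imp_continuous_on DERIV_isCont[OF has_field_derivative_erf])

lemma continuous_on_erfc [continuous_intros]:
  "continuous_on S f \<Longrightarrow> continuous_on S (\<lambda>x. erfc (f x))"
  unfolding erfc_def by (intro continuous_intros)

lemma erf_minus: "erf (- z) = - erf z"
proof -
  have "((\<lambda>z. erf (- z) + erf z) has_field_derivative 0) (at z)" for z
  proof -
    have "((\<lambda>z. erf (- z)) has_field_derivative of_real (2 / sqrt pi) * exp (- ((- z)\<^sup>2)) * (- 1)) (at z)"
      by (rule DERIV_chain2[OF has_field_derivative_erf]) (auto intro!: derivative_eq_intros)
    from DERIV_add[OF this has_field_derivative_erf] show ?thesis by simp
  qed
  hence "\<exists>c. \<forall>z\<in>UNIV. erf (- z) + erf z = c"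
    by (intro has_field_derivative_zero_constant) auto
  then obtain c where c: "\<And>z. erf (- z) + erf z = c" by auto
  from c[of 0] have "c = 0" by simp
  with c[of z] show ?thesis by (simp add: add_eq_0_iff)
qed

lemma tendsto_erf_at_top: "((\<lambda>x. erf (of_real x)) \<longlongrightarrow> 1) at_top"
proof -
  let ?f = "\<lambda>x::real. indicator {0..} x *\<^sub>R exp (- x\<^sup>2) :: real"
  have I: "integrable lborel ?f" "(\<integral>x. ?f x \<partial>lborel) = sqrt pi / 2"
    using gaussian_moment_0 by (auto simp: has_bochner_integral_iff)
  have "((\<lambda>y. \<integral>x. indicator {..y} x *\<^sub>R ?f x \<partial>lborel) \<longlongrightarrow> sqrt pi / 2) at_top"
    using tendsto_integral_at_top[OF sets_lborel I(1)] unfolding I(2) .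
  hence "((\<lambda>y. of_real (2 / sqrt pi * (\<integral>x. indicator {..y} x *\<^sub>R ?f x \<partial>lborel)) :: complex) \<longlongrightarrow> of_real (2 / sqrt pi * (sqrt pi / 2))) at_top"
    by (intro tendsto_intros)
  moreover have "\<forall>\<^sub>F y in at_top. of_real (2 / sqrt pi * (\<integral>x. indicator {..y} x *\<^sub>R ?f x \<partial>lborel)) = erf (of_real y)"
    using eventually_ge_at_top[of 0]
  proof eventually_elim
    case (elim y)
    let ?g = "\<lambda>x::real. of_real (2 / sqrt pi) * exp (- ((of_real x)\<^sup>2)) :: complex"
    have "(\<integral>x. indicator {0..y} x *\<^sub>R ?g x \<partial>lborel) = erf (of_real y) - erf (of_real 0)"
    proof (rule integral_FTC_atLeastAtMost[OF elim])
      fix x :: real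
      have "((\<lambda>x. erf (of_real x)) has_vector_derivative (1 * ?g x)) (at x within {0..y})"
        using has_vector_derivative_real_field[OF has_field_derivative_erf] by simp
      thus "((\<lambda>x. erf (of_real x)) has_vector_derivative ?g x) (at x within {0..y})" by simp
    qed (intro continuous_intros)
    also have "(\<integral>x. indicator {0..y} x *\<^sub>R ?g x \<partial>lborel)
        = (\<integral>x. of_real (2 / sqrt pi * (indicator {..y} x *\<^sub>R ?f x)) \<partial>lborel)"
      by (intro Bochner_Integration.integral_cong) (auto simp: indicator_def exp_of_real[symmetric])
    also have "\<dots> = of_real (2 / sqrt pi * (\<integral>x. indicator {..y} x *\<^sub>R ?f x \<partial>lborel))"
      by (subst integral_complex_of_real) simp
    finally show ?case by simp
  qed
  ultimately have "((\<lambda>y. erf (of_real y)) \<longlongrightarrow> of_real (2 / sqrt pi * (sqrt pi / 2))) at_top"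
    by (rule Lim_transform_eventually)
  thus ?thesis by simp
qed

text \<open>On the disc of radius \<open>r = cmod c\<close> around \<open>x\<close> the derivative
  of erf is at most a multiple of \<open>exp (r\<^sup>2 - (x - r)\<^sup>2)\<close>, so a bounded
  complex shift is harmless. It supplies the value at infinity of the antiderivative in the
  half-line integral with complex \<open>w\<close>.\<close>

lemma tendsto_erf_shift_at_top: "((\<lambda>x. erf (of_real x + c)) \<longlongrightarrow> 1) at_top"
proof -
  define r where "r = cmod c"
  let ?B = "\<lambda>x. 2 / sqrt pi * exp (r\<^sup>2 - (x - r)\<^sup>2)"
  have "((\<lambda>x. ?B x * r) \<longlongrightarrow> 0) at_top" by real_asymp
  moreover have "\<forall>\<^sub>F x in at_top. norm (erf (of_real x + c) - erf (of_real x)) \<le> ?B x * r"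
    using eventually_ge_at_top[of r]
  proof eventually_elim
    case (elim x)
    have "norm (erf (of_real x + c) - erf (of_real x)) \<le> ?B x * norm (of_real x + c - of_real x)"
    proof (rule field_differentiable_bound[OF convex_cball])
      show "of_real x + c \<in> cball (of_real x) r" "of_real x \<in> cball (of_real x) r"
        by (auto simp: r_def dist_norm)
      fix z assume z: "z \<in> cball (complex_of_real x) r"
      show "(erf has_field_derivative of_real (2 / sqrt pi) * exp (- z\<^sup>2)) (at z within cball (of_real x) r)"
        by (rule has_field_derivative_at_within[OF has_field_derivative_erf])
      have zr: "cmod (z - of_real x) \<le> r" using z by (simp add: dist_norm norm_minus_commute)
      have "\<bar>Re z - x\<bar> \<le> r" using abs_Re_le_cmod[of "z - of_real x"] zr by simp
      hence "x - r \<le> Re z" by linarith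
      hence "(x - r)\<^sup>2 \<le> (Re z)\<^sup>2" using elim by (intro power_mono) auto
      moreover have "\<bar>Im z\<bar> \<le> r" using abs_Im_le_cmod[of "z - of_real x"] zr by simp
      hence "(Im z)\<^sup>2 \<le> r\<^sup>2" by (metis abs_ge_zero power2_abs power_mono)
      ultimately have "Re (- z\<^sup>2) \<le> r\<^sup>2 - (x - r)\<^sup>2" by (simp add: power2_eq_square)
      thus "norm (of_real (2 / sqrt pi) * exp (- z\<^sup>2)) \<le> ?B x"
        by (simp add: norm_mult norm_divide norm_exp_eq_Re divide_right_mono)
    qed
    thus ?case by (simp add: r_def)
  qed
  ultimately have "((\<lambda>x. erf (of_real x + c) - erf (of_real x)) \<longlongrightarrow> 0) at_top"
    by (rule Lim_null_comparison[rotated])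
  from tendsto_add[OF this tendsto_erf_at_top] show ?thesis by simp
qed

text \<open>Completing the square gives the antiderivative \<open>F\<close> along the real line
  directly for complex \<open>w\<close>, so no contour has to be moved; the value is the difference
  of the limits of \<open>F\<close> at infinity and at 0.\<close>

lemma gaussian_half_line_integral:
  fixes w :: complex
  shows "(\<integral>t. indicator {0<..} t *\<^sub>R exp (of_real t * w - of_real (t\<^sup>2 / 2)) \<partial>lborel)
       = of_real (sqrt (pi / 2)) * exp (w\<^sup>2 / 2) * erfc (- w / of_real (sqrt 2))"
proof -
  let ?f = "\<lambda>t. exp (of_real t * w - of_real (t\<^sup>2 / 2)) :: complex"
  define C where "C = of_real (sqrt (pi / 2)) * exp (w\<^sup>2 / 2)"
  define F where "F = (\<lambda>t. C * erf ((of_real t - w) / of_real (sqrt 2)))"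
  have s2: "(complex_of_real (sqrt 2))\<^sup>2 = 2" by (simp flip: of_real_power)
  have der: "(F has_vector_derivative ?f t) (at t)" for t
  proof -
    let ?g = "\<lambda>z. C * erf ((z - w) / of_real (sqrt 2))"
    have "((\<lambda>z. erf ((z - w) / of_real (sqrt 2))) has_field_derivative
        of_real (2 / sqrt pi) * exp (- (((of_real t - w) / of_real (sqrt 2))\<^sup>2)) * (1 / of_real (sqrt 2))) (at (of_real t))"
      by (rule DERIV_chain2[OF has_field_derivative_erf], rule DERIV_cdivide) (auto intro!: derivative_eq_intros)
    from DERIV_cmult[OF this, of C]
    have "(?g has_field_derivative C * (of_real (2 / sqrt pi) * exp (- (((of_real t - w) / of_real (sqrt 2))\<^sup>2)) * (1 / of_real (sqrt 2)))) (at (of_real t))" .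
    also have "C * (of_real (2 / sqrt pi) * exp (- (((of_real t - w) / of_real (sqrt 2))\<^sup>2)) * (1 / of_real (sqrt 2)))
       = of_real (sqrt (pi / 2) * (2 / sqrt pi) / sqrt 2) * (exp (w\<^sup>2 / 2) * exp (- (((of_real t - w) / of_real (sqrt 2))\<^sup>2)))"
      by (simp add: C_def)
    also have "sqrt (pi / 2) * (2 / sqrt pi) / sqrt 2 = 1" 
    proof -
      have "sqrt pi \<noteq> 0" "sqrt 2 * sqrt 2 = (2::real)" by simp_all
      thus ?thesis by (simp add: real_sqrt_divide field_simps)
    qed
    also have "exp (w\<^sup>2 / 2) * exp (- (((of_real t - w) / of_real (sqrt 2))\<^sup>2)) = ?f t"
      unfolding exp_add[symmetric] power_divide s2 by (rule arg_cong[where f=exp]) (simp add: power2_diff field_simps)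
    finally have "(?g has_field_derivative ?f t) (at (of_real t))" by simp
    from has_vector_derivative_real_field[OF this] show ?thesis by (simp add: F_def)
  qed
  have "(LBINT t=0..\<infinity>. ?f t) = C - F 0"
  proof (rule interval_integral_FTC_integrable[where F=F])
    show "isCont ?f x" for x by (intro continuous_intros) auto
    show "set_integrable lborel (einterval 0 \<infinity>) ?f"
      unfolding set_integrable_def
      by (rule integrable_mult_indicator[OF _ integrable_exp_linear_minus_quadratic]) auto
    have "(F \<longlongrightarrow> F 0) (at_right 0)"
      using has_vector_derivative_continuous[OF der[of 0]] by (simp add: continuous_at filterlim_at_split)
    thus "((F \<circ> real_of_ereal) \<longlongrightarrow> F 0) (at_right 0)"
      by (simp add: ereal_tendsto_simps zero_ereal_def)
    have "filterlim (\<lambda>t. t / sqrt 2) at_top at_top" by real_asymp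
    from filterlim_compose[OF tendsto_erf_shift_at_top this, of "- w / of_real (sqrt 2)"]
    have "((\<lambda>t. C * erf (of_real (t / sqrt 2) + - w / of_real (sqrt 2))) \<longlongrightarrow> C * 1) at_top"
      by (intro tendsto_intros)
    hence "(F \<longlongrightarrow> C) at_top" by (simp add: F_def diff_divide_distrib)
    thus "((F \<circ> real_of_ereal) \<longlongrightarrow> C) (at_left \<infinity>)"
      by (simp add: ereal_tendsto_simps)
  qed (use der in auto)
  also have "C - F 0 = C * erfc (- w / of_real (sqrt 2))" by (simp add: F_def erfc_def algebra_simps)
  also have "(LBINT t=0..\<infinity>. ?f t) = (\<integral>t. indicator {0<..} t *\<^sub>R ?f t \<partial>lborel)"
    by (simp add: interval_lebesgue_integral_def set_lebesgue_integral_def zero_ereal_def)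
  finally show ?thesis by (simp add: C_def)
qed

lemma gaussian_neg_half_line_integral:
  fixes w :: complex
  shows "(\<integral>t. indicator {..<0} t *\<^sub>R exp (of_real t * w - of_real (t\<^sup>2 / 2)) \<partial>lborel)
       = of_real (sqrt (pi / 2)) * exp (w\<^sup>2 / 2) * erfc (w / of_real (sqrt 2))"
proof -
  have "(\<integral>t. indicator {..<0} t *\<^sub>R exp (of_real t * w - of_real (t\<^sup>2 / 2)) \<partial>lborel)
      = \<bar>-1\<bar> *\<^sub>R (\<integral>t. indicator {..<0} (0 + - 1 * t) *\<^sub>R exp (of_real (0 + - 1 * t) * w - of_real ((0 + - 1 * t)\<^sup>2 / 2)) \<partial>lborel)"
    by (rule lborel_integral_real_affine) simp
  also have "\<dots> = (\<integral>t. indicator {0<..} t *\<^sub>R exp (of_real t * (- w) - of_real (t\<^sup>2 / 2)) \<partial>lborel)"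
    by (simp add: indicator_def)
  also have "\<dots> = of_real (sqrt (pi / 2)) * exp (w\<^sup>2 / 2) * erfc (w / of_real (sqrt 2))"
    by (subst gaussian_half_line_integral) simp
  finally show ?thesis .
qed

lemma gaussian_line_integral:
  fixes w :: complex
  shows "(\<integral>t. exp (of_real t * w - of_real (t\<^sup>2 / 2)) \<partial>lborel) = of_real (sqrt (2 * pi)) * exp (w\<^sup>2 / 2)"
proof -
  let ?f = "\<lambda>t. exp (of_real t * w - of_real (t\<^sup>2 / 2)) :: complex"
  have int: "integrable lborel (\<lambda>t. indicator A t *\<^sub>R ?f t)" if "A \<in> sets lborel" for A
    by (rule integrable_mult_indicator[OF that integrable_exp_linear_minus_quadratic])
  have "(\<integral>t. ?f t \<partial>lborel) = (\<integral>t. indicator {0<..} t *\<^sub>R ?f t + indicator {..<0} t *\<^sub>R ?f t \<partial>lborel)"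
    by (rule integral_discrete_difference[where X="{0}"]) (auto simp: indicator_def)
  also have "\<dots> = of_real (sqrt (pi / 2)) * exp (w\<^sup>2 / 2) * (erfc (- w / of_real (sqrt 2)) + erfc (w / of_real (sqrt 2)))"
    by (subst Bochner_Integration.integral_add[OF int int])
       (simp_all only: gaussian_half_line_integral gaussian_neg_half_line_integral distrib_left lborelD open_greaterThan open_lessThan sets_lborel borel_open)
  also have "erfc (- w / of_real (sqrt 2)) + erfc (w / of_real (sqrt 2)) = 2"
    using erf_minus[of "w / of_real (sqrt 2)"] by (simp add: erfc_def)
  also have "of_real (sqrt (pi / 2)) * exp (w\<^sup>2 / 2) * 2 = of_real (sqrt (pi / 2) * 2) * exp (w\<^sup>2 / 2)" by simp
  also have "sqrt (pi / 2) * 2 = sqrt (2 * pi)"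
    by (simp add: real_sqrt_mult real_sqrt_divide field_simps)
  finally show ?thesis .
qed

section \<open>The limit of the kernel sum\<close>

text \<open>The range of the summation index \<open>y n + t \<surd>n\<close> between \<open>0\<close> and \<open>n\<close>, seen from the saddle \<open>y\<close>: a half-line at an edge.\<close>
definition sum_range :: "real \<Rightarrow> real set" where
  "sum_range y = {t. (0 < y \<or> 0 < t) \<and> (y < 1 \<or> t < 0)}"

lemma sum_range_sets [measurable]: "sum_range y \<in> sets borel"
  unfolding sum_range_def by measurable

lemma sum_range_scale: "c > 0 \<Longrightarrow> c * t \<in> sum_range y \<longleftrightarrow> t \<in> sum_range y"
  by (auto simp: sum_range_def zero_less_mult_iff mult_less_0_iff)

lemma eventually_index_in_range:
  assumes y: "0 \<le> y" "y \<le> 1" and t: "t \<in> sum_range y"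
  shows "\<forall>\<^sub>F n in sequentially. 0 \<le> \<lfloor>y * real n + t * sqrt (real n)\<rfloor> \<and> \<lfloor>y * real n + t * sqrt (real n)\<rfloor> < int n"
proof -
  have low: "\<forall>\<^sub>F n in sequentially. 0 < c * real n + s * sqrt (real n)" if c: "c > 0 \<or> c = 0 \<and> s > 0" for c s :: real
  proof (cases "c > 0")
    case True
    have "\<forall>\<^sub>F n in sequentially. sqrt (real n) > \<bar>s\<bar> / c" by real_asymp
    thus ?thesis using eventually_gt_at_top[of 0]
    proof eventually_elim
      case (elim n)
      hence "0 < c * sqrt (real n) + s" using True by (simp add: field_simps)
      hence "0 < sqrt (real n) * (c * sqrt (real n) + s)" using elim by (intro mult_pos_pos) auto
      also have "\<dots> = c * (sqrt (real n))\<^sup>2 + s * sqrt (real n)" by (simp add: power2_eq_square algebra_simps)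
      finally show ?case by simp
    qed
  next
    case False
    with c have "c = 0" "s > 0" by auto
    thus ?thesis by (intro eventually_mono[OF eventually_gt_at_top[of "0::nat"]]) simp
  qed
  have "\<forall>\<^sub>F n in sequentially. 0 < y * real n + t * sqrt (real n)"
    using y t by (intro low) (auto simp: sum_range_def)
  moreover have "\<forall>\<^sub>F n in sequentially. 0 < (1 - y) * real n + (- t) * sqrt (real n)"
    using y t by (intro low) (auto simp: sum_range_def)
  ultimately show ?thesis
    by eventually_elim (simp add: floor_less_iff algebra_simps)
qed

text \<open>\<open>t = 0\<close> has to be excluded: for \<open>y = 0\<close> it yields the index 0,
  which is in range although 0 is not in \<open>sum_range 0\<close>. A single point is a null
  set.\<close>

lemma eventually_index_not_in_range:
  assumes y: "0 \<le> y" "y \<le> 1" and t: "t \<notin> sum_range y" "t \<noteq> 0"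
  shows "\<forall>\<^sub>F n in sequentially. \<not> (0 \<le> \<lfloor>y * real n + t * sqrt (real n)\<rfloor> \<and> \<lfloor>y * real n + t * sqrt (real n)\<rfloor> < int n)"
  using eventually_gt_at_top[of "0::nat"]
proof eventually_elim
  case (elim n)
  from t y have "y = 0 \<and> t < 0 \<or> y = 1 \<and> t > 0" by (auto simp: sum_range_def)
  thus ?case
  proof
    assume "y = 0 \<and> t < 0"
    hence "y * real n + t * sqrt (real n) < 0" using elim by (simp add: mult_neg_pos)
    thus ?thesis by simp
  next
    assume "y = 1 \<and> t > 0"
    hence "real n < y * real n + t * sqrt (real n)" using elim by simp
    thus ?thesis by (simp add: floor_less_iff)
  qed
qed

text \<open>\<open>L\<close> and \<open>L'\<close> stand for \<open>sqrt n * Ln w\<close>: the real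
  part displaces the logarithm of the squared modulus, the imaginary part is the rescaled angle. The
  phase is counted from \<open>y n\<close> and not from 0, since only the centred phase has a
  limit.\<close>

lemma tendsto_kernel_sum:
  fixes L L' :: "nat \<Rightarrow> complex"
  assumes m: "m \<ge> 1" and \<delta>: "\<And>k. k \<in> {1..m} \<Longrightarrow> \<delta> k \<ge> 0"
    and y: "0 \<le> y" "y \<le> 1" and \<gamma>: "\<And>k. k \<in> {1..m} \<Longrightarrow> \<delta> k + y > 0"
    and L: "L \<longlonglongrightarrow> \<beta>" "L' \<longlonglongrightarrow> \<beta>'"
  defines "S \<equiv> \<Sum>k=1..m. 1 / (\<delta> k + y)"
  defines "P \<equiv> \<lambda>L n l. loggam_density m (\<lambda>k. \<delta> k * real n) l
      (log_center m \<delta> y n + 2 * Re (L n :: complex) / sqrt (real n)) / sqrt (real n)"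
  shows "(\<lambda>n. of_real (1 / sqrt (real n)) * (\<Sum>l<n. of_real (sqrt (P L n l * P L' n l)) *
        cis ((real l - y * real n) / sqrt (real n) * (Im (L n) - Im (L' n)))))
    \<longlonglongrightarrow> (\<integral>t. indicator (sum_range y) t *\<^sub>R (of_real (sqrt (normal_density 0 (sqrt S) (2 * Re \<beta> - t * S) *
        normal_density 0 (sqrt S) (2 * Re \<beta>' - t * S))) * cis (t * (Im \<beta> - Im \<beta>'))) \<partial>lborel)"
proof -
  have X: "(\<lambda>n. 2 * Re (L n)) \<longlonglongrightarrow> 2 * Re \<beta>" "(\<lambda>n. 2 * Re (L' n)) \<longlonglongrightarrow> 2 * Re \<beta>'"
    by (intro tendsto_intros L)+
  obtain D1 where D1: "D1 \<ge> 0" "\<forall>\<^sub>F n in sequentially. \<forall>l<n. P L n l \<le> D1 * exp (- \<bar>real l - y * real n\<bar> / sqrt (real n))"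
  proof -
    have "\<exists>D\<ge>0. \<forall>\<^sub>F n in sequentially. \<forall>l<n. P L n l \<le> D * exp (- \<bar>real l - y * real n\<bar> / sqrt (real n))"
      unfolding P_def by (rule loggam_density_dominated[OF m _ y _ X(1)]) (erule \<delta>, erule \<gamma>)
    thus ?thesis by (elim exE conjE) (rule that)
  qed
  obtain D2 where D2: "D2 \<ge> 0" "\<forall>\<^sub>F n in sequentially. \<forall>l<n. P L' n l \<le> D2 * exp (- \<bar>real l - y * real n\<bar> / sqrt (real n))"
  proof -
    have "\<exists>D\<ge>0. \<forall>\<^sub>F n in sequentially. \<forall>l<n. P L' n l \<le> D * exp (- \<bar>real l - y * real n\<bar> / sqrt (real n))"
      unfolding P_def by (rule loggam_density_dominated[OF m _ y _ X(2)]) (erule \<delta>, erule \<gamma>)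
    thus ?thesis by (elim exE conjE) (rule that)
  qed
  have P0: "0 \<le> P M n l" for M n l
    unfolding P_def using loggam_density_bounds(1)[of m "\<lambda>k. \<delta> k * real n"] m \<delta> by simp
  show ?thesis
  proof (rule tendsto_rescaled_sum_integral[where D="D1 + D2" and c="\<lambda>n. y * real n"])
    show "D1 + D2 \<ge> 0" using D1 D2 by simp
    show "\<forall>\<^sub>F n in sequentially. \<forall>l<n. norm (of_real (sqrt (P L n l * P L' n l)) *
        cis ((real l - y * real n) / sqrt (real n) * (Im (L n) - Im (L' n))))
        \<le> (D1 + D2) * exp (- \<bar>real l - y * real n\<bar> / sqrt (real n))"
      using D1(2) D2(2)
    proof eventually_elim
      case (elim n)
      show ?case
      proof (intro allI impI)
        fix l assume l: "l < n"
        \<comment> \<open>One majorant for both densities is also one for their geometric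
          mean.\<close>
        define E where "E = (D1 + D2) * exp (- \<bar>real l - y * real n\<bar> / sqrt (real n))"
        have "P L n l \<le> E" "P L' n l \<le> E"
          using elim l D1(1) D2(1) unfolding E_def by (auto simp: distrib_right intro: order_trans add_increasing add_increasing2)
        moreover have "E \<ge> 0" using D1(1) D2(1) by (simp add: E_def)
        ultimately have "P L n l * P L' n l \<le> E\<^sup>2"
          unfolding power2_eq_square by (intro mult_mono P0)
        hence "sqrt (P L n l * P L' n l) \<le> E" using \<open>E \<ge> 0\<close> by (intro real_le_lsqrt) auto
        thus "norm (of_real (sqrt (P L n l * P L' n l)) *
           cis ((real l - y * real n) / sqrt (real n) * (Im (L n) - Im (L' n)))) \<le> (D1 + D2) * exp (- \<bar>real l - y * real n\<bar> / sqrt (real n))"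
          using P0 by (simp add: norm_mult E_def)
      qed
    qed
    show "(\<lambda>t. indicator (sum_range y) t *\<^sub>R (of_real (sqrt (normal_density 0 (sqrt S) (2 * Re \<beta> - t * S) *
        normal_density 0 (sqrt S) (2 * Re \<beta>' - t * S))) * cis (t * (Im \<beta> - Im \<beta>')))) \<in> borel_measurable borel"
      unfolding cis_conv_exp by measurable
    show "AE t in lborel. (\<lambda>n. if 0 \<le> \<lfloor>y * real n + t * sqrt (real n)\<rfloor> \<and> \<lfloor>y * real n + t * sqrt (real n)\<rfloor> < int n
       then of_real (sqrt (P L n (nat \<lfloor>y * real n + t * sqrt (real n)\<rfloor>) * P L' n (nat \<lfloor>y * real n + t * sqrt (real n)\<rfloor>))) *
        cis ((real (nat \<lfloor>y * real n + t * sqrt (real n)\<rfloor>) - y * real n) / sqrt (real n) * (Im (L n) - Im (L' n))) else 0) \<longlonglongrightarrow>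
       indicator (sum_range y) t *\<^sub>R (of_real (sqrt (normal_density 0 (sqrt S) (2 * Re \<beta> - t * S) *
        normal_density 0 (sqrt S) (2 * Re \<beta>' - t * S))) * cis (t * (Im \<beta> - Im \<beta>')))"
      using AE_lborel_singleton[of 0]
    proof eventually_elim
      case (elim t)
      define l where "l = (\<lambda>n. nat \<lfloor>y * real n + t * sqrt (real n)\<rfloor>)"
      show ?case
      proof (cases "t \<in> sum_range y")
        case True
        have ev: "\<forall>\<^sub>F n in sequentially. 0 \<le> \<lfloor>y * real n + t * sqrt (real n)\<rfloor> \<and> \<lfloor>y * real n + t * sqrt (real n)\<rfloor> < int n"
          by (rule eventually_index_in_range[OF y True])
        have lt: "(\<lambda>n. (real (l n) - y * real n) / sqrt (real n)) \<longlonglongrightarrow> t"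
        proof (rule Lim_transform)
          show "(\<lambda>n. t) \<longlonglongrightarrow> t" by simp
          show "(\<lambda>n. (real (l n) - y * real n) / sqrt (real n) - t) \<longlonglongrightarrow> 0"
          proof (rule Lim_null_comparison)
            show "(\<lambda>n. 1 / sqrt (real n)) \<longlonglongrightarrow> 0" by real_asymp
            show "\<forall>\<^sub>F n in sequentially. norm ((real (l n) - y * real n) / sqrt (real n) - t) \<le> 1 / sqrt (real n)"
              using ev eventually_gt_at_top[of 0]
            proof eventually_elim
              case (elim n)
              have "real (l n) = of_int \<lfloor>y * real n + t * sqrt (real n)\<rfloor>" using elim by (simp add: l_def)
              hence "\<bar>real (l n) - y * real n - t * sqrt (real n)\<bar> \<le> 1" by linarith
              moreover have "(real (l n) - y * real n) / sqrt (real n) - t = (real (l n) - y * real n - t * sqrt (real n)) / sqrt (real n)"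
                using elim by (simp add: field_simps)
              ultimately show ?case using elim by (simp add: divide_right_mono)
            qed
          qed
        qed
        have "(\<lambda>n. of_real (sqrt (P L n (l n) * P L' n (l n))) *
            cis ((real (l n) - y * real n) / sqrt (real n) * (Im (L n) - Im (L' n)))) \<longlonglongrightarrow>
          of_real (sqrt (normal_density 0 (sqrt S) (2 * Re \<beta> - t * S) *
            normal_density 0 (sqrt S) (2 * Re \<beta>' - t * S))) * cis (t * (Im \<beta> - Im \<beta>'))"
          unfolding cis_conv_exp P_def S_def
          by (intro tendsto_intros tendsto_loggam_density m \<delta> \<gamma> X lt L)
        hence "(\<lambda>n. of_real (sqrt (P L n (l n) * P L' n (l n))) *
            cis ((real (l n) - y * real n) / sqrt (real n) * (Im (L n) - Im (L' n)))) \<longlonglongrightarrow>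
          indicator (sum_range y) t *\<^sub>R (of_real (sqrt (normal_density 0 (sqrt S) (2 * Re \<beta> - t * S) *
            normal_density 0 (sqrt S) (2 * Re \<beta>' - t * S))) * cis (t * (Im \<beta> - Im \<beta>')))"
          using True by simp
        thus ?thesis
          by (rule Lim_transform_eventually) (use ev in eventually_elim, simp only: l_def if_True simp_thms)
      next
        case False
        have "\<forall>\<^sub>F n in sequentially. \<not> (0 \<le> \<lfloor>y * real n + t * sqrt (real n)\<rfloor> \<and> \<lfloor>y * real n + t * sqrt (real n)\<rfloor> < int n)"
          using eventually_index_not_in_range[OF y False] elim by simp
        hence "\<forall>\<^sub>F n in sequentially. 0 = (if 0 \<le> \<lfloor>y * real n + t * sqrt (real n)\<rfloor> \<and> \<lfloor>y * real n + t * sqrt (real n)\<rfloor> < int n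
       then of_real (sqrt (P L n (nat \<lfloor>y * real n + t * sqrt (real n)\<rfloor>) * P L' n (nat \<lfloor>y * real n + t * sqrt (real n)\<rfloor>))) *
        cis ((real (nat \<lfloor>y * real n + t * sqrt (real n)\<rfloor>) - y * real n) / sqrt (real n) * (Im (L n) - Im (L' n))) else 0)"
          by eventually_elim (simp only: if_False)
        thus ?thesis using False by (intro Lim_transform_eventually[OF tendsto_const]) simp
      qed
    qed
  qed
qed

section \<open>Evaluation of the limiting integral\<close>

definition limit_integral :: "real \<Rightarrow> complex \<Rightarrow> complex" where
  "limit_integral y w = (\<integral>t. indicator (sum_range y) t *\<^sub>R exp (of_real t * w - of_real (t\<^sup>2 / 2)) \<partial>lborel)"

text \<open>The substitution \<open>t / sqrt S\<close> removes \<open>S\<close>. The geometric mean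
  of the two Gaussians contributes \<open>t * (Re b + Re b')\<close> to the exponent and the phase
  contributes \<open>t * (Im b - Im b')\<close> times the imaginary unit; together they form
  \<open>t * (b + cnj b')\<close>. \<open>sum_range\<close> is invariant under positive
  scaling.\<close>

lemma integral_normal_density_product:
  assumes S: "S > 0"
  shows "of_real S * (\<integral>t. indicator (sum_range y) t *\<^sub>R (of_real (sqrt (normal_density 0 (sqrt S) (2 * Re (b * of_real (sqrt S)) - t * S) *
        normal_density 0 (sqrt S) (2 * Re (b' * of_real (sqrt S)) - t * S))) * cis (t * (Im (b * of_real (sqrt S)) - Im (b' * of_real (sqrt S))))) \<partial>lborel)
    = of_real (exp (- (Re b)\<^sup>2 - (Re b')\<^sup>2) / sqrt (2 * pi)) * limit_integral y (b + cnj b')"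
    (is "_ * (\<integral>t. ?f t \<partial>lborel) = _")
proof -
  define s where "s = sqrt S"
  have s: "s > 0" "s\<^sup>2 = S" "S = s * s" using S by (auto simp: s_def)
  have f: "?f (0 + 1 / s * t) = of_real (exp (- (Re b)\<^sup>2 - (Re b')\<^sup>2) / (sqrt (2 * pi) * s)) *
      (indicator (sum_range y) t *\<^sub>R exp (of_real t * (b + cnj b') - of_real (t\<^sup>2 / 2)))" for t
  proof -
    have nd: "normal_density 0 s (2 * Re (c * of_real s) - (0 + 1 / s * t) * S) = exp (- (2 * Re c - t)\<^sup>2 / 2) / (sqrt (2 * pi) * s)" for c
    proof -
      have "2 * Re (c * of_real s) - (0 + 1 / s * t) * S = s * (2 * Re c - t)"
        using s(1) by (simp add: s(3) algebra_simps)
      thus ?thesis using s(1) by (simp add: normal_density_def power_mult_distrib real_sqrt_mult)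
    qed
    have "sqrt (exp (- (2 * Re b - t)\<^sup>2 / 2) / (sqrt (2 * pi) * s) * (exp (- (2 * Re b' - t)\<^sup>2 / 2) / (sqrt (2 * pi) * s)))
        = exp (- (2 * Re b - t)\<^sup>2 / 4 - (2 * Re b' - t)\<^sup>2 / 4) / (sqrt (2 * pi) * s)"
    proof (rule real_sqrt_unique)
      show "(exp (- (2 * Re b - t)\<^sup>2 / 4 - (2 * Re b' - t)\<^sup>2 / 4) / (sqrt (2 * pi) * s))\<^sup>2 =
        exp (- (2 * Re b - t)\<^sup>2 / 2) / (sqrt (2 * pi) * s) * (exp (- (2 * Re b' - t)\<^sup>2 / 2) / (sqrt (2 * pi) * s))"
        by (simp add: power_divide exp_double[symmetric] exp_add[symmetric] power2_eq_square[of "sqrt (2 * pi) * s"] add_divide_distrib diff_divide_distrib)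
    qed (use s(1) in simp)
    also have "- (2 * Re b - t)\<^sup>2 / 4 - (2 * Re b' - t)\<^sup>2 / 4 = (- (Re b)\<^sup>2 - (Re b')\<^sup>2) + (t * (Re b + Re b') - t\<^sup>2 / 2)"
      by (simp add: power2_eq_square field_simps)
    finally have sq: "sqrt (exp (- (2 * Re b - t)\<^sup>2 / 2) / (sqrt (2 * pi) * s) * (exp (- (2 * Re b' - t)\<^sup>2 / 2) / (sqrt (2 * pi) * s)))
        = exp (- (Re b)\<^sup>2 - (Re b')\<^sup>2) / (sqrt (2 * pi) * s) * exp (t * (Re b + Re b') - t\<^sup>2 / 2)"
      by (simp add: exp_add)
    have ph: "(0 + 1 / s * t) * (Im (b * of_real s) - Im (b' * of_real s)) = t * (Im b - Im b')"
      using s(1) by (simp add: field_simps)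
    have ex: "of_real (exp (t * (Re b + Re b') - t\<^sup>2 / 2)) * cis (t * (Im b - Im b')) = exp (of_real t * (b + cnj b') - of_real (t\<^sup>2 / 2))"
      by (subst exp_eq_polar) simp
    have ind: "indicator (sum_range y) (0 + 1 / s * t) = (indicator (sum_range y) t :: real)"
      using sum_range_scale[of "1 / s" t y] s(1) by (simp add: indicator_def)
    show ?thesis
      unfolding s_def[symmetric] nd sq ph ind ex[symmetric] by simp
  qed
  have "(\<integral>t. ?f t \<partial>lborel) = \<bar>1 / s\<bar> *\<^sub>R (\<integral>t. ?f (0 + 1 / s * t) \<partial>lborel)"
    by (rule lborel_integral_real_affine) (use s(1) in simp)
  also have "\<dots> = (1 / s) *\<^sub>R (of_real (exp (- (Re b)\<^sup>2 - (Re b')\<^sup>2) / (sqrt (2 * pi) * s)) * limit_integral y (b + cnj b'))"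
  proof -
    have "\<bar>1 / s\<bar> = 1 / s" using s(1) by simp
    thus ?thesis unfolding f limit_integral_def by (simp only: integral_mult_right_zero)
  qed
  finally have "(\<integral>t. ?f t \<partial>lborel) = of_real (1 / s * (exp (- (Re b)\<^sup>2 - (Re b')\<^sup>2) / (sqrt (2 * pi) * s))) * limit_integral y (b + cnj b')"
    by (simp add: scaleR_conv_of_real)
  hence "of_real S * (\<integral>t. ?f t \<partial>lborel) = of_real (S * (1 / s * (exp (- (Re b)\<^sup>2 - (Re b')\<^sup>2) / (sqrt (2 * pi) * s)))) * limit_integral y (b + cnj b')"
    by simp
  also have "S * (1 / s * (exp (- (Re b)\<^sup>2 - (Re b')\<^sup>2) / (sqrt (2 * pi) * s))) = exp (- (Re b)\<^sup>2 - (Re b')\<^sup>2) / sqrt (2 * pi)"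
    unfolding s(3) using s(1) by simp
  finally show ?thesis .
qed

lemma limit_integral_bulk:
  "0 < y \<Longrightarrow> y < 1 \<Longrightarrow> limit_integral y w = of_real (sqrt (2 * pi)) * exp (w\<^sup>2 / 2)"
  unfolding limit_integral_def sum_range_def by (subst gaussian_line_integral[symmetric]) simp

lemma limit_integral_inner:
  "limit_integral 0 w = of_real (sqrt (pi / 2)) * exp (w\<^sup>2 / 2) * erfc (- w / of_real (sqrt 2))"
  unfolding limit_integral_def sum_range_def
  by (subst gaussian_half_line_integral[symmetric]) (simp add: greaterThan_def)

lemma limit_integral_outer:
  "limit_integral 1 w = of_real (sqrt (pi / 2)) * exp (w\<^sup>2 / 2) * erfc (w / of_real (sqrt 2))"
  unfolding limit_integral_def sum_range_def
  by (subst gaussian_neg_half_line_integral[symmetric]) (simp add: lessThan_def)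

section \<open>The rescaled correlation function\<close>

text \<open>At \<open>x = (y + \<delta> m) / (cmod u)\<^sup>2\<close> the factors are the positive
  numbers \<open>\<delta> k + y\<close>. For larger \<open>x\<close> all of them are strictly
  larger, so no root lies beyond and this one is \<open>xi\<close>.\<close>

lemma rho_saddle:
  assumes m: "m \<ge> 1" and \<gamma>: "\<And>k. k \<in> {1..m} \<Longrightarrow> \<delta> k + y > 0"
    and u: "u \<noteq> 0" "(\<Prod>k=1..m. \<delta> k + y) = (cmod u)\<^sup>2"
  shows "rho m \<delta> u = 1 / (cmod u * sqrt (\<Sum>k=1..m. 1 / (\<delta> k + y)))"
proof -
  have u2: "(cmod u)\<^sup>2 > 0" using u by simp
  have "xi m \<delta> u = (y + \<delta> m) / (cmod u)\<^sup>2"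
    unfolding xi_def
  proof (rule Greatest_equality)
    show "(\<Prod>k=1..m. \<delta> k - \<delta> m + (cmod u)\<^sup>2 * ((y + \<delta> m) / (cmod u)\<^sup>2)) - (cmod u)\<^sup>2 = 0"
      using u by simp
    fix x assume x: "(\<Prod>k=1..m. \<delta> k - \<delta> m + (cmod u)\<^sup>2 * x) - (cmod u)\<^sup>2 = 0"
    show "x \<le> (y + \<delta> m) / (cmod u)\<^sup>2"
    proof (rule ccontr)
      assume "\<not> x \<le> (y + \<delta> m) / (cmod u)\<^sup>2"
      hence "y < (cmod u)\<^sup>2 * x - \<delta> m" using u2 by (simp add: field_simps)
      hence lt: "\<delta> k + y < \<delta> k - \<delta> m + (cmod u)\<^sup>2 * x" for k by simp
      have "0 < \<delta> k - \<delta> m + (cmod u)\<^sup>2 * x" if "k \<in> {1..m}" for k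
        using \<gamma>[OF that] lt[of k] by linarith
      hence "(\<Prod>k=1..m. \<delta> k + y) < (\<Prod>k=1..m. \<delta> k - \<delta> m + (cmod u)\<^sup>2 * x)"
        using m \<gamma> lt by (intro prod_mono_strict) (auto intro: less_imp_le)
      thus False using x u(2) by simp
    qed
  qed
  hence E: "\<delta> k - \<delta> m + (cmod u)\<^sup>2 * xi m \<delta> u = \<delta> k + y" for k using u by simp
  show ?thesis unfolding rho_def E ..
qed

lemma saddle_exists:
  assumes "(\<Prod>k=1..m. \<delta> k) < c" "c < (\<Prod>k=1..m. 1 + (\<delta> k :: real))"
  obtains y where "0 < y" "y < 1" "(\<Prod>k=1..m. \<delta> k + y) = c"
proof -
  have "\<exists>y\<ge>0. y \<le> 1 \<and> (\<Prod>k=1..m. \<delta> k + y) = c"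
    using assms by (intro IVT' continuous_intros) (auto simp: add.commute)
  then obtain y where y: "0 \<le> y" "y \<le> 1" "(\<Prod>k=1..m. \<delta> k + y) = c" by auto
  moreover have "y \<noteq> 0" "y \<noteq> 1" using y(3) assms by (auto simp: add.commute)
  ultimately show ?thesis using that[of y] by linarith
qed

lemma corr_kernel_conv_loggam_density:
  assumes m: "m \<ge> 1" and a: "\<And>k. k \<in> {1..m} \<Longrightarrow> a k \<ge> 0" and z: "z \<noteq> 0" "z' \<noteq> 0"
  shows "corr_kernel m a N z z' = of_real (1 / (pi * cmod z * cmod z')) *
     (\<Sum>l<N. of_real (sqrt (loggam_density m a l (ln ((cmod z)\<^sup>2)) * loggam_density m a l (ln ((cmod z')\<^sup>2)))) *
        (z * cnj z' / of_real (cmod z * cmod z')) ^ l)"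
proof -
  define c where "c = (\<lambda>l. \<Prod>k=1..m. Gamma (a k + 1) / Gamma (a k + real l + 1))"
  have c: "c l > 0" for l
    unfolding c_def using a by (intro prod_pos divide_pos_pos ballI Gamma_real_pos) (auto simp: add_nonneg_pos add_pos_nonneg)
  define A where "A = cmod z * cmod z'"
  have A: "A > 0" using z by (simp add: A_def)
  have w: "loggam_density m a l (ln ((cmod x)\<^sup>2)) = pi * weight m a x * c l * cmod x ^ (2 * l + 2)" if "x \<noteq> 0" for x l
    using weight_conv_loggam_density[of m a x l] m a that by (simp add: c_def)
  have cnj: "weight m a (cnj z') = weight m a z'" by (simp add: weight_def)
  have key: "of_real (sqrt (weight m a z * weight m a z')) * (of_real (c l) * (z * cnj z') ^ l)
     = of_real (1 / (pi * A)) * (of_real (sqrt (loggam_density m a l (ln ((cmod z)\<^sup>2)) * loggam_density m a l (ln ((cmod z')\<^sup>2)))) *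
        (z * cnj z' / of_real A) ^ l)" for l
  proof -
    have "loggam_density m a l (ln ((cmod z)\<^sup>2)) * loggam_density m a l (ln ((cmod z')\<^sup>2))
        = (pi * c l * A ^ (l + 1))\<^sup>2 * (weight m a z * weight m a z')"
      unfolding w[OF z(1)] w[OF z(2)] unfolding A_def mult_2 power_add power2_eq_square power_mult_distrib
      by (simp add: mult_ac)
    hence "sqrt (loggam_density m a l (ln ((cmod z)\<^sup>2)) * loggam_density m a l (ln ((cmod z')\<^sup>2)))
        = pi * c l * A ^ (l + 1) * sqrt (weight m a z * weight m a z')"
      using c[of l] A by (simp add: real_sqrt_mult)
    moreover have "of_real (1 / (pi * A)) * (of_real (pi * c l * A ^ (l + 1) * sqrt (weight m a z * weight m a z')) *
        (z * cnj z' / of_real A) ^ l) = of_real (sqrt (weight m a z * weight m a z')) * (of_real (c l) * (z * cnj z') ^ l)"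
      using A by (simp add: power_divide)
    ultimately show ?thesis by simp
  qed
  show ?thesis
    unfolding corr_kernel_def cnj A_def[symmetric] mult.assoc[of pi] sum_distrib_left
    by (rule sum.cong[OF refl key[unfolded c_def]])
qed

text \<open>The saddle equation turns \<open>ln ((cmod u)\<^sup>2)\<close> into the sum in
  \<open>log_center\<close>. What is left is the contribution of \<open>w\<close>, written in the
  form in which \<open>tendsto_kernel_sum\<close> takes it.\<close>

lemma log_center_rescaled:
  assumes n: "n > 0" and \<gamma>: "\<And>k. k \<in> {1..m} \<Longrightarrow> \<delta> k + y > 0"
    and u: "u \<noteq> 0" "(\<Prod>k=1..m. \<delta> k + y) = (cmod u)\<^sup>2" and w: "w \<noteq> 0"
  shows "ln ((cmod (of_real (real n powr (real m / 2)) * (u * w)))\<^sup>2)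
       = log_center m \<delta> y n + 2 * Re (of_real (sqrt (real n)) * Ln w) / sqrt (real n)"
proof -
  have "(cmod (of_real (real n powr (real m / 2)) * (u * w)))\<^sup>2 = real n powr real m * (cmod u)\<^sup>2 * (cmod w)\<^sup>2"
    by (simp add: norm_mult power_mult_distrib power2_eq_square powr_add[symmetric])
  hence "ln ((cmod (of_real (real n powr (real m / 2)) * (u * w)))\<^sup>2) = real m * ln (real n) + ln ((cmod u)\<^sup>2) + 2 * ln (cmod w)"
    using n u w by (simp add: ln_mult ln_powr ln_realpow)
  also have "ln ((cmod u)\<^sup>2) = (\<Sum>k=1..m. ln (\<delta> k + y))"
  proof -
    have "\<delta> k + y \<noteq> 0" if "k \<in> {1..m}" for k using \<gamma>[OF that] by simp
    thus ?thesis unfolding u(2)[symmetric] using \<gamma> by (intro ln_prod) auto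
  qed
  finally show ?thesis using n w by (simp add: log_center_def)
qed

text \<open>An identity at fixed \<open>n\<close>. Since \<open>Im (Ln w)\<close> is of order
  \<open>1 / sqrt n\<close>, the phase at the index \<open>y n\<close> is of order
  \<open>sqrt n\<close> and in general has no limit; it is isolated as a product of a function of
  \<open>w\<close> and the inverse of the same function of \<open>w'\<close>.\<close>

lemma corr_kernel_rescaled:
  assumes m: "m \<ge> 1" and \<delta>: "\<And>k. k \<in> {1..m} \<Longrightarrow> \<delta> k \<ge> 0"
    and \<gamma>: "\<And>k. k \<in> {1..m} \<Longrightarrow> \<delta> k + y > 0"
    and u: "u \<noteq> 0" "(\<Prod>k=1..m. \<delta> k + y) = (cmod u)\<^sup>2"
    and n: "n > 0" and w: "w \<noteq> 0" "w' \<noteq> 0"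
  defines "P \<equiv> \<lambda>w l. loggam_density m (\<lambda>k. \<delta> k * real n) l
      (log_center m \<delta> y n + 2 * Re (of_real (sqrt (real n)) * Ln w) / sqrt (real n)) / sqrt (real n)"
  shows "of_real (real n ^ (m - 1) / r\<^sup>2) * corr_kernel m (\<lambda>k. \<delta> k * real n) n
       (of_real (real n powr (real m / 2)) * (u * w)) (of_real (real n powr (real m / 2)) * (u * w'))
     = cis (y * real n * Im (Ln w)) * cis (- (y * real n * Im (Ln w'))) *
       (of_real (1 / (pi * r\<^sup>2 * (cmod u)\<^sup>2 * (cmod w * cmod w'))) *
        (of_real (1 / sqrt (real n)) * (\<Sum>l<n. of_real (sqrt (P w l * P w' l)) *
          cis ((real l - y * real n) / sqrt (real n) * (Im (of_real (sqrt (real n)) * Ln w) - Im (of_real (sqrt (real n)) * Ln w'))))))"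
proof -
  define a where "a = (\<lambda>k. \<delta> k * real n)"
  define s where "s = real n powr (real m / 2)"
  have s: "s > 0" "s * s = real n ^ m" using n by (simp_all add: s_def powr_add[symmetric] powr_realpow)
  define z where "z = (\<lambda>w. of_real s * (u * w))"
  have z0: "z w \<noteq> 0" "z w' \<noteq> 0" using s u w by (auto simp: z_def)
  define p where "p = (\<lambda>w l. loggam_density m a l (ln ((cmod (z w))\<^sup>2)))"
  have P: "P w l = p w l / sqrt (real n)" if "w \<noteq> 0" for w l
    unfolding P_def p_def z_def s_def a_def using log_center_rescaled[of n m \<delta> y u w] n \<gamma> u that by simp
  have sqrtP: "sqrt (P w l * P w' l) = sqrt (p w l * p w' l) / sqrt (real n)" for l
    using n by (simp add: P w real_sqrt_mult real_sqrt_divide)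
  have pol: "x = of_real (cmod x) * cis (Im (Ln x))" if "x \<noteq> 0" for x
    using exp_eq_polar[of "Ln x"] that by (simp add: exp_Ln exp_of_real[symmetric])
  have phase: "z w * cnj (z w') / of_real (cmod (z w) * cmod (z w')) = cis (Im (Ln w) - Im (Ln w'))"
  proof -
    have num: "z w * cnj (z w') = of_real (s * s * (cmod u)\<^sup>2) * (w * cnj w')"
      unfolding of_real_mult complex_norm_square by (simp add: z_def mult_ac)
    have ww: "w * cnj w' = of_real (cmod w * cmod w') * (cis (Im (Ln w)) * cis (- Im (Ln w')))"
      by (subst pol[OF w(1)], subst pol[OF w(2)]) (simp add: cis_cnj)
    have cc: "cis (Im (Ln w)) * cis (- Im (Ln w')) = cis (Im (Ln w) - Im (Ln w'))" by (simp add: cis_mult)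
    have den: "cmod (z w) * cmod (z w') = s * s * (cmod u)\<^sup>2 * (cmod w * cmod w')"
      using s by (simp add: z_def norm_mult power2_eq_square)
    have "complex_of_real (s * s * (cmod u)\<^sup>2) \<noteq> 0" "complex_of_real (cmod w * cmod w') \<noteq> 0"
      using s(1) u w by auto
    thus ?thesis unfolding num ww cc den of_real_mult[of "s * s * (cmod u)\<^sup>2"] by (simp del: of_real_mult)
  qed
  have ph: "cis (Im (Ln w) - Im (Ln w')) ^ l = cis (y * real n * Im (Ln w)) * cis (- (y * real n * Im (Ln w'))) *
      cis ((real l - y * real n) / sqrt (real n) * (Im (of_real (sqrt (real n)) * Ln w) - Im (of_real (sqrt (real n)) * Ln w')))" for l
  proof -
    have "(real l - y * real n) / sqrt (real n) * (Im (of_real (sqrt (real n)) * Ln w) - Im (of_real (sqrt (real n)) * Ln w'))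
        = (real l - y * real n) * (Im (Ln w) - Im (Ln w'))"
      using n by (simp add: field_simps)
    thus ?thesis unfolding Complex.DeMoivre cis_mult by (intro arg_cong[where f=cis]) (simp add: algebra_simps)
  qed
  have "corr_kernel m a n (z w) (z w') = of_real (1 / (pi * cmod (z w) * cmod (z w'))) *
     (\<Sum>l<n. of_real (sqrt (p w l * p w' l)) * cis (Im (Ln w) - Im (Ln w')) ^ l)"
    unfolding p_def phase[symmetric]
    by (rule corr_kernel_conv_loggam_density[OF m _ z0]) (use \<delta> in \<open>auto simp: a_def\<close>)
  also have "(\<Sum>l<n. of_real (sqrt (p w l * p w' l)) * cis (Im (Ln w) - Im (Ln w')) ^ l)
     = (\<Sum>l<n. of_real (sqrt (real n)) * (cis (y * real n * Im (Ln w)) * cis (- (y * real n * Im (Ln w')))) * (of_real (sqrt (P w l * P w' l)) *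
          cis ((real l - y * real n) / sqrt (real n) * (Im (of_real (sqrt (real n)) * Ln w) - Im (of_real (sqrt (real n)) * Ln w')))))"
    unfolding ph sqrtP using n by (intro sum.cong refl) (simp add: mult_ac)
  also have "\<dots> = of_real (sqrt (real n)) * (cis (y * real n * Im (Ln w)) * cis (- (y * real n * Im (Ln w')))) * (\<Sum>l<n. of_real (sqrt (P w l * P w' l)) *
          cis ((real l - y * real n) / sqrt (real n) * (Im (of_real (sqrt (real n)) * Ln w) - Im (of_real (sqrt (real n)) * Ln w'))))"
    (is "_ = _ * ?sum") by (rule sum_distrib_left[symmetric])
  also have "pi * cmod (z w) * cmod (z w') = pi * (real n ^ m * (cmod u)\<^sup>2 * (cmod w * cmod w'))"
    using s by (simp add: z_def norm_mult power2_eq_square s(2)[symmetric])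
  finally have K: "corr_kernel m a n (z w) (z w') = of_real (1 / (pi * (real n ^ m * (cmod u)\<^sup>2 * (cmod w * cmod w')))) *
      (of_real (sqrt (real n)) * (cis (y * real n * Im (Ln w)) * cis (- (y * real n * Im (Ln w')))) * ?sum)" .
  \<comment> \<open>Count of powers: \<open>n^(m-1)\<close> from the normalisation,
    \<open>n^m\<close> in the denominator from the two moduli, and \<open>sqrt n\<close> from the
    division inside \<open>P\<close> leave \<open>1 / sqrt n\<close>, the step length of the
    sum.\<close>
  have nm: "real n ^ m = real n ^ (m - 1) * (sqrt (real n) * sqrt (real n))"
    using m n by (cases m) auto
  have c: "real n ^ (m - 1) / r\<^sup>2 * (1 / (pi * (real n ^ m * (cmod u)\<^sup>2 * (cmod w * cmod w')))) * sqrt (real n)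
      = 1 / (pi * r\<^sup>2 * (cmod u)\<^sup>2 * (cmod w * cmod w')) * (1 / sqrt (real n))"
    unfolding nm using n by (simp add: divide_simps)
  have "of_real (real n ^ (m - 1) / r\<^sup>2) * corr_kernel m a n (z w) (z w')
     = of_real (real n ^ (m - 1) / r\<^sup>2 * (1 / (pi * (real n ^ m * (cmod u)\<^sup>2 * (cmod w * cmod w')))) * sqrt (real n)) *
       ((cis (y * real n * Im (Ln w)) * cis (- (y * real n * Im (Ln w')))) * ?sum)"
    unfolding K of_real_mult by (simp only: mult.assoc)
  also have "\<dots> = cis (y * real n * Im (Ln w)) * cis (- (y * real n * Im (Ln w'))) *
       (of_real (1 / (pi * r\<^sup>2 * (cmod u)\<^sup>2 * (cmod w * cmod w'))) * (of_real (1 / sqrt (real n)) * ?sum))"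
    unfolding c of_real_mult by (simp only: mult_ac)
  finally show ?thesis unfolding a_def z_def s_def .
qed

section \<open>Determinants, compact sets and continuous convergence\<close>

lemma det_scale_conjugate:
  fixes A :: "'n::finite \<Rightarrow> 'n \<Rightarrow> 'a::comm_ring_1"
  assumes "\<And>j. c j * d j = 1"
  shows "det (\<chi> j k. s * (c j * d k * A j k)) = s ^ CARD('n) * det (\<chi> j k. A j k)"
proof -
  have "(\<Prod>i\<in>UNIV. s * (c i * d (p i) * A i (p i))) = s ^ CARD('n) * (\<Prod>i\<in>UNIV. A i (p i))"
    if "p permutes UNIV" for p :: "'n \<Rightarrow> 'n"
  proof -
    have "(\<Prod>i\<in>UNIV. d (p i)) = (\<Prod>i\<in>UNIV. d i)" using prod.permute[OF that, of d] by (simp add: o_def)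
    hence "(\<Prod>i\<in>UNIV. c i) * (\<Prod>i\<in>UNIV. d (p i)) = 1" by (simp add: prod.distrib[symmetric] assms)
    moreover have "(\<Prod>i\<in>UNIV. s * (c i * d (p i) * A i (p i))) =
        s ^ CARD('n) * (((\<Prod>i\<in>UNIV. c i) * (\<Prod>i\<in>UNIV. d (p i))) * (\<Prod>i\<in>UNIV. A i (p i)))"
      by (simp add: prod.distrib)
    ultimately show ?thesis by simp
  qed
  thus ?thesis unfolding det_def by (simp add: sum_distrib_left mult_ac)
qed

lemma tendsto_det:
  fixes A :: "'b \<Rightarrow> complex ^ 'n ^ 'n"
  assumes "\<And>i j. ((\<lambda>x. A x $ i $ j) \<longlongrightarrow> B $ i $ j) F"
  shows "((\<lambda>x. det (A x)) \<longlongrightarrow> det B) F"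
  unfolding det_def by (intro tendsto_intros assms)

lemma continuous_on_det:
  fixes A :: "'b::topological_space \<Rightarrow> complex ^ 'n ^ 'n"
  assumes "\<And>i j. continuous_on S (\<lambda>x. A x $ i $ j)"
  shows "continuous_on S (\<lambda>x. det (A x))"
  unfolding det_def by (intro continuous_intros assms)

lemma compact_vec_components:
  fixes S :: "complex set"
  assumes "compact S" shows "compact {v :: complex ^ 'n. \<forall>k. v $ k \<in> S}"
proof -
  obtain B where B: "\<And>x. x \<in> S \<Longrightarrow> norm x \<le> B"
    using compact_imp_bounded[OF assms] unfolding bounded_iff by auto
  have "norm v \<le> real CARD('n) * B" if "\<forall>k. v $ k \<in> S" for v :: "complex ^ 'n"
  proof -
    have "norm v \<le> (\<Sum>i\<in>UNIV. norm (v $ i))" unfolding norm_vec_def by (rule L2_set_le_sum) simp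
    also have "\<dots> \<le> (\<Sum>i\<in>(UNIV::'n set). B)" using that B by (intro sum_mono) auto
    finally show ?thesis by simp
  qed
  hence "bounded {v :: complex ^ 'n. \<forall>k. v $ k \<in> S}" unfolding bounded_iff by auto
  moreover have "closed {v :: complex ^ 'n. \<forall>k. v $ k \<in> S}"
  proof -
    have "{v :: complex ^ 'n. \<forall>k. v $ k \<in> S} = (\<Inter>k. (\<lambda>v. v $ k) -` S)" by auto
    thus ?thesis using compact_imp_closed[OF assms]
      by (auto intro!: closed_INT closed_vimage continuous_intros)
  qed
  ultimately show ?thesis by (simp add: compact_eq_bounded_closed)
qed

text \<open>Continuous convergence on a compact set is uniform: points where uniformity fails would
  have a convergent subsequence, along which both \<open>f n\<close> and \<open>g\<close> tend to
  the value of \<open>g\<close> at the limit point.\<close>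

lemma uniform_limit_compactI:
  fixes f :: "nat \<Rightarrow> 'a::metric_space \<Rightarrow> 'b::metric_space"
  assumes X: "compact X" and g: "continuous_on X g"
    and lim: "\<And>v v0. (\<And>n. v n \<in> X) \<Longrightarrow> v0 \<in> X \<Longrightarrow> v \<longlonglongrightarrow> v0 \<Longrightarrow> (\<lambda>n. f n (v n)) \<longlonglongrightarrow> g v0"
  shows "uniform_limit X f g sequentially"
proof (rule ccontr)
  assume "\<not> uniform_limit X f g sequentially"
  then obtain e where e: "e > 0" "\<exists>\<^sub>F n in sequentially. \<exists>x\<in>X. \<not> dist (f n x) (g x) < e"
    by (auto simp: uniform_limit_iff frequently_def)
  define bad where "bad = {n. \<exists>x\<in>X. \<not> dist (f n x) (g x) < e}"
  have "infinite bad" using e(2) unfolding bad_def by (simp add: frequently_cofinite[symmetric] cofinite_eq_sequentially)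
  then obtain r :: "nat \<Rightarrow> nat" where r: "strict_mono r" "\<And>n. r n \<in> bad" using infinite_enumerate by blast
  have "\<forall>n\<in>bad. \<exists>x\<in>X. \<not> dist (f n x) (g x) < e" by (auto simp: bad_def)
  then obtain w where w: "\<And>n. n \<in> bad \<Longrightarrow> w n \<in> X \<and> \<not> dist (f n (w n)) (g (w n)) < e" by metis
  have "\<forall>n. (w \<circ> r) n \<in> X" using w r by auto
  then obtain v0 s where s: "v0 \<in> X" "strict_mono s" "((w \<circ> r) \<circ> s) \<longlonglongrightarrow> v0"
    using X unfolding compact_def by metis
  define rs where "rs = r \<circ> s"
  have rs: "strict_mono rs" unfolding rs_def using r s by (intro strict_mono_o)
  have rsb: "rs i \<in> bad" for i using r by (simp add: rs_def)
  have wrs: "(\<lambda>i. w (rs i)) \<longlonglongrightarrow> v0" using s by (simp add: rs_def o_def)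
  \<comment> \<open>The hypothesis speaks of sequences indexed by all \<open>n\<close>, so the gaps
    of the subsequence are filled with its limit.\<close>
  define v where "v = (\<lambda>n. if n \<in> range rs then w n else v0)"
  have "v \<longlonglongrightarrow> v0"
  proof (rule metric_LIMSEQ_I)
    fix \<epsilon> :: real assume \<epsilon>: "\<epsilon> > 0"
    obtain i0 where i0: "\<And>i. i \<ge> i0 \<Longrightarrow> dist (w (rs i)) v0 < \<epsilon>"
      using metric_LIMSEQ_D[OF wrs \<epsilon>] by blast
    have "dist (v n) v0 < \<epsilon>" if n: "n \<ge> rs i0" for n
    proof (cases "n \<in> range rs")
      case True
      then obtain i where i: "n = rs i" by blast
      have "i0 \<le> i" using n i rs by (simp add: strict_mono_less_eq)
      thus ?thesis using i0 True by (simp add: v_def i)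
    qed (use \<epsilon> in \<open>simp add: v_def\<close>)
    thus "\<exists>no. \<forall>n\<ge>no. dist (v n) v0 < \<epsilon>" by blast
  qed
  moreover have "v n \<in> X" for n using w rsb s by (auto simp: v_def)
  ultimately have "(\<lambda>n. f n (v n)) \<longlonglongrightarrow> g v0" using s by (intro lim) auto
  from LIMSEQ_subseq_LIMSEQ[OF this rs] have "(\<lambda>i. f (rs i) (w (rs i))) \<longlonglongrightarrow> g v0"
    by (simp add: o_def v_def)
  moreover have "(\<lambda>i. g (w (rs i))) \<longlonglongrightarrow> g v0"
    using g wrs s w rsb by (intro continuous_on_tendsto_compose[OF g wrs]) auto
  ultimately have "(\<lambda>i. dist (f (rs i) (w (rs i))) (g (w (rs i)))) \<longlonglongrightarrow> dist (g v0) (g v0)"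
    by (intro tendsto_dist)
  hence "\<forall>\<^sub>F i in sequentially. dist (f (rs i) (w (rs i))) (g (w (rs i))) < e"
    using e(1) by (intro order_tendstoD) auto
  then obtain i where "dist (f (rs i) (w (rs i))) (g (w (rs i))) < e"
    using eventually_happens'[OF sequentially_bot] by blast
  thus False using w[OF rsb] by blast
qed

text \<open>The scale \<open>rho\<close> is tuned to cancel \<open>S\<close>:
  \<open>1 / (u * rho) = sqrt S * cmod u / u\<close> makes the rescaled logarithms tend to
  \<open>b j * sqrt S\<close>, and \<open>1 / (rho\<^sup>2 * (cmod u)\<^sup>2) = S\<close> is the
  prefactor in \<open>integral_normal_density_product\<close>. The points are \<open>u * W\<close>
  with \<open>W\<close> tending to 1, so the branch of \<open>Ln\<close> causes no trouble.\<close>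

lemma tendsto_rescaled_corr:
  fixes v :: "nat \<Rightarrow> complex ^ 'n"
  assumes m: "m \<ge> 1" and \<delta>: "\<And>k. k \<in> {1..m} \<Longrightarrow> \<delta> k \<ge> 0"
    and y: "0 \<le> y" "y \<le> 1" and \<gamma>: "\<And>k. k \<in> {1..m} \<Longrightarrow> \<delta> k + y > 0"
    and u: "u \<noteq> 0" "(\<Prod>k=1..m. \<delta> k + y) = (cmod u)\<^sup>2"
    and v: "v \<longlonglongrightarrow> v0"
  defines "b \<equiv> \<lambda>j. v0 $ j * of_real (cmod u) / u"
  shows "(\<lambda>n. rescaled_corr m \<delta> u n (v n)) \<longlonglongrightarrow>
     det (\<chi> j k. of_real (1 / pi) * (of_real (exp (- (Re (b j))\<^sup>2 - (Re (b k))\<^sup>2) / sqrt (2 * pi)) * limit_integral y (b j + cnj (b k))))"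
proof -
  define S where "S = (\<Sum>k=1..m. 1 / (\<delta> k + y))"
  have S: "S > 0" unfolding S_def using \<gamma> m by (intro sum_pos) auto
  define r where "r = rho m \<delta> u"
  have r: "r = 1 / (cmod u * sqrt S)" unfolding r_def S_def by (rule rho_saddle[OF m _ u]) (rule \<gamma>)
  have r0: "r > 0" "1 / (r\<^sup>2 * (cmod u)\<^sup>2) = S" using S u by (auto simp: r power_divide power_mult_distrib)
  define W where "W = (\<lambda>n j. 1 + (v n $ j / (u * of_real r)) / of_real (sqrt (real n)))"
  define L where "L = (\<lambda>j n. of_real (sqrt (real n)) * Ln (W n j))"
  have vj: "(\<lambda>n. v n $ j) \<longlonglongrightarrow> v0 $ j" for j using v by (rule tendsto_vec_nth)
  have Llim: "L j \<longlonglongrightarrow> b j * of_real (sqrt S)" for j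
  proof -
    have "((\<lambda>x::complex. Ln (1 + x)) has_field_derivative 1) (at 0)"
      by (auto intro!: derivative_eq_intros)
    moreover have "(\<lambda>n. v n $ j / (u * of_real r)) \<longlonglongrightarrow> v0 $ j / (u * of_real r)"
      using u r0 by (intro tendsto_intros vj) auto
    ultimately have "L j \<longlonglongrightarrow> 1 * (v0 $ j / (u * of_real r))"
      unfolding L_def W_def by (intro tendsto_sqrt_scaled) auto
    also have "1 * (v0 $ j / (u * of_real r)) = b j * of_real (sqrt S)"
      using S u by (simp add: b_def r)
    finally show ?thesis .
  qed
  have Wlim: "(\<lambda>n. W n j) \<longlonglongrightarrow> 1" for j
  proof -
    have "(\<lambda>n. 1 + (v n $ j / (u * of_real r)) * of_real (1 / sqrt (real n))) \<longlonglongrightarrow> 1 + (v0 $ j / (u * of_real r)) * of_real 0"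
      using u r0 by (intro tendsto_intros vj) (auto, real_asymp)
    thus ?thesis by (simp add: W_def divide_inverse)
  qed
  have Wnz: "\<forall>\<^sub>F n in sequentially. \<forall>j. W n j \<noteq> 0"
    using tendsto_imp_eventually_ne[OF Wlim] by (intro eventually_all_finite) auto
  define P where "P = (\<lambda>L n l. loggam_density m (\<lambda>k. \<delta> k * real n) l
      (log_center m \<delta> y n + 2 * Re (L n :: complex) / sqrt (real n)) / sqrt (real n))"
  define B where "B = (\<lambda>n j k. of_real (1 / (pi * r\<^sup>2 * (cmod u)\<^sup>2 * (cmod (W n j) * cmod (W n k)))) *
     (of_real (1 / sqrt (real n)) * (\<Sum>l<n. of_real (sqrt (P (L j) n l * P (L k) n l)) *
        cis ((real l - y * real n) / sqrt (real n) * (Im (L j n) - Im (L k n))))))"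
  have Blim: "(\<lambda>n. B n j k) \<longlonglongrightarrow> of_real (1 / pi) *
      (of_real (exp (- (Re (b j))\<^sup>2 - (Re (b k))\<^sup>2) / sqrt (2 * pi)) * limit_integral y (b j + cnj (b k)))" for j k
  proof -
    let ?I = "\<integral>t. indicator (sum_range y) t *\<^sub>R (of_real (sqrt (normal_density 0 (sqrt S) (2 * Re (b j * of_real (sqrt S)) - t * S) *
        normal_density 0 (sqrt S) (2 * Re (b k * of_real (sqrt S)) - t * S))) *
        cis (t * (Im (b j * of_real (sqrt S)) - Im (b k * of_real (sqrt S))))) \<partial>lborel"
    have "(\<lambda>n. B n j k) \<longlonglongrightarrow> of_real (1 / (pi * r\<^sup>2 * (cmod u)\<^sup>2 * (cmod 1 * cmod (1::complex)))) * ?I"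
      unfolding B_def P_def S_def
    proof (intro tendsto_mult[where g="\<lambda>n. _ * sum _ _"] tendsto_intros Wlim)
      show "pi * r\<^sup>2 * (cmod u)\<^sup>2 * (cmod 1 * cmod (1::complex)) \<noteq> 0" using r0 u by simp
      show "(\<lambda>n. of_real (1 / sqrt (real n)) * (\<Sum>l<n. of_real (sqrt (loggam_density m (\<lambda>k. \<delta> k * real n) l
      (log_center m \<delta> y n + 2 * Re (L j n) / sqrt (real n)) / sqrt (real n) * (loggam_density m (\<lambda>k. \<delta> k * real n) l
      (log_center m \<delta> y n + 2 * Re (L k n) / sqrt (real n)) / sqrt (real n)))) *
        cis ((real l - y * real n) / sqrt (real n) * (Im (L j n) - Im (L k n)))))
       \<longlonglongrightarrow> (\<integral>t. indicator (sum_range y) t *\<^sub>R (of_real (sqrt (normal_density 0 (sqrt (\<Sum>k=1..m. 1 / (\<delta> k + y))) (2 * Re (b j * of_real (sqrt (\<Sum>k=1..m. 1 / (\<delta> k + y)))) - t * (\<Sum>k=1..m. 1 / (\<delta> k + y))) *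
        normal_density 0 (sqrt (\<Sum>k=1..m. 1 / (\<delta> k + y))) (2 * Re (b k * of_real (sqrt (\<Sum>k=1..m. 1 / (\<delta> k + y)))) - t * (\<Sum>k=1..m. 1 / (\<delta> k + y))))) *
        cis (t * (Im (b j * of_real (sqrt (\<Sum>k=1..m. 1 / (\<delta> k + y)))) - Im (b k * of_real (sqrt (\<Sum>k=1..m. 1 / (\<delta> k + y)))))))\<partial>lborel)"
        by (rule tendsto_kernel_sum[OF m _ y _ Llim[unfolded S_def] Llim[unfolded S_def]]) (erule \<delta>, erule \<gamma>)
    qed
    also have "of_real (1 / (pi * r\<^sup>2 * (cmod u)\<^sup>2 * (cmod 1 * cmod (1::complex)))) * ?I = of_real (1 / pi) * (of_real S * ?I)"
    proof -
      have "1 / (pi * r\<^sup>2 * (cmod u)\<^sup>2 * (cmod 1 * cmod (1::complex))) = 1 / pi * S" using r0(2) by (simp add: field_simps)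
      thus ?thesis by (simp only: of_real_mult mult.assoc)
    qed
    also have "of_real S * ?I = of_real (exp (- (Re (b j))\<^sup>2 - (Re (b k))\<^sup>2) / sqrt (2 * pi)) * limit_integral y (b j + cnj (b k))"
      by (rule integral_normal_density_product[OF S])
    finally show ?thesis .
  qed
  have "(\<lambda>n. det (\<chi> j k. B n j k)) \<longlonglongrightarrow> det (\<chi> j k. of_real (1 / pi) *
      (of_real (exp (- (Re (b j))\<^sup>2 - (Re (b k))\<^sup>2) / sqrt (2 * pi)) * limit_integral y (b j + cnj (b k))))"
    by (rule tendsto_det) (simp only: vec_lambda_beta Blim)
  moreover have "\<forall>\<^sub>F n in sequentially. det (\<chi> j k. B n j k) = rescaled_corr m \<delta> u n (v n)"
    using Wnz eventually_gt_at_top[of 0]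
  proof eventually_elim
    case (elim n)
    let ?s = "real n ^ (m - 1) / r\<^sup>2"
    let ?z = "\<lambda>j. of_real (real n powr (real m / 2)) * (u * W n j)"
    let ?K = "\<lambda>j k. corr_kernel m (\<lambda>k. \<delta> k * real n) n (?z j) (?z k)"
    let ?c = "\<lambda>j. cis (y * real n * Im (Ln (W n j)))" and ?d = "\<lambda>j. cis (- (y * real n * Im (Ln (W n j))))"
    have K: "of_real ?s * ?K j k = 1 * (?c j * ?d k * B n j k)" for j k
      unfolding B_def P_def L_def mult_1_left
      by (rule corr_kernel_rescaled[OF m _ _ u]) (use \<delta> \<gamma> elim in auto)
    have rp: "rescaled_point m \<delta> u n (v n $ j) = u * W n j" for j
      using u by (simp add: rescaled_point_def W_def r_def[symmetric] distrib_left)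
    have "rescaled_corr m \<delta> u n (v n) = of_real (real n ^ (CARD('n) * (m - 1)) / r ^ (2 * CARD('n))) * det (\<chi> j k. ?K j k)"
      unfolding rescaled_corr_def corr_fun_def r_def by (simp only: vec_lambda_beta rp)
    also have "of_real (real n ^ (CARD('n) * (m - 1)) / r ^ (2 * CARD('n))) = (of_real ?s :: complex) ^ CARD('n)"
      by (simp only: of_real_power[symmetric] power_divide power_mult[symmetric] mult.commute)
    also have "(of_real ?s) ^ CARD('n) * det (\<chi> j k. ?K j k) = det (\<chi> j k. of_real ?s * (1 * 1 * ?K j k))"
      by (rule det_scale_conjugate[where c="\<lambda>_. 1" and d="\<lambda>_. 1" and A="?K", symmetric]) simp
    also have "\<dots> = det (\<chi> j k. 1 * (?c j * ?d k * B n j k))"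
      by (simp only: mult_1_left K)
    also have "\<dots> = 1 ^ CARD('n) * det (\<chi> j k. B n j k)"
      by (rule det_scale_conjugate[where c="?c" and d="?d" and A="B n"]) (simp add: cis_mult)
    finally show ?case by simp
  qed
  ultimately show ?thesis by (rule Lim_transform_eventually)
qed

text \<open>Because \<open>b\<^sup>2 / 2 - (Re b)\<^sup>2\<close> has real part
  \<open>- (cmod b)\<^sup>2 / 2\<close> and imaginary part \<open>Re b * Im b\<close>, the limit
  kernel equals the stated one up to a second pair of phases, of the kind that cancels in the
  determinant.\<close>

lemma exp_gauge_factor:
  fixes b b' :: complex
  shows "of_real (exp (- (Re b)\<^sup>2 - (Re b')\<^sup>2)) * exp ((b + cnj b')\<^sup>2 / 2)
     = cis (Re b * Im b) * cis (- (Re b' * Im b')) *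
       exp (- (1 / 2) * (of_real ((cmod b)\<^sup>2) + of_real ((cmod b')\<^sup>2) - 2 * b * cnj b'))"
  unfolding cis_conv_exp exp_of_real[symmetric] exp_add[symmetric]
  by (rule arg_cong[where f=exp]) (simp add: complex_eq_iff cmod_power2, simp add: power2_eq_square field_simps)

text \<open>\<open>E\<close> holds what distinguishes the three regimes: the constant
  \<open>1 / pi\<close> in the bulk, a multiple of erfc at an edge. The rotation by
  \<open>cmod u / u\<close> leaves \<open>cmod (b j)\<close> and \<open>b j * cnj (b k)\<close>
  unchanged, so it disappears from the Gaussian factor and survives only inside
  \<open>E\<close>.\<close>

lemma uniform_limit_rescaled_corr:
  fixes S :: "complex set" and E :: "complex \<Rightarrow> complex \<Rightarrow> complex"
  assumes m: "m \<ge> 1" and \<delta>: "\<And>k. k \<in> {1..m} \<Longrightarrow> \<delta> k \<ge> 0" and S: "compact S"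
    and y: "0 \<le> y" "y \<le> 1" and \<gamma>: "\<And>k. k \<in> {1..m} \<Longrightarrow> \<delta> k + y > 0"
    and u: "u \<noteq> 0" "(\<Prod>k=1..m. \<delta> k + y) = (cmod u)\<^sup>2"
    and E: "\<And>b b'. of_real (1 / (pi * sqrt (2 * pi))) * limit_integral y (b + cnj b') = E b b' * exp ((b + cnj b')\<^sup>2 / 2)"
    and contE: "continuous_on UNIV (\<lambda>(b, b'). E b b')"
  shows "uniform_limit {v :: complex ^ 'n. \<forall>k. v $ k \<in> S} (\<lambda>n v. rescaled_corr m \<delta> u n v)
     (\<lambda>v. det (\<chi> k j. exp (- (1 / 2) * (of_real ((cmod (v $ k))\<^sup>2) + of_real ((cmod (v $ j))\<^sup>2) - 2 * (v $ k) * cnj (v $ j))) *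
        E (v $ k * of_real (cmod u) / u) (v $ j * of_real (cmod u) / u))) sequentially"
proof (rule uniform_limit_compactI)
  show "compact {v :: complex ^ 'n. \<forall>k. v $ k \<in> S}" by (rule compact_vec_components[OF S])
  have E': "continuous_on X (\<lambda>x. E (f x) (g x))" if "continuous_on X f" "continuous_on X g" for X :: "(complex ^ 'n) set" and f g
    using continuous_on_compose2[OF contE continuous_on_Pair[OF that]] by simp
  show "continuous_on {v :: complex ^ 'n. \<forall>k. v $ k \<in> S}
     (\<lambda>v. det (\<chi> k j. exp (- (1 / 2) * (of_real ((cmod (v $ k))\<^sup>2) + of_real ((cmod (v $ j))\<^sup>2) - 2 * (v $ k) * cnj (v $ j))) *
        E (v $ k * of_real (cmod u) / u) (v $ j * of_real (cmod u) / u)))"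
    using u(1) by (intro continuous_on_det) (simp only: vec_lambda_beta, intro continuous_intros E', auto)
  fix v :: "nat \<Rightarrow> complex ^ 'n" and v0
  assume v: "v \<longlonglongrightarrow> v0"
  define b where "b = (\<lambda>j. v0 $ j * of_real (cmod u) / u)"
  have cmod_b: "cmod (b j) = cmod (v0 $ j)" for j using u by (simp add: b_def norm_mult norm_divide)
  have b_cnj: "b j * cnj (b k) = v0 $ j * cnj (v0 $ k)" for j k
  proof -
    have "u * cnj u = of_real (cmod u) * of_real (cmod u)" by (simp add: complex_norm_square[symmetric] power2_eq_square)
    thus ?thesis using u by (simp add: b_def field_simps)
  qed
  have entry: "of_real (1 / pi) * (of_real (exp (- (Re (b j))\<^sup>2 - (Re (b k))\<^sup>2) / sqrt (2 * pi)) * limit_integral y (b j + cnj (b k)))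
     = 1 * (cis (Re (b j) * Im (b j)) * cis (- (Re (b k) * Im (b k))) *
       (exp (- (1 / 2) * (of_real ((cmod (v0 $ j))\<^sup>2) + of_real ((cmod (v0 $ k))\<^sup>2) - 2 * (v0 $ j) * cnj (v0 $ k))) * E (b j) (b k)))" for j k
  proof -
    have "of_real (1 / pi) * (of_real (exp (- (Re (b j))\<^sup>2 - (Re (b k))\<^sup>2) / sqrt (2 * pi)) * limit_integral y (b j + cnj (b k)))
       = of_real (exp (- (Re (b j))\<^sup>2 - (Re (b k))\<^sup>2)) * (of_real (1 / (pi * sqrt (2 * pi))) * limit_integral y (b j + cnj (b k)))"
      by simp
    also have "\<dots> = E (b j) (b k) * (of_real (exp (- (Re (b j))\<^sup>2 - (Re (b k))\<^sup>2)) * exp ((b j + cnj (b k))\<^sup>2 / 2))"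
      unfolding E by (simp only: mult_ac)
    finally show ?thesis
      unfolding exp_gauge_factor cmod_b mult.assoc[of 2] b_cnj by (simp only: mult_ac mult_1_left)
  qed
  have "(\<lambda>n. rescaled_corr m \<delta> u n (v n)) \<longlonglongrightarrow>
     det (\<chi> j k. of_real (1 / pi) * (of_real (exp (- (Re (b j))\<^sup>2 - (Re (b k))\<^sup>2) / sqrt (2 * pi)) * limit_integral y (b j + cnj (b k))))"
    unfolding b_def by (rule tendsto_rescaled_corr[OF m _ y _ u v]) (erule \<delta>, erule \<gamma>)
  also have "det (\<chi> j k. of_real (1 / pi) * (of_real (exp (- (Re (b j))\<^sup>2 - (Re (b k))\<^sup>2) / sqrt (2 * pi)) * limit_integral y (b j + cnj (b k))))
     = 1 ^ CARD('n) * det (\<chi> j k. exp (- (1 / 2) * (of_real ((cmod (v0 $ j))\<^sup>2) + of_real ((cmod (v0 $ k))\<^sup>2) - 2 * (v0 $ j) * cnj (v0 $ k))) * E (b j) (b k))"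
    unfolding entry
    by (rule det_scale_conjugate[where c="\<lambda>j. cis (Re (b j) * Im (b j))" and d="\<lambda>j. cis (- (Re (b j) * Im (b j)))"
        and A="\<lambda>j k. exp (- (1 / 2) * (of_real ((cmod (v0 $ j))\<^sup>2) + of_real ((cmod (v0 $ k))\<^sup>2) - 2 * (v0 $ j) * cnj (v0 $ k))) * E (b j) (b k)"])
       (simp add: cis_mult)
  finally show "(\<lambda>n. rescaled_corr m \<delta> u n (v n)) \<longlonglongrightarrow> det (\<chi> k j. exp (- (1 / 2) * (of_real ((cmod (v0 $ k))\<^sup>2) + of_real ((cmod (v0 $ j))\<^sup>2) - 2 * (v0 $ k) * cnj (v0 $ j))) *
        E (v0 $ k * of_real (cmod u) / u) (v0 $ j * of_real (cmod u) / u))"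
    by (simp add: b_def)
qed

theorem theorem1p3:
  fixes m :: nat and \<delta> :: "nat \<Rightarrow> real" and u :: complex and S :: "complex set"
  assumes "m \<ge> 1"
    and "\<And>k. k \<in> {1..m} \<Longrightarrow> \<delta> k \<ge> 0"
    and "u \<noteq> 0"
    and "compact S"
  shows
    "(sqrt (\<Prod>k=1..m. \<delta> k) < cmod u \<and> cmod u < sqrt (\<Prod>k=1..m. 1 + \<delta> k) \<longrightarrow>
        uniform_limit {v :: complex ^ 'n. \<forall>k. v $ k \<in> S}
          (\<lambda>N v. rescaled_corr m \<delta> u N v)
          (\<lambda>v. det (\<chi> k j. 1 / of_real pi *
             exp (- (1 / 2) * (of_real ((cmod (v $ k))\<^sup>2) + of_real ((cmod (v $ j))\<^sup>2)
                               - 2 * (v $ k) * cnj (v $ j)))))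
          sequentially) \<and>
     (\<forall>\<phi>::real. (\<forall>k\<in>{1..m}. \<delta> k > 0) \<and> 0 \<le> \<phi> \<and> \<phi> < 2 * pi \<and>
        u = of_real (sqrt (\<Prod>k=1..m. \<delta> k)) * exp (\<i> * of_real \<phi>) \<longrightarrow>
        uniform_limit {v :: complex ^ 'n. \<forall>k. v $ k \<in> S}
          (\<lambda>N v. rescaled_corr m \<delta> u N v)
          (\<lambda>v. det (\<chi> k j. 1 / (2 * of_real pi) *
             exp (- (1 / 2) * (of_real ((cmod (v $ k))\<^sup>2) + of_real ((cmod (v $ j))\<^sup>2)
                               - 2 * (v $ k) * cnj (v $ j))) *
             erfc (- ((exp (\<i> * of_real \<phi>) * cnj (v $ j) + exp (- \<i> * of_real \<phi>) * v $ k)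
                      / of_real (sqrt 2)))))
          sequentially) \<and>
     (\<forall>\<phi>::real. 0 \<le> \<phi> \<and> \<phi> < 2 * pi \<and>
        u = of_real (sqrt (\<Prod>k=1..m. 1 + \<delta> k)) * exp (\<i> * of_real \<phi>) \<longrightarrow>
        uniform_limit {v :: complex ^ 'n. \<forall>k. v $ k \<in> S}
          (\<lambda>N v. rescaled_corr m \<delta> u N v)
          (\<lambda>v. det (\<chi> k j. 1 / (2 * of_real pi) *
             exp (- (1 / 2) * (of_real ((cmod (v $ k))\<^sup>2) + of_real ((cmod (v $ j))\<^sup>2)
                               - 2 * (v $ k) * cnj (v $ j))) *
             erfc ((exp (\<i> * of_real \<phi>) * cnj (v $ j) + exp (- \<i> * of_real \<phi>) * v $ k)
                   / of_real (sqrt 2))))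
          sequentially)"
proof (intro conjI impI allI)
  note m = assms(1) and \<delta> = assms(2) and S = assms(4)
  have half: "of_real (1 / (pi * sqrt (2 * pi))) * (of_real (sqrt (pi / 2)) * a * c) = 1 / (2 * of_real pi) * c * a" for a c :: complex
  proof -
    have "1 / (pi * sqrt (2 * pi)) * sqrt (pi / 2) = 1 / (2 * pi)"
      by (simp add: real_sqrt_mult real_sqrt_divide)
    hence A: "of_real (1 / (pi * sqrt (2 * pi))) * of_real (sqrt (pi / 2)) = (1 / (2 * of_real pi) :: complex)"
      unfolding of_real_mult[symmetric] by simp
    show ?thesis unfolding A[symmetric] by (simp only: mult_ac)
  qed
  have phase: "v * of_real (cmod u) / u = exp (- \<i> * of_real \<phi>) * v" if "u = of_real R * exp (\<i> * of_real \<phi>)" "R \<ge> 0" for R \<phi> v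
  proof -
    have "cmod u = R" using that by (simp add: norm_mult)
    moreover have "R \<noteq> 0" using that assms(3) by auto
    ultimately show ?thesis by (subst (2) that(1)) (simp add: exp_minus field_simps)
  qed
  have phase': "cnj (exp (- \<i> * of_real \<phi>) * v) = exp (\<i> * of_real \<phi>) * cnj v" for \<phi> v
    by (simp add: exp_cnj)
  {
    assume "sqrt (\<Prod>k=1..m. \<delta> k) < cmod u \<and> cmod u < sqrt (\<Prod>k=1..m. 1 + \<delta> k)"
    hence "sqrt (\<Prod>k=1..m. \<delta> k) < sqrt ((cmod u)\<^sup>2)" "sqrt ((cmod u)\<^sup>2) < sqrt (\<Prod>k=1..m. 1 + \<delta> k)"
      by (simp_all only: real_sqrt_abs abs_norm_cancel)
    hence "(\<Prod>k=1..m. \<delta> k) < (cmod u)\<^sup>2" "(cmod u)\<^sup>2 < (\<Prod>k=1..m. 1 + \<delta> k)"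
      by (simp_all only: real_sqrt_less_iff)
    \<comment> \<open>Strict inequalities for \<open>cmod u\<close> put the saddle strictly inside
      the summation range, hence the integral over the whole line.\<close>
    then obtain y where y: "0 < y" "y < 1" "(\<Prod>k=1..m. \<delta> k + y) = (cmod u)\<^sup>2" by (rule saddle_exists)
    have "uniform_limit {v :: complex ^ 'n. \<forall>k. v $ k \<in> S} (\<lambda>n v. rescaled_corr m \<delta> u n v)
     (\<lambda>v. det (\<chi> k j. exp (- (1 / 2) * (of_real ((cmod (v $ k))\<^sup>2) + of_real ((cmod (v $ j))\<^sup>2) - 2 * (v $ k) * cnj (v $ j))) *
        (1 / of_real pi))) sequentially"
    proof (rule uniform_limit_rescaled_corr[where E="\<lambda>_ _. 1 / of_real pi", OF m _ S _ _ _ assms(3) y(3)])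
      show "of_real (1 / (pi * sqrt (2 * pi))) * limit_integral y (b + cnj b') = 1 / of_real pi * exp ((b + cnj b')\<^sup>2 / 2)" for b b'
        unfolding limit_integral_bulk[OF y(1,2)] by simp
    qed (use y \<delta> in \<open>auto intro: add_nonneg_pos\<close>)
    thus "uniform_limit {v :: complex ^ 'n. \<forall>k. v $ k \<in> S}
          (\<lambda>N v. rescaled_corr m \<delta> u N v)
          (\<lambda>v. det (\<chi> k j. 1 / of_real pi *
             exp (- (1 / 2) * (of_real ((cmod (v $ k))\<^sup>2) + of_real ((cmod (v $ j))\<^sup>2)
                               - 2 * (v $ k) * cnj (v $ j)))))
          sequentially"
      by (simp only: mult.commute)
  next
    fix \<phi> :: real
    assume h: "(\<forall>k\<in>{1..m}. \<delta> k > 0) \<and> 0 \<le> \<phi> \<and> \<phi> < 2 * pi \<and>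
        u = of_real (sqrt (\<Prod>k=1..m. \<delta> k)) * exp (\<i> * of_real \<phi>)"
    have P0: "(\<Prod>k=1..m. \<delta> k) \<ge> 0" using \<delta> by (intro prod_nonneg) auto
    have "cmod u = sqrt (\<Prod>k=1..m. \<delta> k)" using h P0 by (simp add: norm_mult)
    \<comment> \<open>The inner edge is the saddle \<open>y = 0\<close>; the condition
      \<open>\<delta> k + y > 0\<close> then becomes the assumption
      \<open>\<delta> k > 0\<close>.\<close>
    hence u2: "(\<Prod>k=1..m. \<delta> k + 0) = (cmod u)\<^sup>2" using P0 by simp
    note ph = phase[of "sqrt (\<Prod>k=1..m. \<delta> k)" \<phi>]
    have "uniform_limit {v :: complex ^ 'n. \<forall>k. v $ k \<in> S} (\<lambda>n v. rescaled_corr m \<delta> u n v)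
     (\<lambda>v. det (\<chi> k j. exp (- (1 / 2) * (of_real ((cmod (v $ k))\<^sup>2) + of_real ((cmod (v $ j))\<^sup>2) - 2 * (v $ k) * cnj (v $ j))) *
        (1 / (2 * of_real pi) * erfc (- (v $ k * of_real (cmod u) / u + cnj (v $ j * of_real (cmod u) / u)) / of_real (sqrt 2))))) sequentially"
    proof (rule uniform_limit_rescaled_corr[where E="\<lambda>b b'. 1 / (2 * of_real pi) * erfc (- (b + cnj b') / of_real (sqrt 2))", OF m _ S _ _ _ assms(3) u2])
      show "of_real (1 / (pi * sqrt (2 * pi))) * limit_integral 0 (b + cnj b')
          = 1 / (2 * of_real pi) * erfc (- (b + cnj b') / of_real (sqrt 2)) * exp ((b + cnj b')\<^sup>2 / 2)" for b b'
        unfolding limit_integral_inner by (rule half)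
      show "continuous_on UNIV (\<lambda>(b, b'). 1 / (2 * of_real pi) * erfc (- (b + cnj b') / of_real (sqrt 2)))"
        unfolding case_prod_beta by (intro continuous_intros) auto
    qed (use h \<delta> in auto)
    moreover have "exp (- (1 / 2) * (of_real ((cmod (v $ k))\<^sup>2) + of_real ((cmod (v $ j))\<^sup>2) - 2 * (v $ k) * cnj (v $ j))) *
        (1 / (2 * of_real pi) * erfc (- (v $ k * of_real (cmod u) / u + cnj (v $ j * of_real (cmod u) / u)) / of_real (sqrt 2)))
      = 1 / (2 * of_real pi) *
             exp (- (1 / 2) * (of_real ((cmod (v $ k))\<^sup>2) + of_real ((cmod (v $ j))\<^sup>2)
                               - 2 * (v $ k) * cnj (v $ j))) *
             erfc (- ((exp (\<i> * of_real \<phi>) * cnj (v $ j) + exp (- \<i> * of_real \<phi>) * v $ k)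
                      / of_real (sqrt 2)))" for v :: "complex ^ 'n" and k j
    proof -
      have u: "u = of_real (sqrt (\<Prod>k=1..m. \<delta> k)) * exp (\<i> * of_real \<phi>)" "sqrt (\<Prod>k=1..m. \<delta> k) \<ge> 0" using h P0 by auto
      have "- (exp (- \<i> * of_real \<phi>) * v $ k + exp (\<i> * of_real \<phi>) * cnj (v $ j)) / of_real (sqrt 2)
         = - ((exp (\<i> * of_real \<phi>) * cnj (v $ j) + exp (- \<i> * of_real \<phi>) * v $ k) / of_real (sqrt 2))"
        by (simp only: add.commute minus_divide_left)
      thus ?thesis unfolding ph[OF u] phase' by (simp only: mult_ac)
    qed
    ultimately show "uniform_limit {v :: complex ^ 'n. \<forall>k. v $ k \<in> S}
          (\<lambda>N v. rescaled_corr m \<delta> u N v)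
          (\<lambda>v. det (\<chi> k j. 1 / (2 * of_real pi) *
             exp (- (1 / 2) * (of_real ((cmod (v $ k))\<^sup>2) + of_real ((cmod (v $ j))\<^sup>2)
                               - 2 * (v $ k) * cnj (v $ j))) *
             erfc (- ((exp (\<i> * of_real \<phi>) * cnj (v $ j) + exp (- \<i> * of_real \<phi>) * v $ k)
                      / of_real (sqrt 2)))))
          sequentially" by (simp only:)
  next
    fix \<phi> :: real
    assume h: "0 \<le> \<phi> \<and> \<phi> < 2 * pi \<and>
        u = of_real (sqrt (\<Prod>k=1..m. 1 + \<delta> k)) * exp (\<i> * of_real \<phi>)"
    have P0: "(\<Prod>k=1..m. 1 + \<delta> k) \<ge> 0" using \<delta> by (intro prod_nonneg) (auto intro: add_nonneg_nonneg)
    have "cmod u = sqrt (\<Prod>k=1..m. 1 + \<delta> k)" using h P0 by (simp add: norm_mult)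
    \<comment> \<open>The outer edge is the saddle \<open>y = 1\<close>, where
      \<open>\<delta> k + y > 0\<close> is automatic.\<close>
    hence u2: "(\<Prod>k=1..m. \<delta> k + 1) = (cmod u)\<^sup>2" using P0 by (simp add: add.commute)
    note ph = phase[of "sqrt (\<Prod>k=1..m. 1 + \<delta> k)" \<phi>]
    have "uniform_limit {v :: complex ^ 'n. \<forall>k. v $ k \<in> S} (\<lambda>n v. rescaled_corr m \<delta> u n v)
     (\<lambda>v. det (\<chi> k j. exp (- (1 / 2) * (of_real ((cmod (v $ k))\<^sup>2) + of_real ((cmod (v $ j))\<^sup>2) - 2 * (v $ k) * cnj (v $ j))) *
        (1 / (2 * of_real pi) * erfc ((v $ k * of_real (cmod u) / u + cnj (v $ j * of_real (cmod u) / u)) / of_real (sqrt 2))))) sequentially"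
    proof (rule uniform_limit_rescaled_corr[where E="\<lambda>b b'. 1 / (2 * of_real pi) * erfc ((b + cnj b') / of_real (sqrt 2))", OF m _ S _ _ _ assms(3) u2])
      show "of_real (1 / (pi * sqrt (2 * pi))) * limit_integral 1 (b + cnj b')
          = 1 / (2 * of_real pi) * erfc ((b + cnj b') / of_real (sqrt 2)) * exp ((b + cnj b')\<^sup>2 / 2)" for b b'
        unfolding limit_integral_outer by (rule half)
      show "continuous_on UNIV (\<lambda>(b, b'). 1 / (2 * of_real pi) * erfc ((b + cnj b') / of_real (sqrt 2)))"
        unfolding case_prod_beta by (intro continuous_intros) auto
    qed (use h \<delta> in \<open>auto intro: add_nonneg_pos\<close>)
    moreover have "exp (- (1 / 2) * (of_real ((cmod (v $ k))\<^sup>2) + of_real ((cmod (v $ j))\<^sup>2) - 2 * (v $ k) * cnj (v $ j))) *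
        (1 / (2 * of_real pi) * erfc ((v $ k * of_real (cmod u) / u + cnj (v $ j * of_real (cmod u) / u)) / of_real (sqrt 2)))
      = 1 / (2 * of_real pi) *
             exp (- (1 / 2) * (of_real ((cmod (v $ k))\<^sup>2) + of_real ((cmod (v $ j))\<^sup>2)
                               - 2 * (v $ k) * cnj (v $ j))) *
             erfc ((exp (\<i> * of_real \<phi>) * cnj (v $ j) + exp (- \<i> * of_real \<phi>) * v $ k)
                   / of_real (sqrt 2))" for v :: "complex ^ 'n" and k j
    proof -
      have u: "u = of_real (sqrt (\<Prod>k=1..m. 1 + \<delta> k)) * exp (\<i> * of_real \<phi>)" "sqrt (\<Prod>k=1..m. 1 + \<delta> k) \<ge> 0" using h P0 by auto
      show ?thesis unfolding ph[OF u] phase' by (simp only: mult_ac add.commute)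
    qed
    ultimately show "uniform_limit {v :: complex ^ 'n. \<forall>k. v $ k \<in> S}
          (\<lambda>N v. rescaled_corr m \<delta> u N v)
          (\<lambda>v. det (\<chi> k j. 1 / (2 * of_real pi) *
             exp (- (1 / 2) * (of_real ((cmod (v $ k))\<^sup>2) + of_real ((cmod (v $ j))\<^sup>2)
                               - 2 * (v $ k) * cnj (v $ j))) *
             erfc ((exp (\<i> * of_real \<phi>) * cnj (v $ j) + exp (- \<i> * of_real \<phi>) * v $ k)
                   / of_real (sqrt 2))))
          sequentially" by (simp only:)
  }
qed

end
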